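(* Let $n\ge 3$. There exists $\lambda^{*}=\lambda^{*}(n)>0$ such that, for every $0<\lambda\le\lambda^{*}$, $$\underline{\partial_s}\mathcal A[f](0^+)\ \ge\ 0\qquad\text{for all } f\in C^{0,1}_c(\overline\Sigma),$$ and the inequality is strict whenever $f$ is not identically zero (which means that $\Sigma$ is strictly stable in the cone $\Omega_\lambda$).
   Context: Let $n\ge2$ be an integer and $\lambda>0$. Write points of $\mathbb R^{n+1}$ as $(x',x_n,x_{n+1})$ with $x'\in\mathbb R^{n-1}$. Let $\omega_\lambda(x',x_{n+1})=\lambda\sqrt{|x'|^2+x_{n+1}^2}$, let $$\Omega_\lambda=\{(x',x_n,x_{n+1})\in\mathbb R^{n+1}: x_n>\omega_\lambda(x',x_{n+1})\}$$ (a convex circular cone), and let $\Sigma=\Omega_\lambda\cap\{x_{n+1}=0\}$. A point $x=(x',x_n)\in\mathbb R^n$ is identified with $(x,0)\in\mathbb R^{n+1}$, so that $\Sigma=\{(x',x_n)\in\mathbb R^n: x_n>\lambda|x'|\}$ and $\overline\Sigma=\{x_n\ge\lambda|x'|\}$. $C^{0,1}_c(\overline\Sigma)$ is the set of Lipschitz functions $f:\overline\Sigma\to\mathbb R$ whose support $\operatorname{spt}(f)$ is a compact subset of $\overline\Sigma$ (so $f$ need not vanish on $\partial\Sigma$). For $f\in C^{0,1}_c(\overline\Sigma)$, $x\in\overline\Sigma$, $t\in\mathbb R$, define the flow $$\Phi[f](x,t)=\Big(x',\ x_n+\lambda\sqrt{|x'|^2+t^2f(x)^2}-\lambda|x'|,\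 t f(x)\Big)\in\mathbb R^{n+1},$$ the area $A[f](t)=\mathcal H^n\big(\Phi[f](\Sigma\cap\operatorname{spt}(f),t)\big)$ (with $\mathcal H^n$ the $n$-dimensional Hausdorff measure), and, for $s\ge0$, $\mathcal A[f](s)=A[f](\sqrt s)$. The lower right derivative at $0$ is $$\underline{\partial_s}\mathcal A[f](0^+)=\liminf_{s\to0^+}\frac{\mathcal A[f](s)-\mathcal A[f](0)}{s}\in[-\infty,+\infty].$$ *)

theory Defs
  imports "HOL-Analysis.Analysis"
begin

(* R^(n-1) is real ^ 'm with CARD('m) = n - 1, R^n is (real ^ 'm) \<times> real and R^(n+1) is
   ((real ^ 'm) \<times> real) \<times> real; the product norms are Euclidean.  A point x of R^n is
   identified with (x, 0). *)

(* The n-dimensional Hausdorff (outer) measure, n \<ge> 1, normalised so that the unit ball of R^n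
   has measure unit_ball_vol n.  Covering sets are required to be bounded because
   diameter is meaningless on unbounded sets. *)
definition hausdorff_premeasure :: "nat \<Rightarrow> real \<Rightarrow> 'a::metric_space set \<Rightarrow> ennreal" where
  "hausdorff_premeasure n \<delta> S =
     (INF C \<in> {C :: nat \<Rightarrow> 'a set. S \<subseteq> (\<Union>i. C i) \<and> (\<forall>i. bounded (C i) \<and> diameter (C i) \<le> \<delta>)}.
        \<Sum>i. ennreal (unit_ball_vol (real n) * (diameter (C i) / 2) ^ n))"

definition hausdorff_measure :: "nat \<Rightarrow> 'a::metric_space set \<Rightarrow> ennreal" where
  "hausdorff_measure n S = (SUP \<delta> \<in> {0<..}. hausdorff_premeasure n \<delta> S)"

definition omega :: "real \<Rightarrow> real ^ 'm \<Rightarrow> real \<Rightarrow> real" where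
  "omega lam x' z = lam * sqrt ((norm x')\<^sup>2 + z\<^sup>2)"

definition Omega :: "real \<Rightarrow> (((real ^ 'm) \<times> real) \<times> real) set" where
  "Omega lam = {((x', y), z) | x' y z. y > omega lam x' z}"

definition Sigma_cone :: "real \<Rightarrow> ((real ^ 'm) \<times> real) set" where
  "Sigma_cone lam = {x. (x, 0) \<in> Omega lam}"

lemma Sigma_cone_eq: "Sigma_cone lam = {(x', y). y > lam * norm x'}"
  by (auto simp: Sigma_cone_def Omega_def omega_def)

lemma closure_Sigma_cone_eq: "closure (Sigma_cone lam) = {(x', y). y \<ge> lam * norm x'}"
proof
  have "closed {p :: (real ^ 'm) \<times> real. lam * norm (fst p) \<le> snd p}"
    by (intro closed_Collect_le continuous_intros)
  then show "closure (Sigma_cone lam) \<subseteq> {(x' :: real ^ 'm, y). y \<ge> lam * norm x'}"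
    by (intro closure_minimal) (auto simp: Sigma_cone_eq case_prod_unfold)
next
  show "{(x' :: real ^ 'm, y). y \<ge> lam * norm x'} \<subseteq> closure (Sigma_cone lam)"
  proof clarify
    fix x' :: "real ^ 'm" and y assume y: "lam * norm x' \<le> y"
    have "(\<lambda>k. (x', y + inverse (real (Suc k)))) \<longlonglongrightarrow> (x', y + 0)"
      by (intro tendsto_intros LIMSEQ_inverse_real_of_nat)
    moreover have "(x', y + inverse (real (Suc k))) \<in> Sigma_cone lam" for k
      using y by (simp add: Sigma_cone_eq add_strict_increasing2 add.commute le_less_trans)
    ultimately show "(x', y) \<in> closure (Sigma_cone lam)"
      unfolding closure_sequential by force
  qed
qed

(* Functions on the closed cone are represented by total functions, of which only the values on
   closure (Sigma_cone lam) are ever used. *)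
definition spt :: "real \<Rightarrow> ((real ^ 'm) \<times> real \<Rightarrow> real) \<Rightarrow> ((real ^ 'm) \<times> real) set" where
  "spt lam f = closure {x \<in> closure (Sigma_cone lam). f x \<noteq> 0}"

definition Lipschitz_compact :: "real \<Rightarrow> ((real ^ 'm) \<times> real \<Rightarrow> real) set" where
  "Lipschitz_compact lam =
     {f. (\<exists>L. L-lipschitz_on (closure (Sigma_cone lam)) f) \<and> compact (spt lam f)}"

definition Phi :: "real \<Rightarrow> ((real ^ 'm) \<times> real \<Rightarrow> real) \<Rightarrow> (real ^ 'm) \<times> real \<Rightarrow> real
    \<Rightarrow> ((real ^ 'm) \<times> real) \<times> real" where
  "Phi lam f x t =
     ((fst x, snd x + lam * sqrt ((norm (fst x))\<^sup>2 + t\<^sup>2 * (f x)\<^sup>2) - lam * norm (fst x)), t * f x)"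

definition area :: "real \<Rightarrow> ((real ^ 'm) \<times> real \<Rightarrow> real) \<Rightarrow> real \<Rightarrow> ennreal" where
  "area lam f t =
     hausdorff_measure (CARD('m) + 1) ((\<lambda>x. Phi lam f x t) ` (Sigma_cone lam \<inter> spt lam f))"

definition area_sqrt :: "real \<Rightarrow> ((real ^ 'm) \<times> real \<Rightarrow> real) \<Rightarrow> real \<Rightarrow> ennreal" where
  "area_sqrt lam f s = area lam f (sqrt s)"

(* For f in Lipschitz_compact lam all areas are finite (Lipschitz images of bounded sets), so the
   convention for \<infinity> - \<infinity> in ereal plays no role. *)
definition lower_right_deriv_0 :: "(real \<Rightarrow> ennreal) \<Rightarrow> ereal" where
  "lower_right_deriv_0 F =
     Liminf (at_right 0) (\<lambda>s. (enn2ereal (F s) - enn2ereal (F 0)) / ereal s)"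

end

theory Submission
  imports Defs
begin

text \<open>At time \<open>t\<close> the moved surface is the graph of \<open>t v\<close>, with \<open>v\<close> uniformly close to \<open>f\<close>, over a base
  that has lost the volume \<open>t\<^sup>2 (\<lambda>/2) B\<close> to leading order, where \<open>B = \<integral> f(y, \<lambda>|y|)\<^sup>2 / |y| dy\<close>
  is a boundary integral. The gain from the slope of the graph is bounded below without an area formula: over
  small boxes the graph is projected orthogonally to hyperplanes of slope \<open>t \<phi>\<close> in a coordinate direction
  \<open>e\<close>. Projections are 1-Lipschitz and the Hausdorff measure dominates Lebesgue measure (isodiametric
  inequality, here from the multiplicative Brunn-Minkowski inequality for unions of boxes), so the gain is at least
  \<open>t\<^sup>2 (\<integral> \<phi> \<partial>\<^sub>e f - \<integral> \<phi>\<^sup>2 / 2)\<close>, where difference quotients replace \<open>\<partial>\<^sub>e f\<close>.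

  Take \<open>\<phi> = \<epsilon> f A\<^sub>e\<close> with a vector field \<open>A\<close> whose divergence is at most \<open>-1/(|x|\<^sup>2 + \<eta>\<^sup>2)\<close> and whose
  flux through the boundary of the cone controls \<open>1/|y|\<close>. Integrating
  \<open>f A\<^sub>e \<partial>\<^sub>e f = A\<^sub>e \<partial>\<^sub>e (f\<^sup>2) / 2\<close> by parts and summing over \<open>e\<close> gives, for small \<open>\<epsilon>\<close>, a trace Hardy
  inequality: the total gain is at least a multiple of \<open>\<epsilon>\<close> times \<open>B + \<integral> f\<^sup>2 / (|x|\<^sup>2 + 1)\<close>, up to an error
  that vanishes as \<open>\<eta> \<rightarrow> 0\<close>. Some direction \<open>e\<close> attains at least the average, which beats the loss as soon
  as \<open>\<lambda>\<close> is small compared with \<open>\<epsilon>/n\<close>.\<close>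

subsection \<open>The isodiametric inequality\<close>

text \<open>\<open>f\<close> is only Lipschitz and need not vanish on the boundary of the cone. Near
  the boundary the flow lifts the base by about
  \<open>\<lambda> t\<^sup>2 f\<^sup>2 / (2 |y|)\<close>, a loss of the same order
  \<open>t\<^sup>2\<close> as the Dirichlet gain. Its weight \<open>1 / |y|\<close> is locally
  integrable in dimension \<open>n - 1 \<ge> 2\<close>; this is where \<open>n \<ge> 3\<close>
  enters, besides the sign of a divergence. The loss carries the factor \<lambda> and the Hardy gain
  does not, hence the threshold. For a slope \<open>p\<close> one has
  \<open>p\<^sup>2 / 2 \<ge> \<phi> p - \<phi>\<^sup>2 / 2\<close>. The right-hand side is linear in
  \<open>p\<close>, so with difference quotients for \<open>p\<close> it passes to the limit when
  the heights merely converge uniformly. Taking \<phi> proportional to \<open>f A\<^sub>e\<close> is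
  the vector field method for Hardy inequalities. A tilt in one coordinate direction acts along the
  lines parallel to it, so the area of a projection is found by the intermediate value theorem and
  Fubini. The price is that one direction does the work of all \<open>n\<close>: the average loses a
  factor \<open>n\<close>, which goes into the threshold for \<lambda>.\<close>

definition midpoints :: "'a::real_vector set \<Rightarrow> 'a set \<Rightarrow> 'a set" where
  "midpoints A B = (\<Union>a\<in>A. (\<lambda>b. (1/2) *\<^sub>R (a + b)) ` B)"

lemma mem_midpoints: "x \<in> midpoints A B \<longleftrightarrow> (\<exists>a\<in>A. \<exists>b\<in>B. x = (1/2) *\<^sub>R (a + b))"
  by (auto simp: midpoints_def)

lemma midpoints_commute: "midpoints A B = midpoints B A"
  unfolding set_eq_iff mem_midpoints by (metis add.commute)

lemma midpoints_mono: "A \<subseteq> A' \<Longrightarrow> B \<subseteq> B' \<Longrightarrow> midpoints A B \<subseteq> midpoints A' B'"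
  unfolding midpoints_def by blast

lemma open_midpoints:
  fixes A B :: "'a::real_normed_vector set"
  assumes "open B"
  shows "open (midpoints A B)"
proof -
  have "open ((\<lambda>b. (1/2) *\<^sub>R (a + b)) ` B)" for a :: 'a
    using open_affinity[OF assms, of "1/2" "(1/2) *\<^sub>R a"] by (simp add: scaleR_right_distrib)
  then show ?thesis
    unfolding midpoints_def by (intro open_UN) auto
qed

lemma bounded_midpoints:
  fixes A B :: "'a::real_normed_vector set"
  assumes "bounded A" "bounded B"
  shows "bounded (midpoints A B)"
proof -
  obtain r s where r: "\<And>a. a \<in> A \<Longrightarrow> norm a \<le> r" and s: "\<And>b. b \<in> B \<Longrightarrow> norm b \<le> s"
    using assms by (meson bounded_iff)
  have "norm x \<le> (r + s) / 2" if x: "x \<in> midpoints A B" for x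
  proof -
    obtain a b where "a \<in> A" "b \<in> B" and x: "x = (1/2) *\<^sub>R (a + b)"
      using x by (auto simp: mem_midpoints)
    then have "norm (a + b) \<le> r + s"
      by (intro norm_triangle_le add_mono r s)
    then show ?thesis by (simp add: x)
  qed
  then show ?thesis unfolding bounded_iff by blast
qed

section \<open>Cutting bounded sets by coordinate hyperplanes\<close>

lemma fmeasurable_bounded_borel:
  fixes S :: "'a::euclidean_space set"
  shows "bounded S \<Longrightarrow> S \<in> sets borel \<Longrightarrow> S \<in> fmeasurable lborel"
  using emeasure_bounded_finite[of S] by (intro fmeasurableI) auto

lemma measure_disjoint_Un:
  "A \<in> fmeasurable M \<Longrightarrow> B \<in> fmeasurable M \<Longrightarrow> A \<inter> B = {} \<Longrightarrow>
    measure M (A \<union> B) = measure M A + measure M B"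
  by (intro measure_Union) (auto simp: fmeasurable_def)

lemma measure_open_pos:
  fixes S :: "'a::euclidean_space set"
  assumes "bounded S" "open S" "S \<noteq> {}"
  shows "0 < measure lborel S"
proof -
  have "measure lebesgue S \<noteq> 0"
    using open_not_negligible[OF assms(2,3)] assms lmeasurable_open negligible_iff_measure by blast
  then show ?thesis
    using assms by (simp add: measure_completion zero_less_measure_iff)
qed

text \<open>A bounded set lies in a box, and thin slabs of a box have small volume; two neighbouring
  cuts differ by at most the volume of such a slab.\<close>

lemma measure_halfspace_continuous:
  fixes B :: "'a::euclidean_space set"
  assumes B: "bounded B" "B \<in> sets borel" and i: "i \<in> Basis"
  shows "continuous_on UNIV (\<lambda>c. measure lborel (B \<inter> {x. x \<bullet> i < c}))"
proof -
  obtain a b where ab: "B \<subseteq> cbox a b"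
    using B bounded_subset_cbox_symmetric by blast
  have fm: "B \<inter> S \<in> fmeasurable lborel" if "S \<in> sets borel" for S
    using B that by (intro fmeasurable_bounded_borel) auto
  have "\<exists>d>0. \<forall>c'. dist c' c < d \<longrightarrow>
      dist (measure lborel (B \<inter> {x. x \<bullet> i < c'})) (measure lborel (B \<inter> {x. x \<bullet> i < c})) < e"
    if "e > 0" for c e
  proof -
    obtain d where d: "d > 0" and less: "measure lborel (cbox a b \<inter> {x. \<bar>x \<bullet> i - c\<bar> \<le> d}) < e"
      using content_doublesplit[OF \<open>e > 0\<close> i] by blast
    let ?D = "cbox a b \<inter> {x. \<bar>x \<bullet> i - c\<bar> \<le> d}"
    have D: "?D \<in> fmeasurable lborel"
      by (intro fmeasurable_bounded_borel) auto
    have step: "measure lborel (B \<inter> {x. x \<bullet> i < u}) \<le> measure lborel (B \<inter> {x. x \<bullet> i < v}) + measure lborel ?D"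
      if "\<bar>u - c\<bar> < d" "\<bar>v - c\<bar> < d" for u v
    proof -
      have "B \<inter> {x. x \<bullet> i < u} \<subseteq> (B \<inter> {x. x \<bullet> i < v}) \<union> ?D"
        using ab that by (auto simp: abs_le_iff)
      then have "measure lborel (B \<inter> {x. x \<bullet> i < u}) \<le> measure lborel ((B \<inter> {x. x \<bullet> i < v}) \<union> ?D)"
        by (intro measure_mono_fmeasurable fmeasurable.Un D fm) (use B in auto)
      also have "\<dots> \<le> measure lborel (B \<inter> {x. x \<bullet> i < v}) + measure lborel ?D"
        by (intro measure_Un_le) (use B D in \<open>auto simp: fmeasurable_def\<close>)
      finally show ?thesis .
    qed
    have "dist (measure lborel (B \<inter> {x. x \<bullet> i < c'})) (measure lborel (B \<inter> {x. x \<bullet> i < c})) < e"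
      if "dist c' c < d" for c'
      using step[of c' c] step[of c c'] that d less by (auto simp: dist_real_def)
    then show ?thesis using d by blast
  qed
  then show ?thesis unfolding continuous_on_iff by auto
qed

lemma measure_split_halfspace:
  fixes B :: "'a::euclidean_space set"
  assumes B: "bounded B" "B \<in> sets borel" and i: "i \<in> Basis"
  shows "measure lborel B = measure lborel (B \<inter> {x. x \<bullet> i < c}) + measure lborel (B \<inter> {x. x \<bullet> i > c})"
proof -
  have fm: "B \<inter> S \<in> fmeasurable lborel" if "S \<in> sets borel" for S
    using B that by (intro fmeasurable_bounded_borel) auto
  have "{x. x \<bullet> i = c} \<in> null_sets lborel"
    using negligible_standard_hyperplane[OF i, of c]
    by (auto simp: negligible_iff_null_sets null_sets_completion_iff closed_hyperplane borel_closed closed_Collect_eq continuous_intros)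
  then have "measure lborel B = measure lborel (B - {x. x \<bullet> i = c})"
    using B by (subst measure_Diff_null_set) auto
  also have "B - {x. x \<bullet> i = c} = (B \<inter> {x. x \<bullet> i < c}) \<union> (B \<inter> {x. x \<bullet> i > c})"
    by auto
  also have "measure lborel \<dots> = measure lborel (B \<inter> {x. x \<bullet> i < c}) + measure lborel (B \<inter> {x. x \<bullet> i > c})"
    by (intro measure_disjoint_Un fm) auto
  finally show ?thesis .
qed

text \<open>The measure below the hyperplane moves continuously from zero to the full measure, so
  the intermediate value theorem gives any proportion. In the Brunn-Minkowski induction the second
  set is cut in the proportion of the first.\<close>

lemma measure_halfspace_ratio:
  fixes B :: "'a::euclidean_space set"
  assumes B: "bounded B" "B \<in> sets borel" and i: "i \<in> Basis" and th: "0 \<le> th" "th \<le> 1"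
  obtains c where "measure lborel (B \<inter> {x. x \<bullet> i < c}) = th * measure lborel B"
    "measure lborel (B \<inter> {x. x \<bullet> i > c}) = (1 - th) * measure lborel B"
proof -
  obtain R where R: "\<And>x. x \<in> B \<Longrightarrow> norm x \<le> R"
    using B by (meson bounded_iff)
  have ab: "\<bar>x \<bullet> i\<bar> \<le> R" if "x \<in> B" for x
    using R[OF that] Basis_le_norm[OF i, of x] by linarith
  let ?g = "\<lambda>c. measure lborel (B \<inter> {x. x \<bullet> i < c})"
  have 1: "B \<inter> {x. x \<bullet> i < - R} = {}" "B \<inter> {x. x \<bullet> i < \<bar>R\<bar> + 1} = B"
    using ab by fastforce+
  have "measure lborel B * th \<le> measure lborel B * 1"
    by (intro mult_left_mono th) auto
  then have "\<exists>c\<ge>- \<bar>R\<bar> - 1. c \<le> \<bar>R\<bar> + 1 \<and> ?g c = th * measure lborel B"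
  proof (intro IVT')
    have "B \<inter> {x. x \<bullet> i < - \<bar>R\<bar> - 1} = {}" using ab by fastforce
    then show "?g (- \<bar>R\<bar> - 1) \<le> th * measure lborel B" using th by simp
    show "continuous_on {- \<bar>R\<bar> - 1..\<bar>R\<bar> + 1} ?g"
      using measure_halfspace_continuous[OF B i] continuous_on_subset by blast
  qed (auto simp: 1 mult.commute)
  then obtain c where "?g c = th * measure lborel B" by blast
  with measure_split_halfspace[OF B i, of c] that[of c] show ?thesis
    by (simp add: algebra_simps)
qed

section \<open>Finite disjoint unions of boxes and the multiplicative Brunn-Minkowski
  inequality\<close>

definition box_family :: "'a::euclidean_space set set \<Rightarrow> bool" where
  "box_family \<A> \<longleftrightarrow> finite \<A> \<and> (\<forall>K\<in>\<A>. K \<noteq> {} \<and> (\<exists>a b. K = box a b)) \<and> pairwise disjnt \<A>"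

lemma box_family_Union:
  assumes "box_family \<A>"
  shows "open (\<Union>\<A>)" "bounded (\<Union>\<A>)" "\<Union>\<A> \<in> sets borel" "\<A> \<noteq> {} \<Longrightarrow> \<Union>\<A> \<noteq> {}"
proof -
  show "open (\<Union>\<A>)" using assms unfolding box_family_def by (metis open_Union open_box)
  then show "\<Union>\<A> \<in> sets borel" by simp
  show "bounded (\<Union>\<A>)" using assms by (auto simp: box_family_def intro!: bounded_Union)
  show "\<A> \<noteq> {} \<Longrightarrow> \<Union>\<A> \<noteq> {}" using assms by (auto simp: box_family_def)
qed

lemma box_Int_halfspace:
  fixes a :: "'a::euclidean_space"
  assumes "i \<in> Basis"
  shows "\<exists>c d. box a b \<inter> {x. x \<bullet> i < t} = box c d" "\<exists>c d. box a b \<inter> {x. x \<bullet> i > t} = box c d"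
proof -
  have "box a b \<inter> {x. x \<bullet> i < t} = box a (\<Sum>j\<in>Basis. (if j = i then min (b \<bullet> i) t else b \<bullet> j) *\<^sub>R j)"
    using assms by (auto simp: mem_box split: if_splits)
  moreover have "box a b \<inter> {x. x \<bullet> i > t} = box (\<Sum>j\<in>Basis. (if j = i then max (a \<bullet> i) t else a \<bullet> j) *\<^sub>R j) b"
    using assms by (auto simp: mem_box split: if_splits)
  ultimately show "\<exists>c d. box a b \<inter> {x. x \<bullet> i < t} = box c d" "\<exists>c d. box a b \<inter> {x. x \<bullet> i > t} = box c d"
    by blast+
qed

text \<open>Boxes are open because they stay open boxes when cut by an open half-space; what lies on
  the cutting hyperplane is null. Empty intersections are discarded, so that the cardinality drops
  when a box misses the half-space.\<close>

definition restrict_family :: "'a set set \<Rightarrow> 'a set \<Rightarrow> 'a set set" where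
  "restrict_family \<A> H = (\<lambda>K. K \<inter> H) ` \<A> - {{}}"

lemma Union_restrict_family: "\<Union>(restrict_family \<A> H) = \<Union>\<A> \<inter> H"
  by (auto simp: restrict_family_def)

lemma box_family_restrict:
  assumes A: "box_family \<A>" and i: "i \<in> Basis" and H: "H = {x. x \<bullet> i < t} \<or> H = {x. x \<bullet> i > t}"
  shows "box_family (restrict_family \<A> H)"
  unfolding box_family_def
proof (intro conjI ballI)
  show "finite (restrict_family \<A> H)" using A by (auto simp: restrict_family_def box_family_def)
  show "pairwise disjnt (restrict_family \<A> H)"
    using A unfolding restrict_family_def box_family_def pairwise_def disjnt_def by blast
  fix K assume "K \<in> restrict_family \<A> H"
  then obtain L where "K = L \<inter> H" "L \<in> \<A>" and ne: "K \<noteq> {}"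
    by (auto simp: restrict_family_def)
  then obtain a b where "K = box a b \<inter> H"
    using A unfolding box_family_def by metis
  with ne show "K \<noteq> {}" "\<exists>a b. K = box a b"
    using box_Int_halfspace[OF i] H by metis+
qed

lemma card_restrict_family:
  assumes "finite \<A>"
  shows "card (restrict_family \<A> H) \<le> card \<A>"
    "K \<in> \<A> \<Longrightarrow> K \<inter> H = {} \<Longrightarrow> card (restrict_family \<A> H) < card \<A>"
proof -
  show "card (restrict_family \<A> H) \<le> card \<A>"
    unfolding restrict_family_def
    by (meson Diff_subset assms card_image_le card_mono finite_imageI le_trans)
  assume K: "K \<in> \<A>" "K \<inter> H = {}"
  then have "restrict_family \<A> H \<subseteq> (\<lambda>K. K \<inter> H) ` (\<A> - {K})"
    by (auto simp: restrict_family_def)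
  then have "card (restrict_family \<A> H) \<le> card (\<A> - {K})"
    by (meson assms card_image_le card_mono finite_Diff finite_imageI le_trans)
  also have "\<dots> < card \<A>" using K assms by (meson card_Diff1_less)
  finally show "card (restrict_family \<A> H) < card \<A>" .
qed

lemma disjoint_boxes_separated:
  fixes a :: "'a::euclidean_space"
  assumes "disjnt (box a b) (box c d)" "box a b \<noteq> {}" "box c d \<noteq> {}"
  obtains i t where "i \<in> Basis" "box a b \<inter> {x. x \<bullet> i > t} = {} \<and> box c d \<inter> {x. x \<bullet> i < t} = {} \<or>
    box a b \<inter> {x. x \<bullet> i < t} = {} \<and> box c d \<inter> {x. x \<bullet> i > t} = {}"
proof -
  obtain i where i: "i \<in> Basis" "b \<bullet> i \<le> c \<bullet> i \<or> d \<bullet> i \<le> a \<bullet> i"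
    using assms unfolding disjnt_def disjoint_interval box_ne_empty by (meson not_less)
  then show ?thesis
    using that[of i "b \<bullet> i"] that[of i "a \<bullet> i"] by (fastforce simp: mem_box)
qed

lemma midpoints_boxes:
  fixes a b c d :: "'a::euclidean_space"
  assumes "box a b \<noteq> {}" "box c d \<noteq> {}"
  shows "box ((1/2) *\<^sub>R (a + c)) ((1/2) *\<^sub>R (b + d)) \<subseteq> midpoints (box a b) (box c d)"
proof
  fix x assume x: "x \<in> box ((1/2) *\<^sub>R (a + c)) ((1/2) *\<^sub>R (b + d))"
  \<comment> \<open>\<open>s i\<close> is the relative position of
    \<open>2 * (x \<bullet> i)\<close> in the sum of the two intervals. Points with this same
    relative position in each box have \<open>x\<close> as their midpoint.\<close>
  define s where "s i = (2 * (x \<bullet> i) - a \<bullet> i - c \<bullet> i) / ((b \<bullet> i - a \<bullet> i) + (d \<bullet> i - c \<bullet> i))" for i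
  have pos: "b \<bullet> i - a \<bullet> i > 0" "d \<bullet> i - c \<bullet> i > 0" if "i \<in> Basis" for i
    using assms that by (auto simp: box_ne_empty)
  have s: "0 < s i" "s i < 1" "s i * ((b \<bullet> i - a \<bullet> i) + (d \<bullet> i - c \<bullet> i)) = 2 * (x \<bullet> i) - a \<bullet> i - c \<bullet> i"
    if "i \<in> Basis" for i
    using x pos[OF that] that by (auto simp: s_def mem_box inner_add_left field_simps)
  let ?y = "\<lambda>a b. \<Sum>i\<in>Basis. (a \<bullet> i + s i * (b \<bullet> i - a \<bullet> i)) *\<^sub>R i"
  have in_box: "?y a b \<in> box a b" if less: "\<And>i. i \<in> Basis \<Longrightarrow> b \<bullet> i - a \<bullet> i > 0" for a b :: 'a
  proof -
    have "a \<bullet> i + s i * (b \<bullet> i - a \<bullet> i) < b \<bullet> i" if i: "i \<in> Basis" for i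
      using mult_strict_right_mono[OF s(2)[OF i] less[OF i]] by simp
    then show ?thesis using s(1) less by (simp add: mem_box)
  qed
  have "x = (1/2) *\<^sub>R (?y a b + ?y c d)"
  proof (rule euclidean_eqI)
    fix i :: 'a assume i: "i \<in> Basis"
    have y: "?y a b \<bullet> i = a \<bullet> i + s i * (b \<bullet> i - a \<bullet> i)" for a b
      using i by simp
    show "x \<bullet> i = ((1/2) *\<^sub>R (?y a b + ?y c d)) \<bullet> i"
      using s(3)[OF i] unfolding inner_scaleR_left inner_add_left y by (simp add: algebra_simps)
  qed
  then show "x \<in> midpoints (box a b) (box c d)"
    using in_box[of b a] in_box[of d c] pos by (auto simp: mem_midpoints)
qed

lemma sqrt_prod: "sqrt (\<Prod>i\<in>A. f i) = (\<Prod>i\<in>A. sqrt (f i))"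
  by (induction A rule: infinite_finite_induct) (auto simp: real_sqrt_mult)

text \<open>The set of midpoints contains the box whose sides are the arithmetic means of the sides,
  and in each coordinate the arithmetic mean dominates the geometric one.\<close>

lemma brunn_minkowski_two_boxes:
  fixes a b c d :: "'a::euclidean_space"
  assumes ne: "box a b \<noteq> {}" "box c d \<noteq> {}"
  shows "sqrt (measure lborel (box a b) * measure lborel (box c d)) \<le> measure lborel (midpoints (box a b) (box c d))"
proof -
  have pos: "b \<bullet> i - a \<bullet> i > 0" "d \<bullet> i - c \<bullet> i > 0" if "i \<in> Basis" for i
    using ne that by (auto simp: box_ne_empty)
  have m: "measure lborel (box u v) = (\<Prod>i\<in>Basis. v \<bullet> i - u \<bullet> i)"
    if "\<And>i. i \<in> Basis \<Longrightarrow> v \<bullet> i - u \<bullet> i > 0" for u v :: 'a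
    using that by (subst measure_lborel_box_eq) (auto simp: inner_diff_left less_imp_le)
  have "sqrt (measure lborel (box a b) * measure lborel (box c d))
      = (\<Prod>i\<in>Basis. sqrt ((b \<bullet> i - a \<bullet> i) * (d \<bullet> i - c \<bullet> i)))"
    using pos by (simp add: m prod.distrib[symmetric] sqrt_prod)
  also have "\<dots> \<le> (\<Prod>i\<in>Basis. ((1/2) *\<^sub>R (b + d)) \<bullet> i - ((1/2) *\<^sub>R (a + c)) \<bullet> i)"
  proof (intro prod_mono conjI)
    fix i :: 'a assume i: "i \<in> Basis"
    have "sqrt ((b \<bullet> i - a \<bullet> i) * (d \<bullet> i - c \<bullet> i)) \<le> ((b \<bullet> i - a \<bullet> i) + (d \<bullet> i - c \<bullet> i)) / 2"
      using pos[OF i] by (intro arith_geo_mean_sqrt) auto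
    then show "sqrt ((b \<bullet> i - a \<bullet> i) * (d \<bullet> i - c \<bullet> i)) \<le> ((1/2) *\<^sub>R (b + d)) \<bullet> i - ((1/2) *\<^sub>R (a + c)) \<bullet> i"
      by (simp add: inner_add_left algebra_simps)
    show "0 \<le> sqrt ((b \<bullet> i - a \<bullet> i) * (d \<bullet> i - c \<bullet> i))" using pos[OF i] by simp
  qed
  also have "\<dots> = measure lborel (box ((1/2) *\<^sub>R (a + c)) ((1/2) *\<^sub>R (b + d)))"
  proof (rule m[symmetric])
    fix i :: 'a assume i: "i \<in> Basis"
    show "0 < ((1/2) *\<^sub>R (b + d)) \<bullet> i - ((1/2) *\<^sub>R (a + c)) \<bullet> i"
      using pos[OF i] by (simp add: inner_add_left)
  qed
  also have "\<dots> \<le> measure lborel (midpoints (box a b) (box c d))"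
    using midpoints_boxes[OF ne]
    by (intro measure_mono_fmeasurable fmeasurable_bounded_borel borel_open bounded_midpoints open_midpoints) auto
  finally show ?thesis .
qed

text \<open>Hadwiger-Ohmann induction on the total number of boxes. A hyperplane separating two
  boxes of one family leaves fewer boxes on each side; the other family is cut by a parallel
  hyperplane in the same proportion \<open>th\<close>. The geometric mean of two measures scaled by
  \<open>th\<close> is scaled by \<open>th\<close>, so the estimates for the two sides add up to the
  full one.\<close>

lemma brunn_minkowski_boxes:
  fixes \<A> \<B> :: "'a::euclidean_space set set"
  assumes "box_family \<A>" "box_family \<B>" "\<A> \<noteq> {}" "\<B> \<noteq> {}"
  shows "sqrt (measure lborel (\<Union>\<A>) * measure lborel (\<Union>\<B>)) \<le> measure lborel (midpoints (\<Union>\<A>) (\<Union>\<B>))"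
  using assms
proof (induction "card \<A> + card \<B>" arbitrary: \<A> \<B> rule: less_induct)
  case less
  note fam = less.prems(1,2) and ne = less.prems(3,4)
  \<comment> \<open>Stated for any pair whose first family has at least two boxes, so that it can be
    applied with the two families exchanged.\<close>
  have step: "sqrt (measure lborel (\<Union>\<C>) * measure lborel (\<Union>\<D>)) \<le> measure lborel (midpoints (\<Union>\<C>) (\<Union>\<D>))"
    if C: "box_family \<C>" and D: "box_family \<D>" and neD: "\<D> \<noteq> {}" and two: "2 \<le> card \<C>"
      and IH: "\<And>\<C>' \<D>' :: 'a set set. card \<C>' + card \<D>' < card \<C> + card \<D> \<Longrightarrow> box_family \<C>' \<Longrightarrow> box_family \<D>' \<Longrightarrow> \<C>' \<noteq> {} \<Longrightarrow> \<D>' \<noteq> {} \<Longrightarrow>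
        sqrt (measure lborel (\<Union>\<C>') * measure lborel (\<Union>\<D>')) \<le> measure lborel (midpoints (\<Union>\<C>') (\<Union>\<D>'))"
    for \<C> \<D> :: "'a set set"
  proof -
    have fin: "finite \<C>" "finite \<D>" using C D by (auto simp: box_family_def)
    obtain K L where KL: "K \<in> \<C>" "L \<in> \<C>" "K \<noteq> L"
      using two card_le_Suc0_iff_eq[OF fin(1)] by fastforce
    obtain i t where i: "i \<in> Basis" and sep: "K \<inter> {x. x \<bullet> i > t} = {} \<and> L \<inter> {x. x \<bullet> i < t} = {} \<or>
        K \<inter> {x. x \<bullet> i < t} = {} \<and> L \<inter> {x. x \<bullet> i > t} = {}"
    proof -
      obtain a b c d where "K = box a b" "L = box c d" "K \<noteq> {}" "L \<noteq> {}" "disjnt K L"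
        using KL C unfolding box_family_def pairwise_def by metis
      then show ?thesis using disjoint_boxes_separated[of a b c d thesis] that by blast
    qed
    let ?L = "\<lambda>t. {x. x \<bullet> i < t}" and ?G = "\<lambda>t. {x. x \<bullet> i > t}"
    let ?m = "measure lborel"
    have "\<exists>K\<in>\<C>. K \<inter> ?L t = {}" "\<exists>K\<in>\<C>. K \<inter> ?G t = {}" using sep KL by blast+
    then have less1: "card (restrict_family \<C> (?L t)) < card \<C>" "card (restrict_family \<C> (?G t)) < card \<C>"
      using card_restrict_family(2)[OF fin(1)] by blast+
    \<comment> \<open>A nonempty open box is not contained in the hyperplane, so each of the two
      separated boxes reaches into its own open side. Hence both parts have positive measure and the
      proportion lies strictly between zero and one.\<close>
    have meets: "\<exists>K\<in>\<C>. K \<inter> ?L t \<noteq> {}" "\<exists>K\<in>\<C>. K \<inter> ?G t \<noteq> {}"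
    proof -
      have nonplane: "\<not> J \<subseteq> {x. x \<bullet> i = t}" if "J \<in> \<C>" for J
      proof
        assume J: "J \<subseteq> {x. x \<bullet> i = t}"
        then have "negligible J" using negligible_standard_hyperplane[OF i] negligible_subset by blast
        moreover have "open J" "J \<noteq> {}" using that C by (auto simp: box_family_def)
        ultimately show False using open_not_negligible by blast
      qed
      have split: "J \<subseteq> {x. x \<bullet> i = t} \<union> (J \<inter> ?L t) \<union> (J \<inter> ?G t)" for J by auto
      show "\<exists>K\<in>\<C>. K \<inter> ?L t \<noteq> {}" "\<exists>K\<in>\<C>. K \<inter> ?G t \<noteq> {}"
        using sep KL nonplane[of K] nonplane[of L] split[of K] split[of L] by auto
    qed
    have bC: "bounded (\<Union>\<C>)" "\<Union>\<C> \<in> sets borel" "open (\<Union>\<C>)" and bD: "bounded (\<Union>\<D>)" "\<Union>\<D> \<in> sets borel" "open (\<Union>\<D>)"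
      using box_family_Union C D by blast+
    have oL: "open (?L t)" "open (?G t)" for t
      by (auto intro!: open_Collect_less continuous_intros)
    have posC: "0 < ?m (\<Union>\<C> \<inter> ?L t)" "0 < ?m (\<Union>\<C> \<inter> ?G t)"
      using meets bC oL by (intro measure_open_pos; force intro!: bounded_Int)+
    have splitC: "?m (\<Union>\<C>) = ?m (\<Union>\<C> \<inter> ?L t) + ?m (\<Union>\<C> \<inter> ?G t)"
      by (rule measure_split_halfspace[OF bC(1,2) i])
    define th where "th = ?m (\<Union>\<C> \<inter> ?L t) / ?m (\<Union>\<C>)"
    have th: "0 < th" "th < 1" "?m (\<Union>\<C> \<inter> ?L t) = th * ?m (\<Union>\<C>)" "?m (\<Union>\<C> \<inter> ?G t) = (1 - th) * ?m (\<Union>\<C>)"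
      using posC splitC by (auto simp: th_def field_simps)
    obtain c where c: "?m (\<Union>\<D> \<inter> ?L c) = th * ?m (\<Union>\<D>)" "?m (\<Union>\<D> \<inter> ?G c) = (1 - th) * ?m (\<Union>\<D>)"
      using measure_halfspace_ratio[OF bD(1,2) i, of th] th by auto
    have posD: "0 < ?m (\<Union>\<D>)"
      using bD neD D box_family_Union(4) by (intro measure_open_pos) auto
    define r where "r = sqrt (?m (\<Union>\<C>) * ?m (\<Union>\<D>))"
    have half: "(if low then th else 1 - th) * r \<le> ?m (midpoints (\<Union>\<C> \<inter> H t) (\<Union>\<D> \<inter> H c))"
      if H: "H = (if low then ?L else ?G)" for low H
    proof -
      let ?th = "if low then th else 1 - th"
      have mm: "?m (\<Union>\<C> \<inter> H t) = ?th * ?m (\<Union>\<C>)" "?m (\<Union>\<D> \<inter> H c) = ?th * ?m (\<Union>\<D>)" "0 < ?th"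
        using th c H by auto
      have cl: "card (restrict_family \<C> (H t)) < card \<C>" using less1 H by auto
      have cle: "card (restrict_family \<D> (H c)) \<le> card \<D>" using card_restrict_family(1)[OF fin(2)] .
      have "0 < ?m (\<Union>\<C> \<inter> H t)" "0 < ?m (\<Union>\<D> \<inter> H c)"
        using posC posD mm H by (auto split: if_splits)
      then have n: "restrict_family \<C> (H t) \<noteq> {}" "restrict_family \<D> (H c) \<noteq> {}"
        unfolding Union_restrict_family[symmetric] by (metis Union_empty measure_empty less_irrefl)+
      have "sqrt (?m (\<Union>(restrict_family \<C> (H t))) * ?m (\<Union>(restrict_family \<D> (H c))))
          \<le> ?m (midpoints (\<Union>(restrict_family \<C> (H t))) (\<Union>(restrict_family \<D> (H c))))"
        using cl cle n H C D i by (intro IH box_family_restrict[of _ i]) auto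
      moreover have "sqrt (?th * ?m (\<Union>\<C>) * (?th * ?m (\<Union>\<D>))) = ?th * r"
        using mm(3) unfolding r_def by (auto simp: real_sqrt_mult)
      ultimately show ?thesis unfolding Union_restrict_family mm by linarith
    qed
    have "r = th * r + (1 - th) * r" by (simp add: algebra_simps)
    also have "\<dots> \<le> ?m (midpoints (\<Union>\<C> \<inter> ?L t) (\<Union>\<D> \<inter> ?L c)) + ?m (midpoints (\<Union>\<C> \<inter> ?G t) (\<Union>\<D> \<inter> ?G c))"
      using half[of ?L True] half[of ?G False] by auto
    also have "\<dots> = ?m (midpoints (\<Union>\<C> \<inter> ?L t) (\<Union>\<D> \<inter> ?L c) \<union> midpoints (\<Union>\<C> \<inter> ?G t) (\<Union>\<D> \<inter> ?G c))"
    \<comment> \<open>Midpoints of the lower parts and midpoints of the upper parts lie on opposite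
      sides of the hyperplane \<open>x \<bullet> i = (t + c) / 2\<close>.\<close>
    proof (rule measure_disjoint_Un[symmetric])
      have "x \<bullet> i < (t + c) / 2" if "x \<in> midpoints (\<Union>\<C> \<inter> ?L t) (\<Union>\<D> \<inter> ?L c)" for x
        using that by (fastforce simp: mem_midpoints inner_add_left)
      moreover have "x \<bullet> i > (t + c) / 2" if "x \<in> midpoints (\<Union>\<C> \<inter> ?G t) (\<Union>\<D> \<inter> ?G c)" for x
        using that by (fastforce simp: mem_midpoints inner_add_left)
      ultimately show "midpoints (\<Union>\<C> \<inter> ?L t) (\<Union>\<D> \<inter> ?L c) \<inter> midpoints (\<Union>\<C> \<inter> ?G t) (\<Union>\<D> \<inter> ?G c) = {}"
        by (metis disjoint_iff less_asym)
    qed (use bC bD oL in \<open>auto intro!: fmeasurable_bounded_borel borel_open bounded_midpoints open_midpoints bounded_Int\<close>)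
    also have "\<dots> \<le> ?m (midpoints (\<Union>\<C>) (\<Union>\<D>))"
    proof (rule measure_mono_fmeasurable)
      show "midpoints (\<Union>\<C> \<inter> ?L t) (\<Union>\<D> \<inter> ?L c) \<union> midpoints (\<Union>\<C> \<inter> ?G t) (\<Union>\<D> \<inter> ?G c) \<subseteq> midpoints (\<Union>\<C>) (\<Union>\<D>)"
        by (intro Un_least midpoints_mono) auto
      show "midpoints (\<Union>\<C> \<inter> ?L t) (\<Union>\<D> \<inter> ?L c) \<union> midpoints (\<Union>\<C> \<inter> ?G t) (\<Union>\<D> \<inter> ?G c) \<in> sets lborel"
        using bD oL by (auto intro!: borel_open open_midpoints)
      show "midpoints (\<Union>\<C>) (\<Union>\<D>) \<in> fmeasurable lborel"
        using bC bD by (intro fmeasurable_bounded_borel borel_open bounded_midpoints open_midpoints)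
    qed
    finally show ?thesis by (simp add: r_def)
  qed
  have fin: "finite \<A>" "finite \<B>" using fam by (auto simp: box_family_def)
  consider "2 \<le> card \<A>" | "2 \<le> card \<B>" | "card \<A> = 1" "card \<B> = 1"
    using ne fin by (metis One_nat_def Suc_1 card_0_eq not_less_eq_eq le_SucE le_zero_eq nat_le_linear)
  then show ?case
  proof cases
    case 1
    then show ?thesis using step[of \<A> \<B>] fam ne less.hyps by blast
  next
    case 2
    then show ?thesis using step[of \<B> \<A>] fam ne less.hyps
      by (simp add: add.commute mult.commute midpoints_commute)
  next
    case 3
    then obtain K L where "\<A> = {K}" "\<B> = {L}" by (meson card_1_singletonE)
    moreover from this fam have "K \<noteq> {} \<and> (\<exists>a b. K = box a b)" "L \<noteq> {} \<and> (\<exists>a b. L = box a b)"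
      by (simp_all add: box_family_def)
    ultimately obtain a b c d where "\<A> = {box a b}" "\<B> = {box c d}" "box a b \<noteq> {}" "box c d \<noteq> {}"
      by metis
    then show ?thesis using brunn_minkowski_two_boxes[of a b c d] by simp
  qed
qed

section \<open>From unions of boxes to compact sets\<close>

lemma division_box_family:
  fixes p :: "'a::euclidean_space set set"
  assumes p: "p division_of U"
  shows "box_family (interior ` p - {{}})" "\<Union>(interior ` p - {{}}) \<subseteq> U"
    "measure lborel (\<Union>(interior ` p - {{}})) = measure lborel U"
proof -
  let ?A = "interior ` p - {{}}"
  show "box_family ?A"
    unfolding box_family_def
  proof (intro conjI ballI)
    show "finite ?A" using p by blast
    show "pairwise disjnt ?A"
      using division_ofD(5)[OF p] unfolding pairwise_def disjnt_def by auto
    fix K assume "K \<in> ?A"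
    then obtain L where "L \<in> p" "K = interior L" "K \<noteq> {}" by auto
    then show "K \<noteq> {}" "\<exists>a b. K = box a b"
      using division_ofD(4)[OF p] by (metis interior_cbox)+
  qed
  then have borel: "\<Union>?A \<in> sets lborel" using box_family_Union(3) by auto
  show sub: "\<Union>?A \<subseteq> U" using division_ofD(6)[OF p] interior_subset by blast
  \<comment> \<open>Passing from the cells of the division to their interiors loses only finitely
    many frontiers of intervals.\<close>
  have "negligible (\<Union>((\<lambda>L. L - interior L) ` p))"
  proof (intro negligible_Union)
    show "finite ((\<lambda>L. L - interior L) ` p)" using p by blast
    fix N assume "N \<in> (\<lambda>L. L - interior L) ` p"
    then show "negligible N"
      using division_ofD(4)[OF p] negligible_frontier_interval by fastforce
  qed
  moreover have "U - \<Union>?A \<subseteq> \<Union>((\<lambda>L. L - interior L) ` p)"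
    using division_ofD(6)[OF p] by auto
  ultimately have neg: "negligible (U - \<Union>?A)" using negligible_subset by blast
  have "closed (\<Union>p)"
  proof (intro closed_Union ballI)
    show "finite p" by (rule division_ofD(1)[OF p])
    show "closed K" if "K \<in> p" for K using division_ofD(4)[OF p that] by (metis closed_cbox)
  qed
  then have "closed U" using division_ofD(6)[OF p] by simp
  then have U: "U \<in> sets lborel" by auto
  have "U - \<Union>?A \<in> null_sets lborel"
    using neg U borel by (simp add: negligible_iff_null_sets null_sets_completion_iff)
  then have "measure lborel (\<Union>?A \<union> (U - \<Union>?A)) = measure lborel (\<Union>?A)"
    using borel by (intro measure_Un_null_set) auto
  then show "measure lborel (\<Union>?A) = measure lborel U"
    using sub by (simp add: Un_absorb1)
qed

text \<open>By compactness finitely many closed boxes inside \<open>U\<close> cover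
  \<open>C\<close>. They may overlap, so their union is divided anew into non-overlapping intervals,
  whose interiors form the family.\<close>

lemma compact_box_family_between:
  fixes C :: "'a::euclidean_space set"
  assumes C: "compact C" and U: "open U" "C \<subseteq> U"
  obtains \<A> where "box_family \<A>" "\<Union>\<A> \<subseteq> U" "measure lborel C \<le> measure lborel (\<Union>\<A>)"
proof -
  have "\<exists>a b. x \<in> box a b \<and> cbox a b \<subseteq> U" if x: "x \<in> C" for x
  proof -
    have "x \<in> U" using x U by blast
    then obtain a b where "cbox a b \<subseteq> U" "x \<in> box a b"
      by (rule open_contains_cbox[OF U(1)])
    then show ?thesis by blast
  qed
  then obtain a b where ab: "\<And>x. x \<in> C \<Longrightarrow> x \<in> box (a x) (b x)" "\<And>x. x \<in> C \<Longrightarrow> cbox (a x) (b x) \<subseteq> U"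
    by metis
  have "C \<subseteq> (\<Union>x\<in>C. box (a x) (b x))" using ab by blast
  then obtain F where F: "F \<subseteq> C" "finite F" "C \<subseteq> (\<Union>x\<in>F. box (a x) (b x))"
    using compactE_image[OF C, of C "\<lambda>x. box (a x) (b x)"] by auto
  let ?V = "\<Union>((\<lambda>x. cbox (a x) (b x)) ` F)"
  obtain p where p: "p division_of ?V"
    using F(2) by (rule elementary_unions_intervals[OF finite_imageI]) blast
  note bf = division_box_family[OF p]
  show thesis
  proof (rule that[OF bf(1)])
    show "\<Union>(interior ` p - {{}}) \<subseteq> U" using bf(2) F(1) ab(2) by blast
    have "C \<subseteq> ?V" using F(3) box_subset_cbox by blast
    then have "measure lborel C \<le> measure lborel ?V"
      using C F by (intro measure_mono_fmeasurable fmeasurable_bounded_borel bounded_UN)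
        (auto simp: borel_compact intro!: borel_closed closed_UN)
    then show "measure lborel C \<le> measure lborel (\<Union>(interior ` p - {{}}))"
      by (simp only: bf(3))
  qed
qed

lemma box_family_uminus:
  assumes "box_family \<A>"
  shows "box_family ((`) uminus ` \<A>)" "\<Union>((`) uminus ` \<A>) = uminus ` \<Union>\<A>"
proof -
  show "\<Union>((`) uminus ` \<A>) = uminus ` \<Union>\<A>" by auto
  show "box_family ((`) uminus ` \<A>)"
    unfolding box_family_def
  proof (intro conjI ballI)
    show "finite ((`) uminus ` \<A>)" using assms by (simp add: box_family_def)
    show "pairwise disjnt ((`) uminus ` \<A>)"
      using assms unfolding box_family_def
      by (simp add: pairwise_image pairwise_def disjnt_def image_Int[OF inj_uminus, symmetric]) metis
    fix K assume "K \<in> (`) uminus ` \<A>"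
    then obtain L where L: "L \<in> \<A>" "K = uminus ` L" by blast
    then obtain a b where "L = box a b" "L \<noteq> {}" using assms unfolding box_family_def by metis
    moreover have "uminus ` box a b = box (- b) (- a)" for a b :: 'a
    proof -
      have "x \<in> uminus ` box a b" if "x \<in> box (- b) (- a)" for x
        using that by (intro image_eqI[of _ _ "- x"]) (auto simp: mem_box)
      then show ?thesis by (auto simp: mem_box)
    qed
    ultimately show "K \<noteq> {}" "\<exists>a b. K = box a b" using L by auto
  qed
qed

lemma measure_lborel_uminus:
  fixes A :: "'a::euclidean_space set"
  assumes "A \<in> sets borel"
  shows "measure lborel (uminus ` A) = measure lborel A"
proof -
  have "measure lebesgue ((\<lambda>x. (-1) *\<^sub>R x + 0) ` A) = measure lebesgue A"
    using measure_lebesgue_affine[of "-1" 0 A] by simp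
  moreover have "uminus ` A = uminus -` A" by force
  moreover have "uminus -` A \<in> sets borel"
    using measurable_sets_borel[of "uminus :: 'a \<Rightarrow> 'a" borel A] assms by simp
  ultimately show ?thesis using assms by (simp add: measure_completion)
qed

text \<open>Symmetrisation: the midpoints of a set and its reflection are the halved differences
  \<open>(x - y) / 2\<close>, so they lie in a ball of half the diameter, while Brunn-Minkowski says
  that their measure is at least that of the set. A union of boxes inside the
  \<open>e\<close>-neighbourhood of \<open>C\<close> stands in for \<open>C\<close>, which enlarges
  the radius by \<open>e\<close>; then \<open>e\<close> tends to zero.\<close>

theorem isodiametric_compact:
  fixes C :: "'a::euclidean_space set"
  assumes C: "compact C" and d: "\<And>x y. x \<in> C \<Longrightarrow> y \<in> C \<Longrightarrow> dist x y \<le> d" "0 \<le> d"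
  shows "measure lborel C \<le> unit_ball_vol (real DIM('a)) * (d / 2) ^ DIM('a)"
proof -
  have bound: "measure lborel C \<le> unit_ball_vol (real DIM('a)) * (d / 2 + e) ^ DIM('a)" if e: "e > 0" for e
  proof -
    let ?U = "\<Union>x\<in>C. ball x e"
    have U: "open ?U" "C \<subseteq> ?U" using e by force+
    obtain \<A> where A: "box_family \<A>" "\<Union>\<A> \<subseteq> ?U" "measure lborel C \<le> measure lborel (\<Union>\<A>)"
      by (rule compact_box_family_between[OF C U])
    show ?thesis
    proof (cases "\<A> = {}")
      case True
      then have "measure lborel C \<le> 0" using A by simp
      also have "\<dots> \<le> unit_ball_vol (real DIM('a)) * (d / 2 + e) ^ DIM('a)"
        using e d by (intro mult_nonneg_nonneg unit_ball_vol_nonneg zero_le_power) auto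
      finally show ?thesis .
    next
      case False
      let ?B = "uminus ` \<Union>\<A>"
      have mB: "measure lborel ?B = measure lborel (\<Union>\<A>)"
        using box_family_Union(3)[OF A(1)] by (rule measure_lborel_uminus)
      have "measure lborel (\<Union>\<A>) = sqrt (measure lborel (\<Union>\<A>) * measure lborel ?B)"
        by (simp add: mB)
      also have "\<dots> \<le> measure lborel (midpoints (\<Union>\<A>) ?B)"
        using brunn_minkowski_boxes[OF A(1) box_family_uminus(1)[OF A(1)]] False
        by (simp add: box_family_uminus(2)[OF A(1)])
      also have "\<dots> \<le> measure lborel (cball (0::'a) (d / 2 + e))"
      proof (rule measure_mono_fmeasurable)
        show "midpoints (\<Union>\<A>) ?B \<subseteq> cball 0 (d / 2 + e)"
        proof
          fix z assume "z \<in> midpoints (\<Union>\<A>) ?B"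
          then obtain x y where xy: "x \<in> \<Union>\<A>" "y \<in> \<Union>\<A>" and z: "z = (1/2) *\<^sub>R (x - y)"
            by (auto simp: mem_midpoints)
          have "x \<in> ?U" "y \<in> ?U" using xy A(2) by blast+
          then obtain x' y' where "x' \<in> C" "y' \<in> C" "dist x' x < e" "dist y' y < e"
            by auto
          then have "dist x y \<le> d + 2 * e"
            using d(1)[of x' y'] dist_triangle[of x y x'] dist_triangle[of x' y y'] by (simp add: dist_commute)
          then show "z \<in> cball 0 (d / 2 + e)" by (simp add: z dist_norm)
        qed
        show "midpoints (\<Union>\<A>) ?B \<in> sets lborel"
          using box_family_Union(1)[OF box_family_uminus(1)[OF A(1)]]
          by (simp add: box_family_uminus(2)[OF A(1)] borel_open open_midpoints)
      qed (auto intro!: fmeasurable_bounded_borel)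
      also have "\<dots> = unit_ball_vol (real DIM('a)) * (d / 2 + e) ^ DIM('a)"
        using e d by (intro content_cball) auto
      finally show ?thesis using A(3) by linarith
    qed
  qed
  have "((\<lambda>e. unit_ball_vol (real DIM('a)) * (d / 2 + e) ^ DIM('a)) \<longlongrightarrow>
      unit_ball_vol (real DIM('a)) * (d / 2 + 0) ^ DIM('a)) (at_right 0)"
    by (intro tendsto_intros)
  then show ?thesis
    using bound by (intro tendsto_lowerbound[where F = "at_right 0" and a = "measure lborel C" and f="\<lambda>e. unit_ball_vol (real DIM('a)) * (d / 2 + e) ^ DIM('a)"])
      (auto simp: eventually_at_filter)
qed

subsection \<open>Hausdorff measure\<close>

text \<open>Covering sets in the Hausdorff measure are arbitrary; the closure is measurable and has
  the same diameter.\<close>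

lemma isodiametric:
  fixes C :: "'a::euclidean_space set"
  assumes "bounded C"
  shows "emeasure lborel (closure C) \<le> ennreal (unit_ball_vol (real DIM('a)) * (diameter C / 2) ^ DIM('a))"
proof -
  have "compact (closure C)" using assms by simp
  moreover have "dist x y \<le> diameter C" if "x \<in> closure C" "y \<in> closure C" for x y
    using diameter_bounded_bound[OF bounded_closure[OF assms] that] assms by (simp add: diameter_closure)
  ultimately have "measure lborel (closure C) \<le> unit_ball_vol (real DIM('a)) * (diameter C / 2) ^ DIM('a)"
    using assms by (intro isodiametric_compact) (auto simp: diameter_ge_0)
  moreover have "emeasure lborel (closure C) = ennreal (measure lborel (closure C))"
    using assms by (intro emeasure_eq_measure2 fmeasurable_bounded_borel) auto
  ultimately show ?thesis by (simp add: ennreal_leI)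
qed

section \<open>Premeasures and countable subadditivity\<close>

abbreviation hweight :: "nat \<Rightarrow> 'a::metric_space set \<Rightarrow> ennreal" where
  "hweight n C \<equiv> ennreal (unit_ball_vol (real n) * (diameter C / 2) ^ n)"

lemma hausdorff_premeasure_le:
  assumes "S \<subseteq> (\<Union>i. C i)" "\<And>i. bounded (C i)" "\<And>i. diameter (C i) \<le> \<delta>"
  shows "hausdorff_premeasure n \<delta> S \<le> (\<Sum>i. hweight n (C i))"
  unfolding hausdorff_premeasure_def using assms by (intro INF_lower) auto

lemma hausdorff_premeasure_greatest:
  assumes "\<And>C. S \<subseteq> (\<Union>i. C i) \<Longrightarrow> (\<And>i. bounded (C i)) \<Longrightarrow> (\<And>i. diameter (C i) \<le> \<delta>) \<Longrightarrow>
    c \<le> (\<Sum>i. hweight n (C i))"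
  shows "c \<le> hausdorff_premeasure n \<delta> S"
  unfolding hausdorff_premeasure_def using assms by (intro INF_greatest) auto

lemma hausdorff_premeasure_le_measure: "0 < \<delta> \<Longrightarrow> hausdorff_premeasure n \<delta> S \<le> hausdorff_measure n S"
  unfolding hausdorff_measure_def by (intro SUP_upper) auto

lemma hausdorff_measure_least:
  "(\<And>\<delta>. 0 < \<delta> \<Longrightarrow> hausdorff_premeasure n \<delta> S \<le> c) \<Longrightarrow> hausdorff_measure n S \<le> c"
  unfolding hausdorff_measure_def by (intro SUP_least) auto

lemma hausdorff_premeasure_mono: "S \<subseteq> T \<Longrightarrow> hausdorff_premeasure n \<delta> S \<le> hausdorff_premeasure n \<delta> T"
  by (intro hausdorff_premeasure_greatest hausdorff_premeasure_le) auto

lemma hausdorff_measure_mono: "S \<subseteq> T \<Longrightarrow> hausdorff_measure n S \<le> hausdorff_measure n T"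
  unfolding hausdorff_measure_def by (intro SUP_mono) (auto intro: hausdorff_premeasure_mono)

lemma hausdorff_premeasure_antimono: "\<delta> \<le> \<delta>' \<Longrightarrow> hausdorff_premeasure n \<delta>' S \<le> hausdorff_premeasure n \<delta> S"
  by (intro hausdorff_premeasure_greatest hausdorff_premeasure_le) (auto intro: order_trans)

text \<open>The cover consists of \<open>C\<close> followed by empty sets. They have weight
  \<open>0 ^ n\<close>, which vanishes for positive \<open>n\<close>.\<close>

lemma hausdorff_premeasure_self:
  assumes "bounded C" "diameter C \<le> \<delta>" "0 < n"
  shows "hausdorff_premeasure n \<delta> C \<le> hweight n C"
proof -
  have "0 \<le> \<delta>" using assms diameter_ge_0 by (metis order_trans)
  then have "hausdorff_premeasure n \<delta> C \<le> (\<Sum>i. hweight n (if i = (0::nat) then C else {}))"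
    using assms by (intro hausdorff_premeasure_le) auto
  also have "\<dots> = (\<Sum>i\<in>{0::nat}. hweight n (if i = 0 then C else {}))"
    using assms(3) by (intro suminf_finite) auto
  finally show ?thesis by simp
qed

text \<open>Covers that are optimal up to \<open>e / 2 ^ (i + 1)\<close> are merged through the
  pairing function. Such covers exist only for terms that are finite, hence the case
  distinction.\<close>

lemma hausdorff_premeasure_UN:
  "hausdorff_premeasure n \<delta> (\<Union>i. S i) \<le> (\<Sum>i::nat. hausdorff_premeasure n \<delta> (S i))"
proof (cases "\<exists>i. hausdorff_premeasure n \<delta> (S i) = top")
  case True
  then obtain i where "hausdorff_premeasure n \<delta> (S i) = top" by blast
  then have "(\<Sum>i. hausdorff_premeasure n \<delta> (S i)) = top"
    by (metis ennreal_suminf_lessD less_top not_less_iff_gr_or_eq top.not_eq_extremum)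
  then show ?thesis by simp
next
  case False
  show ?thesis
  proof (rule ennreal_le_epsilon)
    fix e :: real assume e: "0 < e"
    have "\<exists>C. S i \<subseteq> (\<Union>j. C j) \<and> (\<forall>j. bounded (C j) \<and> diameter (C j) \<le> \<delta>) \<and>
        (\<Sum>j. hweight n (C j)) \<le> hausdorff_premeasure n \<delta> (S i) + ennreal (e * (1/2) ^ Suc i)" for i
    proof (rule ccontr)
      assume *: "\<not> (\<exists>C. S i \<subseteq> (\<Union>j. C j) \<and> (\<forall>j. bounded (C j) \<and> diameter (C j) \<le> \<delta>) \<and>
        (\<Sum>j. hweight n (C j)) \<le> hausdorff_premeasure n \<delta> (S i) + ennreal (e * (1/2) ^ Suc i))"
      have "hausdorff_premeasure n \<delta> (S i) + ennreal (e * (1/2) ^ Suc i) \<le> hausdorff_premeasure n \<delta> (S i)"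
        using * by (intro hausdorff_premeasure_greatest) (meson linorder_linear)
      moreover have "hausdorff_premeasure n \<delta> (S i) < hausdorff_premeasure n \<delta> (S i) + ennreal (e * (1/2) ^ Suc i)"
        using False e ennreal_add_left_cancel_less[of "hausdorff_premeasure n \<delta> (S i)" 0] by (simp add: top.not_eq_extremum)
      ultimately show False by simp
    qed
    then obtain C where C: "\<And>i. S i \<subseteq> (\<Union>j. C i j)" "\<And>i j. bounded (C i j)" "\<And>i j. diameter (C i j) \<le> \<delta>"
        "\<And>i. (\<Sum>j. hweight n (C i j)) \<le> hausdorff_premeasure n \<delta> (S i) + ennreal (e * (1/2) ^ Suc i)"
      by metis
    have "hausdorff_premeasure n \<delta> (\<Union>i. S i) \<le> (\<Sum>k. hweight n (case_prod C (prod_decode k)))"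
    proof (rule hausdorff_premeasure_le)
      show "(\<Union>i. S i) \<subseteq> (\<Union>k. case_prod C (prod_decode k))"
      proof
        fix x assume "x \<in> (\<Union>i. S i)"
        then obtain i j where "x \<in> C i j" using C(1) by blast
        then have "x \<in> case_prod C (prod_decode (prod_encode (i, j)))" by simp
        then show "x \<in> (\<Union>k. case_prod C (prod_decode k))" by (rule UN_I[OF UNIV_I])
      qed
    qed (use C in \<open>auto split: prod.split\<close>)
    also have "\<dots> = (\<Sum>i. \<Sum>j. hweight n (C i j))"
      using suminf_ennreal_2dimen[of "\<lambda>i. \<Sum>j. hweight n (C i j)" "\<lambda>(i, j). hweight n (C i j)"]
      by (simp add: comp_def case_prod_beta)
    also have "\<dots> \<le> (\<Sum>i. hausdorff_premeasure n \<delta> (S i) + ennreal (e * (1/2) ^ Suc i))"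
      by (intro suminf_le C) auto
    also have "\<dots> = (\<Sum>i. hausdorff_premeasure n \<delta> (S i)) + (\<Sum>i. ennreal (e * (1/2) ^ Suc i))"
      by (rule suminf_add[symmetric]) auto
    also have "(\<Sum>i. ennreal (e * (1/2) ^ Suc i)) = ennreal e"
    proof (rule suminf_ennreal_eq)
      show "(\<lambda>i. e * (1/2) ^ Suc i) sums e"
        using sums_mult[OF power_half_series, of e] by simp
    qed (use e in auto)
    finally show "hausdorff_premeasure n \<delta> (\<Union>i. S i) \<le> (\<Sum>i. hausdorff_premeasure n \<delta> (S i)) + ennreal e" .
  qed
qed

lemma hausdorff_premeasure_empty: "0 < n \<Longrightarrow> 0 \<le> \<delta> \<Longrightarrow> hausdorff_premeasure n \<delta> {} = 0"
  using hausdorff_premeasure_self[of "{}" \<delta> n] by (simp add: zero_power)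

text \<open>The cubes and balls used below are indexed by countable sets that may be finite. A sum
  over \<open>count_space\<close> treats both cases and matches countable additivity of Lebesgue
  measure.\<close>

lemma hausdorff_premeasure_UN_countable:
  assumes I: "countable I" and n: "0 < n" "0 \<le> \<delta>"
  shows "hausdorff_premeasure n \<delta> (\<Union>i\<in>I. S i) \<le> (\<integral>\<^sup>+ i. hausdorff_premeasure n \<delta> (S i) \<partial>count_space I)"
proof -
  define f where "f = to_nat_on I"
  have f: "inj_on f I" using I unfolding f_def by (rule inj_on_to_nat_on)
  define Y where "Y k = (if k \<in> f ` I then S (the_inv_into I f k) else {})" for k
  have Yf: "Y (f i) = S i" if "i \<in> I" for i
    using that f by (simp add: Y_def the_inv_into_f_f)
  have "(\<Union>i\<in>I. S i) = (\<Union>k. Y k)"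
  proof
    show "(\<Union>i\<in>I. S i) \<subseteq> (\<Union>k. Y k)" using Yf by blast
    show "(\<Union>k. Y k) \<subseteq> (\<Union>i\<in>I. S i)"
      using the_inv_into_into[OF f] by (force simp: Y_def split: if_splits)
  qed
  then have "hausdorff_premeasure n \<delta> (\<Union>i\<in>I. S i) \<le> (\<Sum>k. hausdorff_premeasure n \<delta> (Y k))"
    using hausdorff_premeasure_UN by metis
  also have "\<dots> = (\<integral>\<^sup>+ k. hausdorff_premeasure n \<delta> (Y k) \<partial>count_space UNIV)"
    by (rule nn_integral_count_space_nat[symmetric])
  also have "\<dots> = (\<integral>\<^sup>+ k. hausdorff_premeasure n \<delta> (Y k) \<partial>count_space (f ` I))"
    using n by (intro nn_integral_count_space_eq) (auto simp: Y_def hausdorff_premeasure_empty)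
  also have "\<dots> = (\<integral>\<^sup>+ i. hausdorff_premeasure n \<delta> (Y (f i)) \<partial>count_space I)"
    using f by (rule nn_integral_bij_count_space[symmetric, OF inj_on_imp_bij_betw])
  also have "\<dots> = (\<integral>\<^sup>+ i. hausdorff_premeasure n \<delta> (S i) \<partial>count_space I)"
    by (intro nn_integral_cong) (simp add: Yf)
  finally show ?thesis .
qed

lemma hausdorff_premeasure_Un:
  assumes "0 < n" "0 \<le> \<delta>"
  shows "hausdorff_premeasure n \<delta> (S \<union> T) \<le> hausdorff_premeasure n \<delta> S + hausdorff_premeasure n \<delta> T"
proof -
  let ?X = "\<lambda>b. if b then S else T"
  have "S \<union> T = (\<Union>b\<in>UNIV. ?X b)" by (auto simp: UNIV_bool)
  then have "hausdorff_premeasure n \<delta> (S \<union> T) \<le> (\<integral>\<^sup>+ b. hausdorff_premeasure n \<delta> (?X b) \<partial>count_space UNIV)"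
    using hausdorff_premeasure_UN_countable[of "UNIV :: bool set" n \<delta> ?X] assms by simp
  also have "\<dots> = hausdorff_premeasure n \<delta> S + hausdorff_premeasure n \<delta> T"
    by (simp add: nn_integral_count_space_finite UNIV_bool add.commute)
  finally show ?thesis .
qed

lemma hausdorff_measure_Un:
  assumes "0 < n"
  shows "hausdorff_measure n (S \<union> T) \<le> hausdorff_measure n S + hausdorff_measure n T"
proof (rule hausdorff_measure_least)
  fix \<delta> :: real assume "0 < \<delta>"
  then show "hausdorff_premeasure n \<delta> (S \<union> T) \<le> hausdorff_measure n S + hausdorff_measure n T"
    using hausdorff_premeasure_Un[of n \<delta> S T] assms
    by (meson add_mono hausdorff_premeasure_le_measure less_imp_le order_trans)
qed

section \<open>Metric properties and comparison with Lebesgue measure\<close>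

lemma lborel_le_hausdorff_measure:
  fixes S :: "'a::euclidean_space set"
  assumes "S \<in> sets borel"
  shows "emeasure lborel S \<le> hausdorff_measure DIM('a) S"
proof -
  have "emeasure lborel S \<le> hausdorff_premeasure DIM('a) 1 S"
  proof (rule hausdorff_premeasure_greatest)
    fix C :: "nat \<Rightarrow> 'a set"
    assume C: "S \<subseteq> (\<Union>i. C i)" "\<And>i. bounded (C i)"
    have "S \<subseteq> (\<Union>i. closure (C i))" using C(1) closure_subset by blast
    then have "emeasure lborel S \<le> emeasure lborel (\<Union>i. closure (C i))"
      by (intro emeasure_mono) auto
    also have "\<dots> \<le> (\<Sum>i. emeasure lborel (closure (C i)))"
      by (intro emeasure_subadditive_countably) auto
    also have "\<dots> \<le> (\<Sum>i. hweight DIM('a) (C i))"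
      by (intro suminf_le isodiametric C) auto
    finally show "emeasure lborel S \<le> (\<Sum>i. hweight DIM('a) (C i))" .
  qed
  also have "\<dots> \<le> hausdorff_measure DIM('a) S" by (rule hausdorff_premeasure_le_measure) simp
  finally show ?thesis .
qed

lemma hausdorff_measure_contraction:
  fixes f :: "'a::metric_space \<Rightarrow> 'b::metric_space"
  assumes f: "\<And>x y. x \<in> S \<Longrightarrow> y \<in> S \<Longrightarrow> dist (f x) (f y) \<le> dist x y"
  shows "hausdorff_measure n (f ` S) \<le> hausdorff_measure n S"
  unfolding hausdorff_measure_def
proof (intro SUP_mono bexI hausdorff_premeasure_greatest)
  fix \<delta> :: real and C :: "nat \<Rightarrow> 'a set"
  assume C: "S \<subseteq> (\<Union>i. C i)" "\<And>i. bounded (C i)" "\<And>i. diameter (C i) \<le> \<delta>"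
  have dist: "dist x y \<le> diameter (C i)" if xy: "x \<in> f ` (C i \<inter> S)" "y \<in> f ` (C i \<inter> S)" for x y i
  proof -
    obtain u v where "u \<in> C i \<inter> S" "v \<in> C i \<inter> S" "x = f u" "y = f v" using xy by blast
    then show ?thesis using f[of u v] diameter_bounded_bound[OF C(2)[of i], of u v] by auto
  qed
  have diam: "diameter (f ` (C i \<inter> S)) \<le> diameter (C i)" for i
    using dist diameter_ge_0[OF C(2)[of i]] unfolding diameter_def[of "f ` (C i \<inter> S)"]
    by (auto intro!: cSUP_least)
  have bdd: "bounded (f ` (C i \<inter> S))" for i
    using dist by (metis bounded_two_points)
  \<comment> \<open>The covering sets are cut down to \<open>S\<close> before they are mapped, since
    \<open>f\<close> is controlled on \<open>S\<close> only.\<close>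
  have "hausdorff_premeasure n \<delta> (f ` S) \<le> (\<Sum>i. hweight n (f ` (C i \<inter> S)))"
  proof (rule hausdorff_premeasure_le)
    show "f ` S \<subseteq> (\<Union>i. f ` (C i \<inter> S))" using C(1) by blast
    show "diameter (f ` (C i \<inter> S)) \<le> \<delta>" for i using diam[of i] C(3)[of i] by linarith
  qed (rule bdd)
  also have "\<dots> \<le> (\<Sum>i. hweight n (C i))"
    using diam bdd by (intro suminf_le ennreal_leI mult_left_mono power_mono divide_right_mono)
      (auto simp: diameter_ge_0)
  finally show "hausdorff_premeasure n \<delta> (f ` S) \<le> (\<Sum>i. hweight n (C i))" .
qed

text \<open>A covering set of diameter below \<open>r\<close> cannot meet both \<open>S\<close> and
  \<open>T\<close>, so every fine cover of the union splits into a cover of each. Additivity thus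
  holds for arbitrary, possibly non-measurable sets.\<close>

lemma hausdorff_measure_separated:
  assumes n: "0 < n" and r: "0 < r" and sep: "\<And>x y. x \<in> S \<Longrightarrow> y \<in> T \<Longrightarrow> r \<le> dist x y"
  shows "hausdorff_measure n S + hausdorff_measure n T \<le> hausdorff_measure n (S \<union> T)"
proof -
  have small: "hausdorff_premeasure n \<delta> S + hausdorff_premeasure n \<delta> T \<le> hausdorff_premeasure n \<delta> (S \<union> T)"
    if \<delta>: "0 < \<delta>" "\<delta> < r" for \<delta>
  proof (rule hausdorff_premeasure_greatest)
    fix C :: "nat \<Rightarrow> 'a set"
    assume C: "S \<union> T \<subseteq> (\<Union>i. C i)" "\<And>i. bounded (C i)" "\<And>i. diameter (C i) \<le> \<delta>"
    define A where "A i = (if C i \<inter> S = {} then {} else C i)" for i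
    define B where "B i = (if C i \<inter> T = {} then {} else C i)" for i
    have not_both: "C i \<inter> S = {} \<or> C i \<inter> T = {}" for i
    proof (rule ccontr)
      assume "\<not> ?thesis"
      then obtain x y where "x \<in> C i" "x \<in> S" "y \<in> C i" "y \<in> T" by blast
      then show False
        using sep[of x y] diameter_bounded_bound[OF C(2)[of i], of x y] C(3)[of i] \<delta> by linarith
    qed
    have "hausdorff_premeasure n \<delta> S \<le> (\<Sum>i. hweight n (A i))"
      using C \<delta> by (intro hausdorff_premeasure_le) (force simp: A_def)+
    moreover have "hausdorff_premeasure n \<delta> T \<le> (\<Sum>i. hweight n (B i))"
      using C \<delta> by (intro hausdorff_premeasure_le) (force simp: B_def)+
    ultimately have "hausdorff_premeasure n \<delta> S + hausdorff_premeasure n \<delta> T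
        \<le> (\<Sum>i. hweight n (A i)) + (\<Sum>i. hweight n (B i))" by (rule add_mono)
    also have "\<dots> = (\<Sum>i. hweight n (A i) + hweight n (B i))"
      by (rule suminf_add) auto
    also have "\<dots> \<le> (\<Sum>i. hweight n (C i))"
      using n not_both by (intro suminf_le) (auto simp: A_def B_def zero_power)
    finally show "hausdorff_premeasure n \<delta> S + hausdorff_premeasure n \<delta> T \<le> (\<Sum>i. hweight n (C i))" .
  qed
  \<comment> \<open>Two independent scales are allowed, by passing to a common smaller one, so that
    the two suprema can be taken one after the other.\<close>
  have "hausdorff_premeasure n \<delta> S + hausdorff_premeasure n \<epsilon> T \<le> hausdorff_measure n (S \<union> T)"
    if "0 < \<delta>" "0 < \<epsilon>" for \<delta> \<epsilon>
  proof -
    let ?m = "min (r/2) (min \<delta> \<epsilon>)"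
    have "hausdorff_premeasure n \<delta> S + hausdorff_premeasure n \<epsilon> T
        \<le> hausdorff_premeasure n ?m S + hausdorff_premeasure n ?m T"
      by (intro add_mono hausdorff_premeasure_antimono) auto
    also have "\<dots> \<le> hausdorff_premeasure n ?m (S \<union> T)" using r that by (intro small) auto
    also have "\<dots> \<le> hausdorff_measure n (S \<union> T)" using r that by (intro hausdorff_premeasure_le_measure) auto
    finally show ?thesis .
  qed
  then have "hausdorff_premeasure n \<delta> S + (SUP \<epsilon>\<in>{0<..}. hausdorff_premeasure n \<epsilon> T) \<le> hausdorff_measure n (S \<union> T)"
    if "0 < \<delta>" for \<delta>
    using that by (subst ennreal_SUP_add_right) (auto intro!: SUP_least)
  then have "(SUP \<delta>\<in>{0<..}. hausdorff_premeasure n \<delta> S) + hausdorff_measure n T \<le> hausdorff_measure n (S \<union> T)"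
    by (subst ennreal_SUP_add_left[symmetric]) (auto intro!: SUP_least simp: hausdorff_measure_def)
  then show ?thesis by (simp add: hausdorff_measure_def)
qed

text \<open>A null set lies in an open set of small measure, which is filled by non-overlapping
  cubes. The weight of a cube is a fixed multiple \<open>c\<close> of its volume, so the total
  weight is as small as desired.\<close>

lemma hausdorff_premeasure_negligible:
  fixes N :: "'a::euclidean_space set"
  assumes N: "negligible N" "bounded N" and \<delta>: "0 < \<delta>"
  shows "hausdorff_premeasure DIM('a) \<delta> N = 0"
proof -
  let ?n = "DIM('a)"
  \<comment> \<open>A cube of side \<open>s\<close> has diameter at most \<open>n * s\<close>, by
    the bound of the norm through the sum of the coordinates.\<close>
  define c where "c = unit_ball_vol (real ?n) * (real ?n / 2) ^ ?n"
  have c: "0 \<le> c" by (simp add: c_def)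
  obtain R where R: "0 < R" "\<And>x. x \<in> N \<Longrightarrow> norm x < R"
    using N(2) bounded_pos_less by blast
  define a b :: 'a where "a = - (R *\<^sub>R One)" and "b = R *\<^sub>R One"
  have ab: "a \<bullet> i = - R" "b \<bullet> i = R" if "i \<in> Basis" for i
    using that by (auto simp: a_def b_def)
  have "x \<in> box a b" if "x \<in> N" for x
    using R(2)[OF that] Basis_le_norm[of _ x] by (force simp: mem_box ab abs_le_iff)
  then have Nbox: "N \<subseteq> box a b" by blast
  have bound: "hausdorff_premeasure ?n \<delta> N \<le> ennreal (c * e)" if e: "0 < e" for e
  proof -
    have "N \<in> sets lebesgue" using N(1) by (simp add: negligible_imp_sets)
    then obtain T where T: "open T" "N \<subseteq> T" "T - N \<in> lmeasurable" "emeasure lebesgue (T - N) < ennreal e"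
      using sets_lebesgue_outer_open[of N e] e by metis
    have "emeasure lebesgue T \<le> emeasure lebesgue ((T - N) \<union> N)"
      using T N by (intro emeasure_mono) (auto intro: negligible_imp_sets)
    also have "\<dots> = emeasure lebesgue (T - N)"
      using N T by (intro emeasure_Un_null_set) (auto simp: negligible_iff_null_sets)
    finally have Te: "emeasure lborel T \<le> ennreal e" using T(1,4) by (simp add: emeasure_completion)
    let ?U = "T \<inter> box a b"
    \<comment> \<open>The gauge keeps each cube inside the open set and inside a ball of radius
      \<open>\<delta> / 2\<close>, so that it is an admissible covering set.\<close>
    let ?g = "\<lambda>x. if x \<in> ?U then ?U \<inter> ball x (\<delta>/2) else UNIV"
    have g: "gauge ?g" using T(1) \<delta> unfolding gauge_def by (auto intro!: open_Int)
    have ne: "box a b \<noteq> {}" using R(1) by (simp add: box_ne_empty ab)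
    have sub: "?U \<subseteq> cbox a b" using box_subset_cbox by blast
    obtain \<D> where D: "countable \<D>" "\<Union>\<D> \<subseteq> cbox a b" "\<And>K. K \<in> \<D> \<Longrightarrow> interior K \<noteq> {} \<and> (\<exists>c d. K = cbox c d)"
        "pairwise (\<lambda>A B. interior A \<inter> interior B = {}) \<D>"
        "\<And>K. K \<in> \<D> \<Longrightarrow> \<exists>x \<in> ?U \<inter> K. K \<subseteq> ?g x"
        "\<And>u v. cbox u v \<in> \<D> \<Longrightarrow> \<exists>n. \<forall>i \<in> Basis. v \<bullet> i - u \<bullet> i = (b \<bullet> i - a \<bullet> i) / 2^n"
        "?U \<subseteq> \<Union>\<D>"
    proof (rule covering_lemma[OF sub ne g], goal_cases)
      case (1 \<D>)
      show thesis by (rule 1(1)[OF 1(2-8)])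
    qed
    have K: "K \<subseteq> T \<and> hausdorff_premeasure ?n \<delta> K \<le> ennreal c * emeasure lborel (interior K)" if KD: "K \<in> \<D>" for K
    proof
      obtain x where x: "x \<in> ?U" "K \<subseteq> ?U \<inter> ball x (\<delta>/2)"
        using D(5)[OF KD] by auto
      then show "K \<subseteq> T" by blast
      obtain u v where uv: "K = cbox u v" "interior K \<noteq> {}" using D(3)[OF KD] by blast
      obtain k where k: "\<And>i. i \<in> Basis \<Longrightarrow> v \<bullet> i - u \<bullet> i = (b \<bullet> i - a \<bullet> i) / 2^k"
        using D(6)[of u v] KD uv by blast
      define s where "s = 2 * R / 2 ^ k"
      have s: "v \<bullet> i - u \<bullet> i = s" if "i \<in> Basis" for i using k that by (simp add: ab s_def)
      have "0 \<le> s" using R by (simp add: s_def)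
      have ne: "cbox u v \<noteq> {}" using uv by (metis interior_empty)
      have le: "u \<bullet> i \<le> v \<bullet> i" if "i \<in> Basis" for i using s[OF that] \<open>0 \<le> s\<close> by simp
      have "diameter K = dist u v" using ne uv by (simp add: diameter_cbox box_ne_empty)
      also have "\<dots> \<le> (\<Sum>i\<in>Basis. \<bar>(v - u) \<bullet> i\<bar>)"
        unfolding dist_norm by (subst norm_minus_commute) (rule norm_le_l1)
      also have "\<dots> = real ?n * s" using s \<open>0 \<le> s\<close> by (simp add: inner_diff_left)
      finally have diam: "diameter K \<le> real ?n * s" .
      have "diameter K \<le> diameter (ball x (\<delta>/2))"
        using x by (intro diameter_subset) auto
      then have "diameter K \<le> \<delta>" using \<delta> by (simp add: diameter_ball)
      then have "hausdorff_premeasure ?n \<delta> K \<le> hweight ?n K"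
        using uv by (intro hausdorff_premeasure_self) auto
      also have "\<dots> \<le> ennreal (unit_ball_vol (real ?n) * (real ?n * s / 2) ^ ?n)"
        using diam uv by (intro ennreal_leI mult_left_mono power_mono divide_right_mono) (auto simp: diameter_ge_0)
      also have "\<dots> = ennreal c * ennreal (s ^ ?n)"
        using c \<open>0 \<le> s\<close> by (simp add: c_def power_mult_distrib power_divide ennreal_mult[symmetric])
      also have "ennreal (s ^ ?n) = emeasure lborel (interior K)"
        using le s \<open>0 \<le> s\<close> by (simp add: uv interior_cbox emeasure_lborel_box inner_diff_left prod_ennreal[symmetric])
      finally show "hausdorff_premeasure ?n \<delta> K \<le> ennreal c * emeasure lborel (interior K)" .
    qed
    have "N \<subseteq> (\<Union>K\<in>\<D>. K)" using D(7) T(2) Nbox by auto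
    then have "hausdorff_premeasure ?n \<delta> N \<le> hausdorff_premeasure ?n \<delta> (\<Union>K\<in>\<D>. K)"
      by (rule hausdorff_premeasure_mono)
    also have "\<dots> \<le> (\<integral>\<^sup>+ K. hausdorff_premeasure ?n \<delta> K \<partial>count_space \<D>)"
      using D(1) \<delta> by (intro hausdorff_premeasure_UN_countable) auto
    also have "\<dots> \<le> (\<integral>\<^sup>+ K. ennreal c * emeasure lborel (interior K) \<partial>count_space \<D>)"
      using K by (intro nn_integral_mono) auto
    also have "\<dots> = ennreal c * (\<integral>\<^sup>+ K. emeasure lborel (interior K) \<partial>count_space \<D>)"
      by (rule nn_integral_cmult) auto
    also have "(\<integral>\<^sup>+ K. emeasure lborel (interior K) \<partial>count_space \<D>) = emeasure lborel (\<Union>K\<in>\<D>. interior K)"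
      using D(1,4) by (intro emeasure_UN_countable[symmetric]) (auto simp: disjoint_family_on_def pairwise_def)
    also have "ennreal c * \<dots> \<le> ennreal c * emeasure lborel T"
    proof (intro mult_left_mono emeasure_mono)
      show "(\<Union>K\<in>\<D>. interior K) \<subseteq> T" using K interior_subset by fast
    qed (use T(1) in auto)
    also have "\<dots> \<le> ennreal c * ennreal e" using Te by (intro mult_left_mono) auto
    finally show ?thesis using c e by (simp add: ennreal_mult[symmetric])
  qed
  have "hausdorff_premeasure ?n \<delta> N \<le> 0 + ennreal e" if "0 < e" for e
  proof -
    have "hausdorff_premeasure ?n \<delta> N \<le> ennreal (c * (e / (c + 1)))"
      using c that by (intro bound) auto
    also have "\<dots> \<le> ennreal e" using c that by (intro ennreal_leI) (auto simp: field_simps)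
    finally show ?thesis by simp
  qed
  then have "hausdorff_premeasure ?n \<delta> N \<le> 0" by (rule ennreal_le_epsilon)
  then show ?thesis by simp
qed

text \<open>The weight of a ball is exactly its volume, whereas cubes would only give a constant
  larger than one. The Vitali covering theorem therefore exhausts \<open>E\<close> by disjoint small
  balls, up to a null set that costs nothing.\<close>

lemma hausdorff_measure_le_lborel:
  fixes E :: "'a::euclidean_space set"
  assumes E: "bounded E" "E \<in> sets borel"
  shows "hausdorff_measure DIM('a) E \<le> emeasure lborel E"
proof (rule hausdorff_measure_least)
  fix \<delta> :: real assume \<delta>: "0 < \<delta>"
  show "hausdorff_premeasure DIM('a) \<delta> E \<le> emeasure lborel E"
  proof (rule ennreal_le_epsilon)
    fix e :: real assume e: "0 < e"
    obtain U where U: "open U" "E \<subseteq> U" "U - E \<in> lmeasurable" "emeasure lebesgue (U - E) < ennreal e"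
      using sets_lebesgue_outer_open[of E e] e E by auto
    have "emeasure lborel U = emeasure lborel (E \<union> (U - E))" using U by (simp add: Un_absorb1)
    also have "\<dots> \<le> emeasure lborel E + emeasure lborel (U - E)"
      using E U by (intro emeasure_subadditive) auto
    also have "emeasure lborel (U - E) \<le> ennreal e"
      using U E by (simp add: emeasure_completion less_imp_le)
    finally have Ue: "emeasure lborel U \<le> emeasure lborel E + ennreal e"
      by (simp add: add_left_mono)
    let ?K = "{p :: 'a \<times> real. 0 < snd p \<and> snd p \<le> \<delta>/2 \<and> ball (fst p) (snd p) \<subseteq> U}"
    have fine: "\<exists>p. p \<in> ?K \<and> x \<in> ball (fst p) (snd p) \<and> snd p < d" if xd: "x \<in> E" "0 < d" for x d
    proof -
      obtain r where r: "0 < r" "ball x r \<subseteq> U" using U xd by (metis open_contains_ball subsetD)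
      let ?r = "min r (min (d/2) (\<delta>/2))"
      have "ball x ?r \<subseteq> U" using r by auto
      then show ?thesis using r xd \<delta> by (intro exI[of _ "(x, ?r)"]) auto
    qed
    obtain C where C: "countable C" "C \<subseteq> ?K"
      "pairwise (\<lambda>i j. disjnt (ball (fst i) (snd i)) (ball (fst j) (snd j))) C"
      "negligible (E - (\<Union>i \<in> C. ball (fst i) (snd i)))"
      by (rule Vitali_covering_theorem_balls[of E ?K fst snd, OF fine])
    let ?B = "\<lambda>p :: 'a \<times> real. ball (fst p) (snd p)"
    have ball: "hausdorff_premeasure DIM('a) \<delta> (?B p) \<le> emeasure lborel (?B p)" if "p \<in> C" for p
    proof -
      have p: "0 < snd p" "snd p \<le> \<delta>/2" using that C(2) by auto
      then have "hausdorff_premeasure DIM('a) \<delta> (?B p) \<le> hweight DIM('a) (?B p)"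
        by (intro hausdorff_premeasure_self) (auto simp: diameter_ball)
      also have "\<dots> = emeasure lborel (?B p)" using p by (simp add: diameter_ball emeasure_ball)
      finally show ?thesis .
    qed
    have "E \<subseteq> (\<Union>p\<in>C. ?B p) \<union> (E - (\<Union>p\<in>C. ?B p))" by blast
    then have "hausdorff_premeasure DIM('a) \<delta> E \<le>
        hausdorff_premeasure DIM('a) \<delta> (\<Union>p\<in>C. ?B p) + hausdorff_premeasure DIM('a) \<delta> (E - (\<Union>p\<in>C. ?B p))"
      using \<delta> by (intro order_trans[OF hausdorff_premeasure_mono hausdorff_premeasure_Un]) auto
    also have "hausdorff_premeasure DIM('a) \<delta> (E - (\<Union>p\<in>C. ?B p)) = 0"
      using C(4) E(1) \<delta> by (intro hausdorff_premeasure_negligible) (auto intro: bounded_subset)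
    also have "hausdorff_premeasure DIM('a) \<delta> (\<Union>p\<in>C. ?B p) + 0 \<le>
        (\<integral>\<^sup>+ p. hausdorff_premeasure DIM('a) \<delta> (?B p) \<partial>count_space C)"
      using C(1) \<delta> hausdorff_premeasure_UN_countable[of C "DIM('a)" \<delta> ?B] by simp
    also have "\<dots> \<le> (\<integral>\<^sup>+ p. emeasure lborel (?B p) \<partial>count_space C)"
      using ball by (intro nn_integral_mono) auto
    also have "\<dots> = emeasure lborel (\<Union>p\<in>C. ?B p)"
      using C(1,3) by (intro emeasure_UN_countable[symmetric]) (auto simp: disjoint_family_on_def pairwise_def disjnt_def)
    also have "\<dots> \<le> emeasure lborel U" using C(2) U(1) by (intro emeasure_mono) auto
    finally show "hausdorff_premeasure DIM('a) \<delta> E \<le> emeasure lborel E + ennreal e" using Ue by (rule order_trans)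
  qed
qed

subsection \<open>Tilted projections of graphs\<close>

lemma integrable_bounded_support:
  fixes g :: "'a::euclidean_space \<Rightarrow> real"
  assumes "g \<in> borel_measurable borel" "bounded K" "\<And>x. x \<notin> K \<Longrightarrow> g x = 0" "\<And>x. x \<in> K \<Longrightarrow> \<bar>g x\<bar> \<le> M"
  shows "integrable lborel g"
proof -
  obtain r where "\<And>x. x \<in> K \<Longrightarrow> norm x \<le> r" using assms(2) by (meson bounded_iff)
  then have r: "K \<subseteq> cball 0 r" by auto
  have "emeasure lborel (cball 0 r :: 'a set) < \<infinity>" by (rule emeasure_bounded_finite) simp
  moreover have "AE x in lborel. x \<in> cball 0 r \<longrightarrow> norm (g x) \<le> max M 0"
    using assms(3,4) by (intro AE_I2) (metis abs_zero max.coboundedI1 max.coboundedI2 order_refl real_norm_def)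
  moreover have "AE x in lborel. x \<notin> cball 0 r \<longrightarrow> g x = 0"
    using assms(3) r by (intro AE_I2) blast
  ultimately show ?thesis
    using assms(1) by (intro integrableI_bounded_set[where A = "cball 0 r" and B = "max M 0"]) auto
qed

lemma ennreal_integral_le_nn_integral:
  assumes "integrable M g"
  shows "ennreal (\<integral>x. g x \<partial>M) \<le> (\<integral>\<^sup>+x. ennreal (g x) \<partial>M)"
proof -
  have int: "integrable M (\<lambda>x. max 0 (g x))" using assms by (intro integrable_max) auto
  have "(\<integral>x. g x \<partial>M) \<le> (\<integral>x. max 0 (g x) \<partial>M)" by (intro integral_mono assms int) auto
  then have "ennreal (\<integral>x. g x \<partial>M) \<le> ennreal (\<integral>x. max 0 (g x) \<partial>M)" by (rule ennreal_leI)
  also have "\<dots> = (\<integral>\<^sup>+x. ennreal (max 0 (g x)) \<partial>M)"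
    using int by (intro nn_integral_eq_integral[symmetric]) auto
  also have "\<dots> = (\<integral>\<^sup>+x. ennreal (g x) \<partial>M)"
    by (intro nn_integral_cong) (simp add: max_def ennreal_neg)
  finally show ?thesis .
qed

lemma ennreal_add_le: "ennreal (a + b) \<le> ennreal a + ennreal b"
proof -
  have "ennreal (a + b) \<le> ennreal (max 0 a + max 0 b)" by (intro ennreal_leI) auto
  also have "\<dots> = ennreal (max 0 a) + ennreal (max 0 b)" by (simp add: ennreal_plus)
  also have "\<dots> = ennreal a + ennreal b" by (simp add: max_def ennreal_neg)
  finally show ?thesis .
qed

text \<open>Disjoint compact sets have positive distance, and the graphs over them at least the same
  distance, because the projection to the base is 1-Lipschitz. Metric additivity applies with no
  regularity of \<open>u\<close>.\<close>

lemma graph_measure_pieces: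
  fixes D :: "'a::euclidean_space set" and P :: "'a \<times> real \<Rightarrow> 'a"
  assumes fin: "finite \<Q>" and comp: "\<And>Q. Q \<in> \<Q> \<Longrightarrow> compact Q" and disj: "pairwise disjnt \<Q>"
  shows "(\<Sum>Q\<in>\<Q>. hausdorff_measure DIM('a) ((\<lambda>y. (y, u y :: real)) ` (D \<inter> Q)))
    \<le> hausdorff_measure DIM('a) ((\<lambda>y. (y, u y)) ` (D \<inter> \<Union>\<Q>))"
  using assms
proof (induction \<Q> rule: finite_induct)
  case empty
  then show ?case by simp
next
  case (insert Q \<Q>)
  let ?G = "\<lambda>S. (\<lambda>y. (y, u y)) ` (D \<inter> S)"
  have "Q \<inter> \<Union>\<Q> = {}" using insert by (auto simp: pairwise_insert disjnt_def)
  moreover have "compact Q" "closed (\<Union>\<Q>)" using insert by (auto intro!: closed_Union compact_imp_closed)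
  ultimately obtain r where r: "0 < r" "\<And>x y. x \<in> Q \<Longrightarrow> y \<in> \<Union>\<Q> \<Longrightarrow> r \<le> dist x y"
    using separate_compact_closed[of Q "\<Union>\<Q>"] by blast
  have "(\<Sum>Q\<in>insert Q \<Q>. hausdorff_measure DIM('a) (?G Q)) \<le>
      hausdorff_measure DIM('a) (?G Q) + hausdorff_measure DIM('a) (?G (\<Union>\<Q>))"
    using insert by (auto intro!: add_mono simp: pairwise_insert)
  also have "\<dots> \<le> hausdorff_measure DIM('a) (?G Q \<union> ?G (\<Union>\<Q>))"
  proof (rule hausdorff_measure_separated[OF _ r(1)])
    fix x y assume "x \<in> ?G Q" "y \<in> ?G (\<Union>\<Q>)"
    then have "fst x \<in> Q" "fst y \<in> \<Union>\<Q>" by auto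
    then have "r \<le> dist (fst x) (fst y)" by (rule r(2))
    also have "\<dots> \<le> dist x y" by (rule dist_fst_le)
    finally show "r \<le> dist x y" .
  qed simp
  also have "?G Q \<union> ?G (\<Union>\<Q>) = ?G (\<Union>(insert Q \<Q>))" by auto
  finally show ?case .
qed

text \<open>The part over \<open>D - K\<close> may touch the part over \<open>K\<close>. It is
  exhausted by the sets \<open>F k\<close> at distance at least \<open>1 / (k + 1)\<close> from
  \<open>K\<close>; over each of them the graph has at least the measure of its base.\<close>

lemma graph_measure_complement:
  fixes D :: "'a::euclidean_space set"
  assumes D: "D \<in> sets borel" and K: "compact K"
  shows "emeasure lborel (D - K) + hausdorff_measure DIM('a) ((\<lambda>y. (y, u y :: real)) ` (D \<inter> K))
    \<le> hausdorff_measure DIM('a) ((\<lambda>y. (y, u y)) ` D)"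
proof -
  let ?G = "\<lambda>S. (\<lambda>y. (y, u y)) ` S"
  define F where "F k = {y. \<forall>q\<in>K. 1 / real (Suc k) \<le> dist y q}" for k
  have F: "closed (F k)" for k
  proof -
    have "F k = (\<Inter>q\<in>K. {y. 1 / real (Suc k) \<le> dist y q})" by (auto simp: F_def)
    also have "closed \<dots>" by (intro closed_INT ballI closed_Collect_le continuous_intros)
    finally show ?thesis .
  qed
  have step: "emeasure lborel (D \<inter> F k) + hausdorff_measure DIM('a) (?G (D \<inter> K)) \<le> hausdorff_measure DIM('a) (?G D)" for k
  proof -
    have "emeasure lborel (D \<inter> F k) \<le> hausdorff_measure DIM('a) (D \<inter> F k)"
      using D F by (intro lborel_le_hausdorff_measure) auto
    also have "\<dots> = hausdorff_measure DIM('a) (fst ` ?G (D \<inter> F k))" by (simp add: image_image)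
    also have "\<dots> \<le> hausdorff_measure DIM('a) (?G (D \<inter> F k))"
      by (intro hausdorff_measure_contraction dist_fst_le)
    finally have "emeasure lborel (D \<inter> F k) + hausdorff_measure DIM('a) (?G (D \<inter> K)) \<le>
        hausdorff_measure DIM('a) (?G (D \<inter> F k)) + hausdorff_measure DIM('a) (?G (D \<inter> K))"
      by (rule add_right_mono)
    also have "\<dots> \<le> hausdorff_measure DIM('a) (?G (D \<inter> F k) \<union> ?G (D \<inter> K))"
    proof (rule hausdorff_measure_separated[of _ "1 / real (Suc k)"])
      fix x y assume "x \<in> ?G (D \<inter> F k)" "y \<in> ?G (D \<inter> K)"
      then have "1 / real (Suc k) \<le> dist (fst x) (fst y)" by (auto simp: F_def)
      also have "\<dots> \<le> dist x y" by (rule dist_fst_le)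
      finally show "1 / real (Suc k) \<le> dist x y" .
    qed auto
    also have "\<dots> \<le> hausdorff_measure DIM('a) (?G D)" by (intro hausdorff_measure_mono) auto
    finally show ?thesis .
  qed
  have "(SUP k. emeasure lborel (D \<inter> F k)) = emeasure lborel (\<Union>k. D \<inter> F k)"
  proof (rule SUP_emeasure_incseq)
    show "range (\<lambda>k. D \<inter> F k) \<subseteq> sets lborel" using D F by auto
    have "1 / real (Suc (Suc k)) \<le> 1 / real (Suc k)" for k by (simp add: field_simps)
    then show "incseq (\<lambda>k. D \<inter> F k)"
      unfolding F_def by (intro incseq_SucI) (auto intro: order_trans)
  qed
  also have "(\<Union>k. D \<inter> F k) = D - K"
  proof (intro equalityI subsetI)
    fix y assume y: "y \<in> (\<Union>k. D \<inter> F k)"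
    then obtain k where k: "y \<in> D" "y \<in> F k" by blast
    then have "y \<notin> K" by (force simp: F_def)
    with k show "y \<in> D - K" by blast
  next
    fix y assume y: "y \<in> D - K"
    then obtain r where r: "0 < r" "\<And>q. q \<in> K \<Longrightarrow> r \<le> dist y q"
      using separate_point_closed[of K y] compact_imp_closed[OF K] by auto
    obtain k where "1 / real (Suc k) < r" using r(1) nat_approx_posE by metis
    then have "y \<in> F k" using r(2) by (fastforce simp: F_def)
    with y show "y \<in> (\<Union>k. D \<inter> F k)" by blast
  qed
  finally have "emeasure lborel (D - K) + hausdorff_measure DIM('a) (?G (D \<inter> K)) =
      (SUP k. emeasure lborel (D \<inter> F k) + hausdorff_measure DIM('a) (?G (D \<inter> K)))"
    by (simp add: ennreal_SUP_add_left)
  also have "\<dots> \<le> hausdorff_measure DIM('a) (?G D)" by (intro SUP_least step)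
  finally show ?thesis .
qed

text \<open>For \<open>e\<close> of norm one this is the orthogonal projection along \<open>(- a e, 1)\<close>, followed by the
  rotation that identifies the orthogonal complement of that vector with the base space.\<close>

definition tilt :: "real \<Rightarrow> 'a::euclidean_space \<Rightarrow> 'a \<times> real \<Rightarrow> 'a" where
  "tilt a e p = fst p + ((1 / sqrt (1 + a\<^sup>2) - 1) * (fst p \<bullet> e) + a / sqrt (1 + a\<^sup>2) * snd p) *\<^sub>R e"

lemma tilt_diff: "tilt a e p - tilt a e q = tilt a e (p - q)"
proof -
  have "(1 / sqrt (1 + a\<^sup>2) - 1) * (fst (p - q) \<bullet> e) + a / sqrt (1 + a\<^sup>2) * snd (p - q) =
      ((1 / sqrt (1 + a\<^sup>2) - 1) * (fst p \<bullet> e) + a / sqrt (1 + a\<^sup>2) * snd p) -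
      ((1 / sqrt (1 + a\<^sup>2) - 1) * (fst q \<bullet> e) + a / sqrt (1 + a\<^sup>2) * snd q)"
    by (simp only: fst_diff snd_diff inner_diff_left right_diff_distrib)
  then show ?thesis unfolding tilt_def by (simp only: scaleR_left_diff_distrib fst_diff) simp
qed

text \<open>In the plane of \<open>e\<close> and the vertical axis, with coordinates
  \<open>w\<close> and \<open>z\<close>, the map rotates by the unit vector \<open>(c, s)\<close>
  and forgets the rotated coordinate \<open>s * w - c * z\<close>; orthogonally to this plane it is
  the identity.\<close>

lemma norm_tilt_le:
  assumes e: "norm e = 1"
  shows "norm (tilt a e p) \<le> norm p"
proof -
  define c s where "c = 1 / sqrt (1 + a\<^sup>2)" and "s = a / sqrt (1 + a\<^sup>2)"
  define w z where "w = fst p \<bullet> e" and "z = snd p"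
  have pos: "0 < 1 + a\<^sup>2" by (simp add: add_pos_nonneg)
  have "c\<^sup>2 + s\<^sup>2 = 1"
    using pos by (simp add: c_def s_def power_divide add_divide_distrib[symmetric])
  then have cs: "(c * w + s * z)\<^sup>2 + (s * w - c * z)\<^sup>2 = w\<^sup>2 + z\<^sup>2" by algebra
  define k where "k = (c - 1) * w + s * z"
  have ee: "e \<bullet> e = 1" using e by (simp add: norm_eq_1)
  have "(norm (tilt a e p))\<^sup>2 = (fst p + k *\<^sub>R e) \<bullet> (fst p + k *\<^sub>R e)"
    by (simp add: tilt_def k_def c_def s_def w_def z_def power2_norm_eq_inner)
  also have "\<dots> = fst p \<bullet> fst p + 2 * k * w + k\<^sup>2"
    by (simp add: inner_add_left inner_add_right ee w_def inner_commute power2_eq_square)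
  also have "\<dots> = fst p \<bullet> fst p - w\<^sup>2 + (c * w + s * z)\<^sup>2"
    by (simp add: k_def power2_eq_square algebra_simps)
  also have "\<dots> \<le> fst p \<bullet> fst p + z\<^sup>2"
    using cs zero_le_power2[of "s * w - c * z"] by linarith
  also have "\<dots> = (norm p)\<^sup>2"
    by (simp add: norm_prod_def z_def power2_norm_eq_inner)
  finally show ?thesis by (rule power2_le_imp_le) simp
qed

lemma dist_tilt_le: "norm e = 1 \<Longrightarrow> dist (tilt a e p) (tilt a e q) \<le> dist p q"
  by (simp add: dist_norm tilt_diff norm_tilt_le)

text \<open>Each box replaces its base measure by the lower bound \<open>b Q\<close> obtained from
  its own projection. Boxes may stick out of \<open>D\<close>; there \<open>u\<close> vanishes and
  the excess \<open>Q - D\<close> contributes at most its own volume. This lets fixed boxes be used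
  while \<open>D\<close> varies with the time.\<close>

lemma graph_measure_tilted:
  fixes D :: "'a::euclidean_space set"
  assumes D: "bounded D" "D \<in> sets borel"
    and fin: "finite \<Q>" and comp: "\<And>Q. Q \<in> \<Q> \<Longrightarrow> compact Q" and disj: "pairwise disjnt \<Q>"
    and e: "norm e = 1"
    and u0: "\<And>Q y. Q \<in> \<Q> \<Longrightarrow> y \<in> Q \<Longrightarrow> y \<notin> D \<Longrightarrow> u y = 0"
    and b: "\<And>Q. Q \<in> \<Q> \<Longrightarrow> ennreal (b Q) \<le> hausdorff_measure DIM('a) ((\<lambda>y. tilt (a Q) e (y, u y)) ` Q)"
  shows "ennreal (measure lborel D + (\<Sum>Q\<in>\<Q>. b Q - measure lborel Q)) \<le>
    hausdorff_measure DIM('a) ((\<lambda>y. (y, u y)) ` D)"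
proof -
  let ?G = "\<lambda>S. (\<lambda>y. (y, u y)) ` S" and ?m = "measure lborel"
  have Qm: "Q \<in> fmeasurable lborel" if "Q \<in> \<Q>" for Q
    using comp[OF that] by (intro fmeasurable_bounded_borel) (auto intro: compact_imp_bounded borel_compact)
  have Dm: "D \<in> fmeasurable lborel" using D by (rule fmeasurable_bounded_borel)
  have em: "emeasure lborel A = ennreal (?m A)" if "A \<in> fmeasurable lborel" for A
    using that by (rule emeasure_eq_measure2)
  have UQ: "compact (\<Union>\<Q>)" using fin comp by (rule compact_Union)
  have UQm: "\<Union>\<Q> \<in> fmeasurable lborel" using fin Qm by (intro fmeasurable.finite_Union) auto
  have piece: "ennreal (b Q) \<le> hausdorff_measure DIM('a) (?G (D \<inter> Q)) + ennreal (?m (Q - D))" if Q: "Q \<in> \<Q>" for Q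
  proof -
    let ?F = "\<lambda>y. tilt (a Q) e (y, u y)"
    have "ennreal (b Q) \<le> hausdorff_measure DIM('a) (?F ` Q)" by (rule b[OF Q])
    also have "?F ` Q = ?F ` (D \<inter> Q) \<union> ?F ` (Q - D)" by auto
    also have "?F ` (D \<inter> Q) = tilt (a Q) e ` ?G (D \<inter> Q)" by (simp add: image_image)
    also have "?F ` (Q - D) = (\<lambda>y. tilt (a Q) e (y, 0)) ` (Q - D)"
      using u0[OF Q] by (intro image_cong) auto
    also have "hausdorff_measure DIM('a) (tilt (a Q) e ` ?G (D \<inter> Q) \<union> (\<lambda>y. tilt (a Q) e (y, 0)) ` (Q - D)) \<le>
        hausdorff_measure DIM('a) (tilt (a Q) e ` ?G (D \<inter> Q)) + hausdorff_measure DIM('a) ((\<lambda>y. tilt (a Q) e (y, 0)) ` (Q - D))"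
      by (rule hausdorff_measure_Un) simp
    also have "\<dots> \<le> hausdorff_measure DIM('a) (?G (D \<inter> Q)) + hausdorff_measure DIM('a) (Q - D)"
    proof (intro add_mono hausdorff_measure_contraction dist_tilt_le e)
      fix x y
      show "dist (tilt (a Q) e (x, 0)) (tilt (a Q) e (y, 0)) \<le> dist x y"
        using dist_tilt_le[OF e, of "a Q" "(x, 0)" "(y, 0)"] by (simp add: dist_Pair_Pair)
    qed
    also have "hausdorff_measure DIM('a) (Q - D) \<le> emeasure lborel (Q - D)"
      using comp[OF Q] D by (intro hausdorff_measure_le_lborel) (auto intro: compact_imp_bounded borel_compact bounded_subset)
    also have "emeasure lborel (Q - D) = ennreal (?m (Q - D))"
      using Qm[OF Q] D by (intro em fmeasurable_Diff) auto
    finally show ?thesis by (simp add: add_left_mono)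
  qed
  have "ennreal (\<Sum>Q\<in>\<Q>. b Q) \<le> (\<Sum>Q\<in>\<Q>. ennreal (b Q))"
    using fin
  proof (induction \<Q> rule: finite_induct)
    case (insert Q \<Q>)
    then show ?case using ennreal_add_le[of "b Q" "\<Sum>Q\<in>\<Q>. b Q"]
      by (auto intro: order_trans add_left_mono)
  qed simp
  also have "\<dots> \<le> (\<Sum>Q\<in>\<Q>. hausdorff_measure DIM('a) (?G (D \<inter> Q)) + ennreal (?m (Q - D)))"
    by (intro sum_mono piece)
  also have "\<dots> = (\<Sum>Q\<in>\<Q>. hausdorff_measure DIM('a) (?G (D \<inter> Q))) + ennreal (\<Sum>Q\<in>\<Q>. ?m (Q - D))"
    by (simp add: sum.distrib)
  also have "\<dots> \<le> hausdorff_measure DIM('a) (?G (D \<inter> \<Union>\<Q>)) + ennreal (\<Sum>Q\<in>\<Q>. ?m (Q - D))"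
    using graph_measure_pieces[OF fin comp disj, of u D] by (intro add_right_mono)
  finally have 1: "ennreal (\<Sum>Q\<in>\<Q>. b Q) \<le> hausdorff_measure DIM('a) (?G (D \<inter> \<Union>\<Q>)) + ennreal (\<Sum>Q\<in>\<Q>. ?m (Q - D))" .
  have 2: "ennreal (?m (D - \<Union>\<Q>)) + hausdorff_measure DIM('a) (?G (D \<inter> \<Union>\<Q>)) \<le> hausdorff_measure DIM('a) (?G D)"
    using graph_measure_complement[OF D(2) UQ, of u]
    unfolding em[OF fmeasurable_Diff[OF Dm fmeasurableD[OF UQm]]] .
  \<comment> \<open>Both sides measure \<open>D\<close> together with all the boxes.\<close>
  have add: "?m D + (\<Sum>Q\<in>\<Q>. ?m (Q - D)) = ?m (D - \<Union>\<Q>) + (\<Sum>Q\<in>\<Q>. ?m Q)"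
  proof -
    have un: "?m (\<Union>Q\<in>\<Q>. g Q) = (\<Sum>Q\<in>\<Q>. ?m (g Q))"
      if g: "\<And>Q. Q \<in> \<Q> \<Longrightarrow> g Q \<in> fmeasurable lborel" "\<And>Q. g Q \<subseteq> Q" for g
    proof (rule measure_finite_Union[OF fin])
      show "g ` \<Q> \<subseteq> sets lborel" using fmeasurableD[OF g(1)] by auto
      show "emeasure lborel (g Q) \<noteq> \<infinity>" if "Q \<in> \<Q>" for Q
        using fmeasurableD2[OF g(1)[OF that]] by simp
      have "g P \<inter> g Q = {}" if "P \<in> \<Q>" "Q \<in> \<Q>" "P \<noteq> Q" for P Q
        using pairwiseD[OF disj that] g(2)[of P] g(2)[of Q] unfolding disjnt_def by blast
      then show "disjoint_family_on g \<Q>" unfolding disjoint_family_on_def by blast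
    qed
    have "?m D + (\<Sum>Q\<in>\<Q>. ?m (Q - D)) = ?m D + ?m (\<Union>Q\<in>\<Q>. Q - D)"
      using Qm D by (subst un) (auto intro!: fmeasurable_Diff)
    also have "\<dots> = ?m (D \<union> (\<Union>Q\<in>\<Q>. Q - D))"
      using fin Qm D Dm by (intro measure_disjoint_Un[symmetric] fmeasurable.finite_UN fmeasurable_Diff) auto
    also have "D \<union> (\<Union>Q\<in>\<Q>. Q - D) = (D - \<Union>\<Q>) \<union> (\<Union>Q\<in>\<Q>. Q)" by auto
    also have "?m \<dots> = ?m (D - \<Union>\<Q>) + ?m (\<Union>Q\<in>\<Q>. Q)"
      using Dm UQm fmeasurableD[OF UQm] by (intro measure_disjoint_Un fmeasurable_Diff) auto
    also have "?m (\<Union>Q\<in>\<Q>. Q) = (\<Sum>Q\<in>\<Q>. ?m Q)"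
      using Qm by (intro un) auto
    finally show ?thesis .
  qed
  have "ennreal (?m D + (\<Sum>Q\<in>\<Q>. b Q - ?m Q)) + ennreal (\<Sum>Q\<in>\<Q>. ?m (Q - D)) \<le>
      hausdorff_measure DIM('a) (?G D) + ennreal (\<Sum>Q\<in>\<Q>. ?m (Q - D))"
  proof (cases "0 \<le> ?m D + (\<Sum>Q\<in>\<Q>. b Q - ?m Q)")
    case True
    then have "ennreal (?m D + (\<Sum>Q\<in>\<Q>. b Q - ?m Q)) + ennreal (\<Sum>Q\<in>\<Q>. ?m (Q - D)) =
        ennreal ((?m D + (\<Sum>Q\<in>\<Q>. b Q - ?m Q)) + (\<Sum>Q\<in>\<Q>. ?m (Q - D)))"
      by (intro ennreal_plus[symmetric] sum_nonneg) auto
    also have "(?m D + (\<Sum>Q\<in>\<Q>. b Q - ?m Q)) + (\<Sum>Q\<in>\<Q>. ?m (Q - D)) = ?m (D - \<Union>\<Q>) + (\<Sum>Q\<in>\<Q>. b Q)"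
      using add by (simp add: sum_subtractf)
    also have "\<dots> \<le> ennreal (?m (D - \<Union>\<Q>)) + ennreal (\<Sum>Q\<in>\<Q>. b Q)"
      by (rule ennreal_add_le)
    also have "\<dots> \<le> ennreal (?m (D - \<Union>\<Q>)) +
        (hausdorff_measure DIM('a) (?G (D \<inter> \<Union>\<Q>)) + ennreal (\<Sum>Q\<in>\<Q>. ?m (Q - D)))"
      using 1 by (rule add_left_mono)
    also have "\<dots> \<le> hausdorff_measure DIM('a) (?G D) + ennreal (\<Sum>Q\<in>\<Q>. ?m (Q - D))"
      using 2 by (simp add: add.assoc[symmetric] add_right_mono)
    finally show ?thesis .
  next
    case False
    then show ?thesis by (simp add: ennreal_neg)
  qed
  then show ?thesis
    unfolding add.commute[of _ "ennreal (\<Sum>Q\<in>\<Q>. ?m (Q - D))"] ennreal_add_left_cancel_le by simp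
qed

section \<open>Exchanging two coordinates\<close>

definition coord_swap :: "'a::euclidean_space \<Rightarrow> 'a \<Rightarrow> 'a \<Rightarrow> 'a" where
  "coord_swap e k x = x - (x \<bullet> (e - k)) *\<^sub>R (e - k)"

context
  fixes e k :: "'a::euclidean_space"
  assumes ek: "e \<in> Basis" "k \<in> Basis"
begin

text \<open>\<open>coord_swap e k\<close> is the reflection in the hyperplane orthogonal to
  \<open>e - k\<close>. For distinct basis vectors the squared norm of \<open>e - k\<close> is two,
  so the usual factor \<open>2 / |e - k|\<^sup>2\<close> is one; for \<open>e = k\<close> the map is
  the identity.\<close>

lemma inner_coord_swap:
  assumes "i \<in> Basis"
  shows "coord_swap e k x \<bullet> i = x \<bullet> (if i = e then k else if i = k then e else i)"
  using ek assms by (auto simp: coord_swap_def inner_diff_left inner_diff_right inner_Basis)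

lemma coord_swap_coord_swap: "coord_swap e k (coord_swap e k x) = x"
proof (rule euclidean_eqI)
  fix i :: 'a assume "i \<in> Basis"
  then show "coord_swap e k (coord_swap e k x) \<bullet> i = x \<bullet> i"
    using ek by (simp add: inner_coord_swap)
qed

lemma inner_coord_swap_coord_swap: "coord_swap e k x \<bullet> coord_swap e k y = x \<bullet> y"
proof -
  have "e \<bullet> e = 1" "k \<bullet> k = 1" "e \<noteq> k \<Longrightarrow> e \<bullet> k = 0" "e \<noteq> k \<Longrightarrow> k \<bullet> e = 0"
    using ek by (auto simp: inner_Basis)
  then show ?thesis
    by (cases "e = k") (simp_all add: coord_swap_def inner_diff_left inner_diff_right inner_commute algebra_simps)
qed

lemma coord_swap_diff: "coord_swap e k x - coord_swap e k y = coord_swap e k (x - y)"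
  by (simp add: coord_swap_def inner_diff_left algebra_simps)

lemma dist_coord_swap: "dist (coord_swap e k x) (coord_swap e k y) = dist x y"
  by (simp add: dist_norm coord_swap_diff norm_eq_sqrt_inner inner_coord_swap_coord_swap)

lemma coord_swap_image_eq_vimage: "coord_swap e k ` A = coord_swap e k -` A"
proof (intro equalityI subsetI)
  fix x assume "x \<in> coord_swap e k -` A"
  then show "x \<in> coord_swap e k ` A"
    by (intro image_eqI[of _ _ "coord_swap e k x"]) (simp_all add: coord_swap_coord_swap)
qed (auto simp: coord_swap_coord_swap)

lemma coord_swap_image_cbox: "coord_swap e k ` cbox a b = cbox (coord_swap e k a) (coord_swap e k b)"
  unfolding coord_swap_image_eq_vimage using ek by (auto simp: mem_box inner_coord_swap split: if_splits)

lemma hausdorff_measure_coord_swap: "hausdorff_measure n (coord_swap e k ` A) = hausdorff_measure n A"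
proof (rule antisym)
  show "hausdorff_measure n (coord_swap e k ` A) \<le> hausdorff_measure n A"
    by (intro hausdorff_measure_contraction) (simp add: dist_coord_swap)
  have "hausdorff_measure n (coord_swap e k ` coord_swap e k ` A) \<le> hausdorff_measure n (coord_swap e k ` A)"
    by (intro hausdorff_measure_contraction) (simp add: dist_coord_swap)
  then show "hausdorff_measure n A \<le> hausdorff_measure n (coord_swap e k ` A)"
    by (simp add: image_image coord_swap_coord_swap)
qed

lemma continuous_on_coord_swap: "continuous_on A (coord_swap e k)"
  unfolding coord_swap_def by (intro continuous_intros)

lemma borel_measurable_coord_swap: "coord_swap e k \<in> borel_measurable borel"
  using continuous_on_coord_swap by (rule borel_measurable_continuous_onI)

text \<open>Hausdorff measure is invariant under isometries and agrees with Lebesgue measure on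
  bounded Borel sets, so Lebesgue measure inherits the invariance.\<close>

lemma distr_lborel_coord_swap: "distr lborel borel (coord_swap e k) = (lborel :: 'a measure)"
proof (rule lborel_eqI[symmetric])
  fix l u :: 'a assume le: "\<And>b. b \<in> Basis \<Longrightarrow> l \<bullet> b \<le> u \<bullet> b"
  have box: "emeasure lborel A = hausdorff_measure DIM('a) A" if "bounded A" "A \<in> sets borel" for A :: "'a set"
    using that by (intro antisym lborel_le_hausdorff_measure hausdorff_measure_le_lborel)
  have vim: "coord_swap e k -` box l u \<in> sets borel"
    using measurable_sets_borel[OF borel_measurable_coord_swap, of "box l u"] by simp
  have "bounded (coord_swap e k ` box l u)"
    using bounded_box[of l u] dist_coord_swap unfolding bounded_two_points by (metis (no_types, lifting) imageE)
  then have "emeasure lborel (coord_swap e k -` box l u) = hausdorff_measure DIM('a) (coord_swap e k -` box l u)"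
    using vim by (intro box) (simp_all add: coord_swap_image_eq_vimage)
  also have "\<dots> = hausdorff_measure DIM('a) (box l u)"
    by (simp add: coord_swap_image_eq_vimage[symmetric] hausdorff_measure_coord_swap)
  also have "\<dots> = emeasure lborel (box l u)" by (rule box[symmetric]) auto
  finally show "emeasure (distr lborel borel (coord_swap e k)) (box l u) = ennreal (\<Prod>b\<in>Basis. (u - l) \<bullet> b)"
    using le borel_measurable_coord_swap by (simp add: emeasure_distr emeasure_lborel_box)
qed simp

lemma integral_coord_swap:
  fixes g :: "'a \<Rightarrow> real"
  assumes "g \<in> borel_measurable borel"
  shows "(\<integral>x. g (coord_swap e k x) \<partial>lborel) = (\<integral>x. g x \<partial>lborel)"
  using integral_distr[of "coord_swap e k" lborel borel g] assms borel_measurable_coord_swap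
  by (simp add: distr_lborel_coord_swap)

lemma tilt_coord_swap: "tilt a e (coord_swap e k x, z) = coord_swap e k (tilt a k (x, z))"
proof -
  have "coord_swap e k x \<bullet> e = x \<bullet> k" using ek by (simp add: inner_coord_swap)
  moreover have "coord_swap e k (x + r *\<^sub>R k) = coord_swap e k x + r *\<^sub>R e" for r
    using ek by (cases "e = k")
      (simp_all add: coord_swap_def inner_add_left inner_diff_right inner_Basis algebra_simps)
  ultimately show ?thesis by (simp add: tilt_def)
qed

end

text \<open>With an antiderivative \<open>W\<close> of \<open>w\<close>, the integral telescopes to
  the difference of the averages \<open>G\<close> of \<open>w\<close> over
  \<open>[\<beta>, \<beta> + h]\<close> and \<open>[\<alpha>, \<alpha> + h]\<close>. Each average
  differs from the value at the left end by at most \<open>L * h\<close>.\<close>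

lemma difference_quotient_integral_approx:
  fixes w :: "real \<Rightarrow> real"
  assumes w: "L-lipschitz_on UNIV w" and ab: "\<alpha> \<le> \<beta>" and h: "0 < h"
  shows "\<bar>(\<integral>z. indicator {\<alpha>..\<beta>} z * ((w (z + h) - w z) / h) \<partial>lborel) - (w \<beta> - w \<alpha>)\<bar> \<le> 2 * L * h"
proof -
  have cont: "continuous_on UNIV w" using w by (rule lipschitz_on_continuous_on)
  define W where "W x = integral {\<alpha> - 1..x} w" for x
  have W: "(W has_real_derivative w x) (at x)" if "\<alpha> \<le> x" "x \<le> \<beta> + h" for x
  proof -
    have "(W has_real_derivative w x) (at x within {\<alpha> - 1..\<beta> + h + 1})"
      unfolding W_def using that h by (intro integral_has_real_derivative continuous_on_subset[OF cont]) auto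
    moreover have "at x within {\<alpha> - 1..\<beta> + h + 1} = at x"
      using that h by (intro at_within_interior) (simp add: interior_atLeastAtMost_real)
    ultimately show ?thesis by simp
  qed
  define G where "G x = (W (x + h) - W x) / h" for x
  have G: "(G has_real_derivative (w (x + h) - w x) / h) (at x)" if "\<alpha> \<le> x" "x \<le> \<beta>" for x
  proof -
    have "((\<lambda>x. W (x + h)) has_real_derivative w (x + h)) (at x)"
      using W[of "x + h"] that h DERIV_shift[of W "w (x + h)" x h] by simp
    then show ?thesis
      unfolding G_def using W[of x] that h by (intro DERIV_cdivide DERIV_diff) auto
  qed
  have I: "(\<integral>z. ((w (z + h) - w z) / h) * indicator {\<alpha>..\<beta>} z \<partial>lborel) = G \<beta> - G \<alpha>"
  proof (rule integral_FTC_Icc_real[OF ab G])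
    fix x
    show "isCont (\<lambda>z. (w (z + h) - w z) / h) x"
      using isCont_o2[of x "\<lambda>z. z + h" w] cont h
      by (intro isCont_divide isCont_diff) (auto simp: continuous_on_eq_continuous_at)
  qed
  have *: "\<bar>G x - w x\<bar> \<le> L * h" if x: "\<alpha> \<le> x" "x \<le> \<beta>" for x
  proof -
    have "\<exists>y>x. y < x + h \<and> W (x + h) - W x = (x + h - x) * w y"
      using x h W by (intro MVT2) auto
    then obtain y where y: "x < y" "y < x + h" "G x = w y"
      using h by (auto simp: G_def)
    have "\<bar>w y - w x\<bar> \<le> L * \<bar>y - x\<bar>"
      using lipschitz_onD[OF w, of y x] by (simp add: dist_real_def)
    also have "\<dots> \<le> L * h" using y lipschitz_on_nonneg[OF w] by (intro mult_left_mono) auto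
    finally show ?thesis using y by simp
  qed
  have "\<bar>G \<alpha> - w \<alpha>\<bar> \<le> L * h" "\<bar>G \<beta> - w \<beta>\<bar> \<le> L * h" using *[of \<alpha>] *[of \<beta>] ab by auto
  then have "\<bar>(G \<beta> - G \<alpha>) - (w \<beta> - w \<alpha>)\<bar> \<le> 2 * L * h" unfolding abs_le_iff by linarith
  then show ?thesis unfolding I[symmetric] by (simp only: mult.commute[of "indicator _ _"])
qed

section \<open>The projected area over one box\<close>

lemma lipschitz_on_shift:
  fixes v :: "'a::real_normed_vector \<Rightarrow> real"
  assumes "L-lipschitz_on UNIV v"
  shows "\<bar>(v (x + h *\<^sub>R e) - v x) / h\<bar> \<le> L * norm e"
proof (cases "h = 0")
  case False
  have "\<bar>v (x + h *\<^sub>R e) - v x\<bar> \<le> L * (\<bar>h\<bar> * norm e)"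
    using lipschitz_onD[OF assms, of "x + h *\<^sub>R e" x] by (simp add: dist_norm)
  then show ?thesis using False by (simp add: abs_divide divide_le_eq mult_ac)
qed (use lipschitz_on_nonneg[OF assms] in simp)

lemma borel_measurable_lipschitz:
  fixes v :: "'a::metric_space \<Rightarrow> real"
  shows "L-lipschitz_on UNIV v \<Longrightarrow> v \<in> borel_measurable borel"
  by (intro borel_measurable_continuous_onI lipschitz_on_continuous_on)

lemma difference_quotient_measurable:
  fixes v :: "'a::euclidean_space \<Rightarrow> real"
  assumes "v \<in> borel_measurable borel"
  shows "(\<lambda>x. (v (x + h *\<^sub>R e) - v x) / h) \<in> borel_measurable borel"
proof -
  have "(\<lambda>x. x + h *\<^sub>R e) \<in> borel_measurable borel"
    by (intro borel_measurable_continuous_onI continuous_intros)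
  then show ?thesis using assms by (auto intro!: borel_measurable_diff borel_measurable_divide measurable_compose[of _ borel borel v])
qed

text \<open>The tilt preserves vertical lines. On each line the image of the graph is connected and
  joins \<open>lo y\<close> to \<open>hi y\<close>, so it covers the interval between them, even
  where the tilted map folds. Fubini bounds the area by the integral of \<open>hi - lo\<close>, and
  this difference is the integral of \<open>c + s \<partial>v\<close> along the line.\<close>

lemma tilted_vertical_box:
  fixes v :: "'b::euclidean_space \<times> real \<Rightarrow> real" and a :: real
  assumes v: "L-lipschitz_on UNIV v" and ab: "\<alpha> \<le> \<beta>" and h: "0 < h"
  defines "c \<equiv> 1 / sqrt (1 + a\<^sup>2)" and "s \<equiv> a / sqrt (1 + a\<^sup>2)"
  shows "ennreal (\<integral>x. indicator (cbox (p, \<alpha>) (q, \<beta>)) x * (c + s * ((v (x + h *\<^sub>R (0, 1)) - v x) / h)) \<partial>lborel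
      - 2 * \<bar>s\<bar> * L * h * measure lborel (cbox p q))
    \<le> hausdorff_measure DIM('b \<times> real) ((\<lambda>x. tilt a (0, 1) (x, v x)) ` cbox (p, \<alpha>) (q, \<beta>))"
proof -
  let ?Q = "cbox (p, \<alpha>) (q, \<beta>)"
  let ?dv = "\<lambda>x. (v (x + h *\<^sub>R (0, 1)) - v x) / h"
  define lo where "lo y = c * \<alpha> + s * v (y, \<alpha>)" for y
  define hi where "hi y = c * \<beta> + s * v (y, \<beta>)" for y
  have cv: "continuous_on A v" for A
    using lipschitz_on_continuous_on[OF v] continuous_on_subset by blast
  have cslice: "continuous_on A (\<lambda>y. v (y, z))" for A z
    by (intro continuous_on_compose2[OF cv[of UNIV]] continuous_intros) auto
  have cvert: "continuous_on A (\<lambda>z. v (y, z))" for A y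
    by (intro continuous_on_compose2[OF cv[of UNIV]] continuous_intros) auto
  have clohi: "continuous_on A lo" "continuous_on A hi" for A
    unfolding lo_def hi_def by (intro continuous_intros cslice)+
  have Q: "(y, z) \<in> ?Q \<longleftrightarrow> y \<in> cbox p q \<and> z \<in> {\<alpha>..\<beta>}" for y z
    by (auto simp: cbox_Pair_eq)
  define R where "R = {x :: 'b \<times> real. fst x \<in> cbox p q \<and> lo (fst x) \<le> snd x \<and> snd x \<le> hi (fst x)}"
  have tilt: "tilt a (0, 1) (x, v x) = (fst x, c * snd x + s * v x)" for x
    by (simp add: tilt_def c_def s_def prod_eq_iff inner_prod_def algebra_simps)
  have "R \<subseteq> (\<lambda>x. tilt a (0, 1) (x, v x)) ` ?Q"
  proof
    fix x assume x: "x \<in> R"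
    have "\<exists>z\<ge>\<alpha>. z \<le> \<beta> \<and> c * z + s * v (fst x, z) = snd x"
      using x ab by (intro IVT') (auto simp: R_def lo_def hi_def intro!: continuous_intros cvert)
    then obtain z where z: "\<alpha> \<le> z" "z \<le> \<beta>" "c * z + s * v (fst x, z) = snd x" by blast
    then have "x = tilt a (0, 1) ((fst x, z), v (fst x, z))" by (simp add: tilt prod_eq_iff)
    moreover have "(fst x, z) \<in> ?Q" using x z by (simp add: Q R_def)
    ultimately show "x \<in> (\<lambda>x. tilt a (0, 1) (x, v x)) ` ?Q" by (rule image_eqI)
  qed
  then have H: "hausdorff_measure DIM('b \<times> real) R \<le> hausdorff_measure DIM('b \<times> real) ((\<lambda>x. tilt a (0, 1) (x, v x)) ` ?Q)"
    by (rule hausdorff_measure_mono)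
  have "closed R"
  proof -
    have "R = (fst -` cbox p q) \<inter> ({x. lo (fst x) \<le> snd x} \<inter> {x. snd x \<le> hi (fst x)})" by (auto simp: R_def)
    also have "closed \<dots>"
      by (intro closed_Int closed_vimage_fst closed_cbox closed_Collect_le continuous_on_compose2[OF clohi(1)[of UNIV]] continuous_on_compose2[OF clohi(2)[of UNIV]] continuous_intros) auto
    finally show ?thesis .
  qed
  then have Rb: "R \<in> sets borel" by simp
  have dv: "\<bar>?dv x\<bar> \<le> L" for x using lipschitz_on_shift[OF v, of x h "(0, 1)"] by simp
  have dvm: "?dv \<in> borel_measurable borel"
    by (intro difference_quotient_measurable borel_measurable_lipschitz[OF v])
  let ?g = "\<lambda>x. indicator ?Q x * (c + s * ?dv x)"
  have gb: "\<bar>?g x\<bar> \<le> \<bar>c\<bar> + \<bar>s\<bar> * L" for x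
  proof -
    have "\<bar>c + s * ?dv x\<bar> \<le> \<bar>c\<bar> + \<bar>s\<bar> * L"
      using mult_left_mono[OF dv[of x], of "\<bar>s\<bar>"] by (intro order_trans[OF abs_triangle_ineq]) (auto simp: abs_mult)
    then show ?thesis using lipschitz_on_nonneg[OF v] by (auto simp: indicator_def)
  qed
  have g: "integrable lborel ?g"
  proof (rule integrable_bounded_support[where K = ?Q, OF _ bounded_cbox _ gb])
    show "?g \<in> borel_measurable borel"
      by (intro borel_measurable_times borel_measurable_indicator borel_measurable_add borel_measurable_const dvm) simp
  qed simp
  let ?l = "\<lambda>y. indicator (cbox p q) y * (hi y - lo y)"
  \<comment> \<open>The difference quotient is exchanged for the exact increment of \<open>v\<close>
    on each vertical line, at the cost \<open>2 * L * h\<close> times the sine of the tilt.\<close>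
  have inner: "(\<integral>z. ?g (y, z) \<partial>lborel) \<le> ?l y + indicator (cbox p q) y * (2 * \<bar>s\<bar> * L * h)" for y
  proof (cases "y \<in> cbox p q")
    case True
    let ?w = "\<lambda>z. v (y, z)"
    have w: "L-lipschitz_on UNIV ?w"
    proof (rule lipschitz_onI)
      show "dist (?w z) (?w z') \<le> L * dist z z'" for z z'
        using lipschitz_onD[OF v, of "(y, z)" "(y, z')"] by (simp add: dist_Pair_Pair)
    qed (rule lipschitz_on_nonneg[OF v])
    have int: "integrable lborel (\<lambda>z. indicator {\<alpha>..\<beta>} z * ((?w (z + h) - ?w z) / h))"
    proof (rule integrable_bounded_support[where K = "{\<alpha>..\<beta>}" and M = L])
      show "(\<lambda>z. indicator {\<alpha>..\<beta>} z * ((?w (z + h) - ?w z) / h)) \<in> borel_measurable borel"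
        using difference_quotient_measurable[OF borel_measurable_lipschitz[OF w], of h 1]
        by (intro borel_measurable_times borel_measurable_indicator) auto
      show "\<bar>indicator {\<alpha>..\<beta>} z * ((?w (z + h) - ?w z) / h)\<bar> \<le> L" for z
        using lipschitz_on_shift[OF w, of z h 1] lipschitz_on_nonneg[OF w] by (auto simp: indicator_def)
    qed auto
    have "(\<integral>z. ?g (y, z) \<partial>lborel) = (\<integral>z. c * indicator {\<alpha>..\<beta>} z + s * (indicator {\<alpha>..\<beta>} z * ((?w (z + h) - ?w z) / h)) \<partial>lborel)"
      using True by (intro Bochner_Integration.integral_cong) (auto simp: indicator_def Q)
    also have "\<dots> = (\<integral>z. c * indicator {\<alpha>..\<beta>} z \<partial>lborel) + (\<integral>z. s * (indicator {\<alpha>..\<beta>} z * ((?w (z + h) - ?w z) / h)) \<partial>lborel)"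
      by (intro Bochner_Integration.integral_add integrable_mult_right int integrable_real_indicator) (use ab in auto)
    also have "\<dots> = c * (\<beta> - \<alpha>) + s * (\<integral>z. indicator {\<alpha>..\<beta>} z * ((?w (z + h) - ?w z) / h) \<partial>lborel)"
    proof (rule arg_cong2[where f = "(+)"])
      show "(\<integral>z. c * indicator {\<alpha>..\<beta>} z \<partial>lborel) = c * (\<beta> - \<alpha>)" using ab by simp
    qed (rule integral_mult_right_zero)
    also have "\<dots> \<le> c * (\<beta> - \<alpha>) + (s * (v (y, \<beta>) - v (y, \<alpha>)) + \<bar>s\<bar> * (2 * L * h))"
    proof -
      define I where "I = (\<integral>z. indicator {\<alpha>..\<beta>} z * ((?w (z + h) - ?w z) / h) \<partial>lborel)"
      have "\<bar>I - (v (y, \<beta>) - v (y, \<alpha>))\<bar> \<le> 2 * L * h"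
        unfolding I_def by (rule difference_quotient_integral_approx[OF w ab h])
      then have "\<bar>s\<bar> * \<bar>I - (v (y, \<beta>) - v (y, \<alpha>))\<bar> \<le> \<bar>s\<bar> * (2 * L * h)"
        by (rule mult_left_mono) simp
      then have "s * (I - (v (y, \<beta>) - v (y, \<alpha>))) \<le> \<bar>s\<bar> * (2 * L * h)"
        unfolding abs_mult[symmetric] by linarith
      then have "s * I \<le> s * (v (y, \<beta>) - v (y, \<alpha>)) + \<bar>s\<bar> * (2 * L * h)"
        unfolding right_diff_distrib[of s I] by linarith
      then show ?thesis unfolding I_def[symmetric] by linarith
    qed
    finally show ?thesis using True by (simp add: lo_def hi_def algebra_simps)
  next
    case False
    then show ?thesis by (simp add: Q indicator_def)
  qed
  have lm: "?l \<in> borel_measurable borel"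
    using borel_measurable_continuous_onI[OF clohi(1)] borel_measurable_continuous_onI[OF clohi(2)] by auto
  have "bounded ((\<lambda>y. hi y - lo y) ` cbox p q)"
    by (intro compact_imp_bounded compact_continuous_image continuous_intros clohi) auto
  then obtain M where M: "\<And>y. y \<in> cbox p q \<Longrightarrow> \<bar>hi y - lo y\<bar> \<le> M" unfolding bounded_iff by auto
  have l: "integrable lborel ?l"
    using lm M by (intro integrable_bounded_support[where K = "cbox p q" and M = M]) auto
  have ind: "integrable lborel (\<lambda>y. indicator (cbox p q) y * (2 * \<bar>s\<bar> * L * h))"
    by (intro integrable_mult_left) (auto intro!: integrable_real_indicator simp: emeasure_lborel_cbox_eq)
  have g': "integrable (lborel \<Otimes>\<^sub>M lborel) (\<lambda>x. ?g x)" using g by (simp add: lborel_prod)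
  have "(\<integral>x. ?g x \<partial>lborel) = (\<integral>y. \<integral>z. ?g (y, z) \<partial>lborel \<partial>lborel)"
    using lborel_pair.integral_fst'[OF g'] by (simp add: lborel_prod)
  also have "\<dots> \<le> (\<integral>y. ?l y + indicator (cbox p q) y * (2 * \<bar>s\<bar> * L * h) \<partial>lborel)"
  proof (intro integral_mono inner)
    show "integrable lborel (\<lambda>y. \<integral>z. ?g (y, z) \<partial>lborel)"
      using lborel_pair.integrable_fst'[OF g'] by simp
  qed (use l ind in auto)
  also have "\<dots> = (\<integral>y. ?l y \<partial>lborel) + 2 * \<bar>s\<bar> * L * h * measure lborel (cbox p q)"
    using l ind by simp
  finally have "ennreal ((\<integral>x. ?g x \<partial>lborel) - 2 * \<bar>s\<bar> * L * h * measure lborel (cbox p q)) \<le> ennreal (\<integral>y. ?l y \<partial>lborel)"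
    by (intro ennreal_leI) simp
  also have "\<dots> \<le> (\<integral>\<^sup>+y. ennreal (?l y) \<partial>lborel)"
    using l by (rule ennreal_integral_le_nn_integral)
  also have "\<dots> \<le> (\<integral>\<^sup>+y. emeasure lborel (Pair y -` R) \<partial>lborel)"
  proof (rule nn_integral_mono)
    fix y
    show "ennreal (?l y) \<le> emeasure lborel (Pair y -` R)"
    proof (cases "y \<in> cbox p q \<and> lo y \<le> hi y")
      case True
      then have "Pair y -` R = {lo y..hi y}" by (auto simp: R_def)
      with True show ?thesis by simp
    next
      \<comment> \<open>On a line where the order of \<open>lo\<close> and \<open>hi\<close> is
        reversed nothing is covered, but then the claimed contribution is negative and truncated to
        zero.\<close>
      case False
      then have "?l y \<le> 0" by (auto simp: indicator_def)
      then show ?thesis by (simp add: ennreal_neg)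
    qed
  qed
  also have "\<dots> = emeasure (lborel \<Otimes>\<^sub>M lborel) R"
    using Rb by (intro lborel.emeasure_pair_measure_alt[symmetric]) (metis lborel_prod sets_lborel)
  also have "\<dots> = emeasure lborel R" by (simp add: lborel_prod)
  also have "\<dots> \<le> hausdorff_measure DIM('b \<times> real) R" by (rule lborel_le_hausdorff_measure[OF Rb])
  also note H
  finally show ?thesis .
qed

lemma vertical_in_Basis: "(0, 1) \<in> (Basis :: ('b::euclidean_space \<times> real) set)"
  by (simp add: Basis_prod_def)

text \<open>Exchanging \<open>e\<close> with the vertical basis vector reduces to the vertical case.
  The constant \<open>K\<close> depends on the box and the direction alone, not on the height, the
  step or the slope, which is what makes the error uniform in time.\<close>

lemma tilted_box:
  fixes Q :: "('b::euclidean_space \<times> real) set"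
  assumes Q: "Q = cbox l u" "Q \<noteq> {}" and e: "e \<in> Basis"
  obtains K where "\<And>(v :: 'b \<times> real \<Rightarrow> real) L h a. L-lipschitz_on UNIV v \<Longrightarrow> 0 < h \<Longrightarrow>
    ennreal (1 / sqrt (1 + a\<^sup>2) * measure lborel Q
      + a / sqrt (1 + a\<^sup>2) * (\<integral>x. indicator Q x * ((v (x + h *\<^sub>R e) - v x) / h) \<partial>lborel)
      - \<bar>a / sqrt (1 + a\<^sup>2)\<bar> * L * h * K)
    \<le> hausdorff_measure DIM('b \<times> real) ((\<lambda>x. tilt a e (x, v x)) ` Q)"
proof -
  define k :: "'b \<times> real" where "k = (0, 1)"
  have k: "k \<in> Basis" by (simp add: k_def vertical_in_Basis)
  note ek = e k
  let ?T = "coord_swap e k"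
  obtain p \<alpha> q \<beta> where pq: "?T l = (p, \<alpha>)" "?T u = (q, \<beta>)" by (metis surj_pair)
  have TQ: "?T ` Q = cbox (p, \<alpha>) (q, \<beta>)"
    using coord_swap_image_cbox[OF ek] by (simp add: Q pq)
  then have "cbox (p, \<alpha>) (q, \<beta>) \<noteq> {}" using Q(2) by blast
  then have ab: "\<alpha> \<le> \<beta>" by (auto simp: cbox_Pair_eq)
  show thesis
  \<comment> \<open>Twice the area of the face orthogonal to \<open>e\<close>: each line parallel to
    \<open>e\<close> contributes an error \<open>2 * L * h\<close>.\<close>
  proof (rule that[of "2 * measure lborel (cbox p q)"])
    fix v :: "'b \<times> real \<Rightarrow> real" and L h a assume v: "L-lipschitz_on UNIV v" and h: "(0::real) < h"
    define c s where "c = 1 / sqrt (1 + a\<^sup>2)" and "s = a / sqrt (1 + a\<^sup>2)"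
    define w where "w x = v (?T x)" for x
    have w: "L-lipschitz_on UNIV w"
      using v unfolding lipschitz_on_def w_def by (metis UNIV_I dist_coord_swap[OF ek])
    have Tadd: "?T (x + h *\<^sub>R k) = ?T x + h *\<^sub>R e" for x
      using ek by (cases "e = k")
        (simp_all add: coord_swap_def inner_add_left inner_diff_right inner_Basis algebra_simps)
    have dw: "(w (x + h *\<^sub>R k) - w x) / h = (v (?T x + h *\<^sub>R e) - v (?T x)) / h" for x
      by (simp add: w_def Tadd)
    let ?dv = "\<lambda>x. (v (x + h *\<^sub>R e) - v x) / h"
    have dvm: "?dv \<in> borel_measurable borel"
      by (intro difference_quotient_measurable borel_measurable_lipschitz[OF v])
    have Qb: "Q \<in> sets borel" "bounded Q" by (auto simp: Q)
    have ind: "indicator (cbox (p, \<alpha>) (q, \<beta>)) x = (indicator Q (?T x) :: real)" for x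
    proof -
      have "x \<in> ?T ` Q \<longleftrightarrow> ?T x \<in> Q" unfolding coord_swap_image_eq_vimage[OF ek] by simp
      then show ?thesis unfolding TQ[symmetric] by (simp add: indicator_def)
    qed
    have int: "integrable lborel (\<lambda>x. indicator Q x * ?dv x)"
    proof (rule integrable_bounded_support[where K = Q and M = L])
      show "\<bar>indicator Q x * ?dv x\<bar> \<le> L" for x
        using lipschitz_on_shift[OF v, of x h e] lipschitz_on_nonneg[OF v] e by (auto simp: indicator_def)
      show "(\<lambda>x. indicator Q x * ?dv x) \<in> borel_measurable borel"
        using Qb by (intro borel_measurable_times borel_measurable_indicator dvm) simp
    qed (use Qb in auto)
    have "(\<integral>x. indicator (cbox (p, \<alpha>) (q, \<beta>)) x * (c + s * ((w (x + h *\<^sub>R k) - w x) / h)) \<partial>lborel)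
        = (\<integral>x. indicator Q (?T x) * (c + s * ?dv (?T x)) \<partial>lborel)"
      by (simp add: ind dw)
    also have "\<dots> = (\<integral>x. indicator Q x * (c + s * ?dv x) \<partial>lborel)"
      using Qb by (intro integral_coord_swap[OF ek, of "\<lambda>x. indicator Q x * (c + s * ?dv x)"]
        borel_measurable_times borel_measurable_indicator borel_measurable_add borel_measurable_const dvm) simp
    also have "\<dots> = (\<integral>x. c * indicator Q x + s * (indicator Q x * ?dv x) \<partial>lborel)"
      by (simp add: algebra_simps)
    also have "\<dots> = (\<integral>x. c * indicator Q x \<partial>lborel) + (\<integral>x. s * (indicator Q x * ?dv x) \<partial>lborel)"
      using Qb emeasure_bounded_finite[OF Qb(2)]
      by (intro Bochner_Integration.integral_add integrable_mult_right int integrable_real_indicator) auto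
    also have "\<dots> = c * measure lborel Q + s * (\<integral>x. indicator Q x * ?dv x \<partial>lborel)"
    proof (rule arg_cong2[where f = "(+)"])
      show "(\<integral>x. c * indicator Q x \<partial>lborel) = c * measure lborel Q" by simp
    qed (rule integral_mult_right_zero)
    finally have eq: "(\<integral>x. indicator (cbox (p, \<alpha>) (q, \<beta>)) x * (c + s * ((w (x + h *\<^sub>R k) - w x) / h)) \<partial>lborel)
        = c * measure lborel Q + s * (\<integral>x. indicator Q x * ?dv x \<partial>lborel)" .
    have "hausdorff_measure DIM('b \<times> real) ((\<lambda>x. tilt a k (x, w x)) ` cbox (p, \<alpha>) (q, \<beta>))
        = hausdorff_measure DIM('b \<times> real) (?T ` (\<lambda>x. tilt a k (x, w x)) ` ?T ` Q)"
      unfolding TQ by (rule hausdorff_measure_coord_swap[OF ek, symmetric])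
    also have "?T ` (\<lambda>x. tilt a k (x, w x)) ` ?T ` Q = (\<lambda>x. tilt a e (x, v x)) ` Q"
      unfolding image_image w_def
      by (simp add: tilt_coord_swap[OF ek, symmetric] coord_swap_coord_swap[OF ek])
    finally have H: "hausdorff_measure DIM('b \<times> real) ((\<lambda>x. tilt a k (x, w x)) ` cbox (p, \<alpha>) (q, \<beta>))
        = hausdorff_measure DIM('b \<times> real) ((\<lambda>x. tilt a e (x, v x)) ` Q)" .
    have "ennreal (c * measure lborel Q + s * (\<integral>x. indicator Q x * ?dv x \<partial>lborel) - 2 * \<bar>s\<bar> * L * h * measure lborel (cbox p q))
        \<le> hausdorff_measure DIM('b \<times> real) ((\<lambda>x. tilt a e (x, v x)) ` Q)"
      using tilted_vertical_box[OF w ab h, of p q a] unfolding c_def[symmetric] s_def[symmetric] k_def[symmetric] eq H .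
    then show "ennreal (1 / sqrt (1 + a\<^sup>2) * measure lborel Q
      + a / sqrt (1 + a\<^sup>2) * (\<integral>x. indicator Q x * ?dv x \<partial>lborel)
      - \<bar>a / sqrt (1 + a\<^sup>2)\<bar> * L * h * (2 * measure lborel (cbox p q)))
    \<le> hausdorff_measure DIM('b \<times> real) ((\<lambda>x. tilt a e (x, v x)) ` Q)"
      by (simp add: c_def s_def mult_ac)
  qed
qed

text \<open>A projection along slope \<open>x\<close> shrinks a horizontal base by this cosine; the
  bound is the source of the term \<open>\<phi>\<^sup>2 / 2\<close> in the gain.\<close>

lemma inverse_sqrt_ge: "1 - x\<^sup>2 / 2 \<le> 1 / sqrt (1 + x\<^sup>2)" for x :: real
proof -
  have "sqrt (1 + x\<^sup>2) \<le> 1 + x\<^sup>2 / 2"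
  proof (rule real_le_lsqrt)
    have "(1 + x\<^sup>2 / 2)\<^sup>2 = 1 + x\<^sup>2 + (x\<^sup>2 / 2)\<^sup>2" by (simp add: power2_sum)
    then show "1 + x\<^sup>2 \<le> (1 + x\<^sup>2 / 2)\<^sup>2" by simp
  qed simp
  moreover have pos: "0 < sqrt (1 + x\<^sup>2)" by (simp add: add_pos_nonneg)
  ultimately have "1 / (1 + x\<^sup>2 / 2) \<le> 1 / sqrt (1 + x\<^sup>2)" by (intro divide_left_mono) (auto simp: add_pos_nonneg)
  moreover have "1 - x\<^sup>2 / 2 \<le> 1 / (1 + x\<^sup>2 / 2)"
  proof (subst pos_le_divide_eq)
    have "(1 - x\<^sup>2 / 2) * (1 + x\<^sup>2 / 2) = 1 - (x\<^sup>2 / 2)\<^sup>2"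
      by (simp add: algebra_simps power2_eq_square)
    then show "(1 - x\<^sup>2 / 2) * (1 + x\<^sup>2 / 2) \<le> 1" by simp
  qed (simp add: add_pos_nonneg)
  ultimately show ?thesis by linarith
qed

section \<open>The gain over finitely many boxes\<close>

lemma integrable_indicator_times:
  fixes g :: "'a::euclidean_space \<Rightarrow> real"
  assumes "bounded Q" "Q \<in> sets borel" "g \<in> borel_measurable borel" "\<And>x. x \<in> Q \<Longrightarrow> \<bar>g x\<bar> \<le> M"
  shows "integrable lborel (\<lambda>x. indicator Q x * g x)"
proof (rule integrable_bounded_support[where K = Q and M = M])
  show "(\<lambda>x. indicator Q x * g x) \<in> borel_measurable borel"
    using assms by (intro borel_measurable_times borel_measurable_indicator) auto
qed (use assms in auto)

text \<open>Heights \<open>t * v t\<close> are tilted by slopes \<open>t * a Q\<close>. The cosine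
  loses \<open>t\<^sup>2 a\<^sup>2 / 2\<close> per unit of base, and the sine times the slope of the
  graph gains \<open>t\<^sup>2 a \<partial>v\<close>, so both are of order \<open>t\<^sup>2\<close>.
  The step \<open>h\<close> stays fixed while \<open>t\<close> tends to zero; uniform convergence of
  \<open>v t\<close> to \<open>f\<close> then suffices for the quotients.\<close>

lemma graph_area_gain:
  fixes f :: "'b::euclidean_space \<times> real \<Rightarrow> real"
  assumes fin: "finite \<Q>" and box: "\<And>Q. Q \<in> \<Q> \<Longrightarrow> Q \<noteq> {} \<and> (\<exists>l u. Q = cbox l u)"
    and disj: "pairwise disjnt \<Q>" and e: "e \<in> Basis" and f: "L-lipschitz_on UNIV f"
    and D: "\<forall>\<^sub>F t in at_right 0. bounded (D t) \<and> D t \<in> sets borel"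
    and v: "\<forall>\<^sub>F t in at_right 0. L-lipschitz_on UNIV (v t)"
    and v0: "\<forall>\<^sub>F t in at_right 0. \<forall>Q\<in>\<Q>. \<forall>y\<in>Q. y \<notin> D t \<longrightarrow> v t y = 0"
    and vf: "\<And>\<epsilon>. 0 < \<epsilon> \<Longrightarrow> \<forall>\<^sub>F t in at_right 0. \<forall>x. \<bar>v t x - f x\<bar> \<le> \<epsilon>"
  obtains K where "\<And>h \<eta>. 0 < h \<Longrightarrow> 0 < \<eta> \<Longrightarrow> \<forall>\<^sub>F t in at_right (0::real).
    ennreal (measure lborel (D t) + t\<^sup>2 * ((\<Sum>Q\<in>\<Q>. a Q * (\<integral>x. indicator Q x * ((f (x + h *\<^sub>R e) - f x) / h) \<partial>lborel)
        - (a Q)\<^sup>2 / 2 * measure lborel Q) - K * h - \<eta>))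
    \<le> hausdorff_measure DIM('b \<times> real) ((\<lambda>y. (y, t * v t y)) ` D t)"
proof -
  have L: "0 \<le> L" using f by (rule lipschitz_on_nonneg)
  define P where "P Q K \<longleftrightarrow> (\<forall>(v :: 'b \<times> real \<Rightarrow> real) L h a. L-lipschitz_on UNIV v \<longrightarrow> 0 < h \<longrightarrow>
    ennreal (1 / sqrt (1 + a\<^sup>2) * measure lborel Q
      + a / sqrt (1 + a\<^sup>2) * (\<integral>x. indicator Q x * ((v (x + h *\<^sub>R e) - v x) / h) \<partial>lborel)
      - \<bar>a / sqrt (1 + a\<^sup>2)\<bar> * L * h * K)
    \<le> hausdorff_measure DIM('b \<times> real) ((\<lambda>x. tilt a e (x, v x)) ` Q))" for Q K
  have "\<exists>K. P Q K" if Q: "Q \<in> \<Q>" for Q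
  proof -
    obtain l u where lu: "Q = cbox l u" "Q \<noteq> {}" using box[OF Q] by blast
    obtain K where "\<And>(v :: 'b \<times> real \<Rightarrow> real) L h a. L-lipschitz_on UNIV v \<Longrightarrow> 0 < h \<Longrightarrow>
      ennreal (1 / sqrt (1 + a\<^sup>2) * measure lborel Q
        + a / sqrt (1 + a\<^sup>2) * (\<integral>x. indicator Q x * ((v (x + h *\<^sub>R e) - v x) / h) \<partial>lborel)
        - \<bar>a / sqrt (1 + a\<^sup>2)\<bar> * L * h * K)
      \<le> hausdorff_measure DIM('b \<times> real) ((\<lambda>x. tilt a e (x, v x)) ` Q)"
      using tilted_box[OF lu e] by blast
    then have "P Q K" unfolding P_def by blast
    then show ?thesis by blast
  qed
  then obtain K where PK: "\<And>Q. Q \<in> \<Q> \<Longrightarrow> P Q (K Q)" by metis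
  have K: "ennreal (1 / sqrt (1 + a\<^sup>2) * measure lborel Q
      + a / sqrt (1 + a\<^sup>2) * (\<integral>x. indicator Q x * ((v (x + h *\<^sub>R e) - v x) / h) \<partial>lborel)
      - \<bar>a / sqrt (1 + a\<^sup>2)\<bar> * L * h * K Q)
    \<le> hausdorff_measure DIM('b \<times> real) ((\<lambda>x. tilt a e (x, v x)) ` Q)"
    if "Q \<in> \<Q>" "L-lipschitz_on UNIV v" "0 < h" for Q v L h a
    using PK[OF that(1)] that(2,3) unfolding P_def by blast
  have Qb: "bounded Q" "Q \<in> sets borel" "compact Q" if "Q \<in> \<Q>" for Q
    using box[OF that] by auto
  define K' where "K' = (\<Sum>Q\<in>\<Q>. \<bar>a Q\<bar> * L * \<bar>K Q\<bar>)"
  show thesis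
  proof (rule that[of K'])
    fix h \<eta> :: real assume h: "0 < h" and \<eta>: "0 < \<eta>"
    let ?I = "\<lambda>g Q. \<integral>x. indicator Q x * ((g (x + h *\<^sub>R e) - g x) / h) \<partial>lborel"
    have int: "integrable lborel (\<lambda>x. indicator Q x * ((g (x + h *\<^sub>R e) - g x) / h))"
      if "Q \<in> \<Q>" "L-lipschitz_on UNIV g" for g Q
      using lipschitz_on_shift[OF that(2), of _ h e] e Qb[OF that(1)]
      by (intro integrable_indicator_times[where M = L] difference_quotient_measurable borel_measurable_lipschitz[OF that(2)]) auto
    have I_tendsto: "((\<lambda>t. ?I (v t) Q) \<longlongrightarrow> ?I f Q) (at_right 0)" if Q: "Q \<in> \<Q>" for Q
    proof (rule tendstoI)
      fix r :: real assume r: "0 < r"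
      \<comment> \<open>A uniform error \<epsilon> of the heights changes a quotient with step
        \<open>h\<close> by at most \<open>2 * \<epsilon> / h\<close>; integrated over
        \<open>Q\<close> this stays below \<open>r\<close>.\<close>
      define \<epsilon> where "\<epsilon> = r / (2 * (measure lborel Q + 1)) * h / 2"
      have \<epsilon>: "0 < \<epsilon>" using r h by (auto simp: \<epsilon>_def intro!: divide_pos_pos mult_pos_pos add_nonneg_pos)
      show "\<forall>\<^sub>F t in at_right 0. dist (?I (v t) Q) (?I f Q) < r"
        using v vf[OF \<epsilon>]
      proof eventually_elim
        case (elim t)
        have "\<bar>?I (v t) Q - ?I f Q\<bar> = \<bar>\<integral>x. indicator Q x * ((v t (x + h *\<^sub>R e) - v t x) / h) - indicator Q x * ((f (x + h *\<^sub>R e) - f x) / h) \<partial>lborel\<bar>"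
          by (subst Bochner_Integration.integral_diff) (intro int Q elim f refl)+
        also have "\<dots> \<le> (\<integral>x. indicator Q x * (2 * \<epsilon> / h) \<partial>lborel)"
        proof (rule integral_abs_bound[THEN order_trans], rule integral_mono)
          show "integrable lborel (\<lambda>x. \<bar>indicator Q x * ((v t (x + h *\<^sub>R e) - v t x) / h) - indicator Q x * ((f (x + h *\<^sub>R e) - f x) / h)\<bar>)"
            by (intro integrable_abs Bochner_Integration.integrable_diff int Q elim f)
          show "integrable lborel (\<lambda>x. indicator Q x * (2 * \<epsilon> / h))"
            using Qb[OF Q] by (intro integrable_indicator_times[where M = "\<bar>2 * \<epsilon> / h\<bar>"]) auto
          fix x
          have "\<bar>(v t (x + h *\<^sub>R e) - v t x) - (f (x + h *\<^sub>R e) - f x)\<bar> \<le> 2 * \<epsilon>"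
            using elim(2)[rule_format, of x] elim(2)[rule_format, of "x + h *\<^sub>R e"] by linarith
          then have "\<bar>(v t (x + h *\<^sub>R e) - v t x) / h - (f (x + h *\<^sub>R e) - f x) / h\<bar> \<le> 2 * \<epsilon> / h"
            using h by (simp add: diff_divide_distrib[symmetric] abs_divide divide_right_mono)
          then show "\<bar>indicator Q x * ((v t (x + h *\<^sub>R e) - v t x) / h) - indicator Q x * ((f (x + h *\<^sub>R e) - f x) / h)\<bar> \<le> indicator Q x * (2 * \<epsilon> / h)"
            by (cases "x \<in> Q") (simp_all only: indicator_simps mult_1 mult_zero_left, simp_all)
        qed
        also have "\<dots> = measure lborel Q * (2 * \<epsilon> / h)"
          using Qb[OF Q] by simp
        also have "\<dots> = r * (measure lborel Q / (2 * (measure lborel Q + 1)))"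
        proof -
          have "2 * (X * h / 2) / h = X" for X using h by simp
          then have "2 * \<epsilon> / h = r / (2 * (measure lborel Q + 1))" unfolding \<epsilon>_def by blast
          then show ?thesis by (simp only: times_divide_eq_right mult.commute)
        qed
        also have "\<dots> < r * 1"
          using r by (intro mult_strict_left_mono) (auto simp: divide_less_eq add_nonneg_pos intro: add_nonneg_nonneg)
        finally show ?case by (simp add: dist_real_def)
      qed
    qed
    define S where "S t = (\<Sum>Q\<in>\<Q>. 1 / sqrt (1 + (t * a Q)\<^sup>2) * (a Q * ?I (v t) Q))" for t
    have "(S \<longlongrightarrow> (\<Sum>Q\<in>\<Q>. 1 / sqrt (1 + (0 * a Q)\<^sup>2) * (a Q * ?I f Q))) (at_right 0)"
      unfolding S_def by (intro tendsto_intros I_tendsto) auto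
    then have "\<forall>\<^sub>F t in at_right 0. (\<Sum>Q\<in>\<Q>. a Q * ?I f Q) - \<eta> < S t"
      using \<eta> by (intro order_tendstoD(1)) auto
    moreover have "\<forall>\<^sub>F t in at_right (0::real). 0 < t" by (simp add: eventually_at_filter)
    ultimately show "\<forall>\<^sub>F t in at_right 0.
      ennreal (measure lborel (D t) + t\<^sup>2 * ((\<Sum>Q\<in>\<Q>. a Q * ?I f Q - (a Q)\<^sup>2 / 2 * measure lborel Q) - K' * h - \<eta>))
      \<le> hausdorff_measure DIM('b \<times> real) ((\<lambda>y. (y, t * v t y)) ` D t)"
      using D v v0
    proof eventually_elim
      case (elim t)
      let ?c = "\<lambda>Q. 1 / sqrt (1 + (t * a Q)\<^sup>2)" and ?s = "\<lambda>Q. t * a Q / sqrt (1 + (t * a Q)\<^sup>2)"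
      have u: "(t * L)-lipschitz_on UNIV (\<lambda>y. t * v t y)"
        using lipschitz_on_cmult_real[OF elim(4), of t] elim(2) by simp
      define b where "b Q = ?c Q * measure lborel Q + ?s Q * ?I (\<lambda>y. t * v t y) Q - \<bar>?s Q\<bar> * (t * L) * h * K Q" for Q
      have "ennreal (measure lborel (D t) + (\<Sum>Q\<in>\<Q>. b Q - measure lborel Q)) \<le>
          hausdorff_measure DIM('b \<times> real) ((\<lambda>y. (y, t * v t y)) ` D t)"
      proof (rule graph_measure_tilted[where e = e and a = "\<lambda>Q. t * a Q"])
        show "ennreal (b Q) \<le> hausdorff_measure DIM('b \<times> real) ((\<lambda>y. tilt (t * a Q) e (y, t * v t y)) ` Q)"
          if "Q \<in> \<Q>" for Q
          using K[OF that u h, of "t * a Q"] by (simp only: b_def)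
      qed (use elim fin disj Qb e in auto)
      moreover have "t\<^sup>2 * (?c Q * (a Q * ?I (v t) Q) - (a Q)\<^sup>2 / 2 * measure lborel Q - \<bar>a Q\<bar> * L * \<bar>K Q\<bar> * h) \<le> b Q - measure lborel Q"
        if Q: "Q \<in> \<Q>" for Q
      proof -
        have c: "0 < ?c Q" "?c Q \<le> 1" by (auto simp: add_pos_nonneg divide_le_eq)
        have I: "?I (\<lambda>y. t * v t y) Q = t * ?I (v t) Q"
        proof -
          have "?I (\<lambda>y. t * v t y) Q = (\<integral>x. t * (indicator Q x * ((v t (x + h *\<^sub>R e) - v t x) / h)) \<partial>lborel)"
            by (intro Bochner_Integration.integral_cong) (auto simp: algebra_simps diff_divide_distrib)
          also have "\<dots> = t * ?I (v t) Q" by (rule integral_mult_right_zero)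
          finally show ?thesis .
        qed
        have "(1 - (t * a Q)\<^sup>2 / 2) * measure lborel Q \<le> ?c Q * measure lborel Q"
          by (intro mult_right_mono inverse_sqrt_ge) auto
        moreover have "\<bar>?s Q\<bar> * (t * L) * h * K Q \<le> (t * \<bar>a Q\<bar>) * (t * L) * h * \<bar>K Q\<bar>"
        proof (rule order_trans)
          show "\<bar>?s Q\<bar> * (t * L) * h * K Q \<le> \<bar>?s Q\<bar> * (t * L) * h * \<bar>K Q\<bar>"
            using elim(2) L h by (intro mult_left_mono mult_nonneg_nonneg) auto
          have "\<bar>?s Q\<bar> = (t * \<bar>a Q\<bar>) * ?c Q" using elim(2) by (simp add: abs_mult abs_divide)
          also have "\<dots> \<le> (t * \<bar>a Q\<bar>) * 1" using c elim(2) by (intro mult_left_mono) auto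
          finally show "\<bar>?s Q\<bar> * (t * L) * h * \<bar>K Q\<bar> \<le> (t * \<bar>a Q\<bar>) * (t * L) * h * \<bar>K Q\<bar>"
            using elim(2) L h by (intro mult_right_mono) auto
        qed
        moreover have "?s Q * ?I (\<lambda>y. t * v t y) Q = t\<^sup>2 * (?c Q * (a Q * ?I (v t) Q))"
          unfolding I by (simp add: power2_eq_square)
        moreover have "(t * \<bar>a Q\<bar>) * (t * L) * h * \<bar>K Q\<bar> = t\<^sup>2 * (\<bar>a Q\<bar> * L * \<bar>K Q\<bar> * h)"
          by (simp add: power2_eq_square)
        moreover have "(1 - (t * a Q)\<^sup>2 / 2) * measure lborel Q = measure lborel Q - t\<^sup>2 * ((a Q)\<^sup>2 / 2 * measure lborel Q)"
          by (simp add: power_mult_distrib algebra_simps)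
        ultimately show ?thesis unfolding b_def right_diff_distrib by linarith
      qed
      then have "(\<Sum>Q\<in>\<Q>. t\<^sup>2 * (?c Q * (a Q * ?I (v t) Q) - (a Q)\<^sup>2 / 2 * measure lborel Q - \<bar>a Q\<bar> * L * \<bar>K Q\<bar> * h))
          \<le> (\<Sum>Q\<in>\<Q>. b Q - measure lborel Q)"
        by (rule sum_mono)
      then have "t\<^sup>2 * (S t - (\<Sum>Q\<in>\<Q>. (a Q)\<^sup>2 / 2 * measure lborel Q) - K' * h) \<le> (\<Sum>Q\<in>\<Q>. b Q - measure lborel Q)"
        by (simp add: sum_distrib_left[symmetric] sum_subtractf S_def K'_def sum_distrib_right)
      moreover have "t\<^sup>2 * ((\<Sum>Q\<in>\<Q>. a Q * ?I f Q - (a Q)\<^sup>2 / 2 * measure lborel Q) - K' * h - \<eta>) \<le>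
          t\<^sup>2 * (S t - (\<Sum>Q\<in>\<Q>. (a Q)\<^sup>2 / 2 * measure lborel Q) - K' * h)"
        using elim(1) by (intro mult_left_mono) (auto simp: sum_subtractf)
      ultimately show ?case
        by (meson add_left_mono ennreal_leI order_trans)
    qed
  qed
qed

text \<open>A decomposition into non-overlapping small cubes fills \<open>W\<close>, and finitely
  many of them carry almost all its measure. They may still share faces, so each is shrunk slightly;
  disjoint closed boxes are needed for a positive distance between the pieces of the graph.\<close>

lemma open_inner_boxes:
  fixes W :: "'a::euclidean_space set"
  assumes W: "open W" "bounded W" and d: "0 < d" and r: "0 < r"
  obtains \<Q> where "finite \<Q>" "\<And>Q. Q \<in> \<Q> \<Longrightarrow> Q \<noteq> {} \<and> (\<exists>l u. Q = cbox l u)" "pairwise disjnt \<Q>"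
    "\<And>Q. Q \<in> \<Q> \<Longrightarrow> Q \<subseteq> W" "\<And>Q x y. Q \<in> \<Q> \<Longrightarrow> x \<in> Q \<Longrightarrow> y \<in> Q \<Longrightarrow> dist x y < d"
    "measure lborel W - r \<le> measure lborel (\<Union>\<Q>)"
proof (cases "W = {}")
  case True
  then show ?thesis using r by (intro that[of "{}"]) auto
next
  case False
  let ?m = "measure lborel"
  obtain R where R: "0 < R" "\<And>x. x \<in> W \<Longrightarrow> norm x < R"
    using W(2) bounded_pos_less by metis
  define a b :: 'a where "a = - (R *\<^sub>R One)" and "b = R *\<^sub>R One"
  have ab: "a \<bullet> i = - R" "b \<bullet> i = R" if "i \<in> Basis" for i
    using that by (auto simp: a_def b_def)
  have "x \<in> cbox a b" if "x \<in> W" for x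
    using R(2)[OF that] Basis_le_norm[of _ x] by (force simp: mem_box ab abs_le_iff)
  then have sub: "W \<subseteq> cbox a b" by blast
  let ?g = "\<lambda>x. if x \<in> W then W \<inter> ball x (d/2) else UNIV"
  have g: "gauge ?g" using W(1) d unfolding gauge_def by (auto intro!: open_Int)
  have ne: "box a b \<noteq> {}" using R(1) by (simp add: box_ne_empty ab)
  obtain \<D> where D: "countable \<D>" "\<Union>\<D> \<subseteq> cbox a b" "\<And>K. K \<in> \<D> \<Longrightarrow> interior K \<noteq> {} \<and> (\<exists>c d. K = cbox c d)"
      "pairwise (\<lambda>A B. interior A \<inter> interior B = {}) \<D>"
      "\<And>K. K \<in> \<D> \<Longrightarrow> \<exists>x \<in> W \<inter> K. K \<subseteq> ?g x"
      "\<And>u v. cbox u v \<in> \<D> \<Longrightarrow> \<exists>n. \<forall>i \<in> Basis. v \<bullet> i - u \<bullet> i = (b \<bullet> i - a \<bullet> i) / 2^n"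
      "W \<subseteq> \<Union>\<D>"
  proof (rule covering_lemma[OF sub ne g], goal_cases)
    case (1 \<D>)
    show thesis by (rule 1(1)[OF 1(2-8)])
  qed
  have KW: "K \<subseteq> W \<and> (\<forall>x\<in>K. \<forall>y\<in>K. dist x y < d)" if K: "K \<in> \<D>" for K
  proof -
    obtain x where x: "K \<subseteq> W \<inter> ball x (d/2)" using D(5)[OF K] by auto
    have "dist y z < d" if "y \<in> K" "z \<in> K" for y z
    proof -
      have "dist y x < d / 2" "dist x z < d / 2" using x that by (auto simp: dist_commute)
      then show ?thesis using dist_triangle[of y z x] by linarith
    qed
    then show ?thesis using x by blast
  qed
  have ne\<D>: "\<D> \<noteq> {}" using D(7) False by blast
  define A where "A N = (\<Union>i\<le>N. from_nat_into \<D> i)" for N :: nat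
  have fn: "from_nat_into \<D> i \<in> \<D>" for i using from_nat_into[OF ne\<D>] .
  have Kb: "K \<in> sets borel" "K \<in> fmeasurable lborel" if "K \<in> \<D>" for K
    using D(3)[OF that] by (auto intro!: fmeasurable_bounded_borel)
  have UA: "(\<Union>N. A N) = W"
  proof -
    have "(\<Union>N. A N) = (\<Union>i. from_nat_into \<D> i)" by (auto simp: A_def)
    also have "\<dots> = \<Union>\<D>" using range_from_nat_into[OF ne\<D> D(1)] by simp
    also have "\<dots> = W" using KW by (intro subset_antisym[OF Union_least D(7)]) simp
    finally show ?thesis .
  qed
  have "(\<lambda>N. ?m (A N)) \<longlonglongrightarrow> ?m (\<Union>N. A N)"
  proof (rule Lim_measure_incseq)
    show "range A \<subseteq> sets lborel" using fn Kb by (auto simp: A_def)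
    show "incseq A" unfolding A_def by (intro incseq_SucI UN_mono) auto
    show "emeasure lborel (\<Union>(range A)) \<noteq> \<infinity>" using emeasure_bounded_finite[OF W(2)] UA by auto
  qed
  then have "\<forall>\<^sub>F N in sequentially. ?m W - r / 2 < ?m (A N)"
    using r unfolding UA by (intro order_tendstoD(1)) auto
  then obtain N where N: "?m W - r / 2 < ?m (A N)" by (auto simp: eventually_sequentially)
  define \<F> where "\<F> = from_nat_into \<D> ` {..N}"
  have F: "finite \<F>" "\<F> \<subseteq> \<D>" "\<Union>\<F> = A N" using fn by (auto simp: \<F>_def A_def)
  have "\<exists>l u. K = cbox l u" if "K \<in> \<D>" for K using D(3)[OF that] by simp
  then obtain l u where lu: "\<And>K. K \<in> \<D> \<Longrightarrow> K = cbox (l K) (u K)" by metis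
  have pos: "l K \<bullet> i < u K \<bullet> i" if "K \<in> \<D>" "i \<in> Basis" for K i
  proof -
    have "box (l K) (u K) \<noteq> {}" using D(3)[OF that(1)] lu[OF that(1)] by (metis interior_cbox)
    then show ?thesis using that(2) by (simp add: box_ne_empty)
  qed
  have "((\<lambda>\<theta>. (1 - 2 * \<theta>) ^ DIM('a) * ?m (A N)) \<longlongrightarrow> (1 - 2 * 0) ^ DIM('a) * ?m (A N)) (at_right (0::real))"
    by (intro tendsto_intros)
  then have "\<forall>\<^sub>F \<theta> in at_right 0. ?m (A N) - r / 2 < (1 - 2 * \<theta>) ^ DIM('a) * ?m (A N)"
    using r by (intro order_tendstoD(1)) auto
  moreover have "\<forall>\<^sub>F \<theta> in at_right (0::real). 0 < \<theta> \<and> \<theta> < 1/2"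
    by (intro eventually_conj eventually_at_right_less) (auto intro: eventually_at_rightI[of 0 "1/2"])
  ultimately have "\<forall>\<^sub>F \<theta> in at_right 0. ?m (A N) - r / 2 < (1 - 2 * \<theta>) ^ DIM('a) * ?m (A N) \<and> 0 < \<theta> \<and> \<theta> < 1/2"
    by eventually_elim auto
  then obtain \<theta> where \<theta>: "?m (A N) - r / 2 < (1 - 2 * \<theta>) ^ DIM('a) * ?m (A N)" "0 < \<theta>" "\<theta> < 1/2"
    by (auto dest!: eventually_happens simp: trivial_limit_at_right_real)
  \<comment> \<open>A fraction \<theta> of each side is removed at both ends, which multiplies the
    volume by \<open>(1 - 2 * \<theta>) ^ DIM('a)\<close>.\<close>
  define sh where "sh K = cbox (l K + \<theta> *\<^sub>R (u K - l K)) (u K - \<theta> *\<^sub>R (u K - l K))" for K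
  have sub_sh: "sh K \<subseteq> interior K" if "K \<in> \<D>" for K
  proof -
    have "sh K \<subseteq> box (l K) (u K)"
      using pos[OF that] \<theta> unfolding sh_def
      by (intro subset_box_imp) (auto simp: inner_add_left inner_diff_left mult_pos_pos)
    then show ?thesis using lu[OF that] by (metis interior_cbox)
  qed
  have w: "(u K - \<theta> *\<^sub>R (u K - l K)) \<bullet> i - (l K + \<theta> *\<^sub>R (u K - l K)) \<bullet> i = (1 - 2 * \<theta>) * (u K \<bullet> i - l K \<bullet> i)" for K i
    by (simp add: inner_add_left inner_diff_left algebra_simps)
  have m_sh: "?m (sh K) = (1 - 2 * \<theta>) ^ DIM('a) * ?m K" "sh K \<noteq> {}" if "K \<in> \<D>" for K
  proof -
    have le: "(l K + \<theta> *\<^sub>R (u K - l K)) \<bullet> i \<le> (u K - \<theta> *\<^sub>R (u K - l K)) \<bullet> i" if "i \<in> Basis" for i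
    proof -
      have "0 \<le> (1 - 2 * \<theta>) * (u K \<bullet> i - l K \<bullet> i)"
        using pos[OF \<open>K \<in> \<D>\<close> that] \<theta> by (intro mult_nonneg_nonneg) auto
      then show ?thesis using w[of K i] by linarith
    qed
    then show "sh K \<noteq> {}" by (simp add: sh_def box_ne_empty)
    have "?m (sh K) = (\<Prod>i\<in>Basis. (1 - 2 * \<theta>) * (u K \<bullet> i - l K \<bullet> i))"
      using le unfolding sh_def by (subst measure_lborel_cbox_eq) (simp_all add: inner_diff_left[symmetric] w[unfolded inner_diff_left[symmetric]])
    also have "\<dots> = (1 - 2 * \<theta>) ^ DIM('a) * (\<Prod>i\<in>Basis. u K \<bullet> i - l K \<bullet> i)"
      by (simp add: prod.distrib)
    also have "(\<Prod>i\<in>Basis. u K \<bullet> i - l K \<bullet> i) = ?m (cbox (l K) (u K))"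
      using pos[OF that] by (subst measure_lborel_cbox_eq) (auto simp: inner_diff_left less_imp_le)
    also have "cbox (l K) (u K) = K" using lu[OF that] by simp
    finally show "?m (sh K) = (1 - 2 * \<theta>) ^ DIM('a) * ?m K" .
  qed
  have dis: "sh K \<inter> sh J = {}" if "K \<in> \<F>" "J \<in> \<F>" "K \<noteq> J" for K J
  proof -
    have KJ: "K \<in> \<D>" "J \<in> \<D>" using that F(2) by auto
    show ?thesis using pairwiseD[OF D(4) KJ that(3)] sub_sh[OF KJ(1)] sub_sh[OF KJ(2)] by blast
  qed
  show ?thesis
  proof (rule that[of "sh ` \<F>"])
    show "finite (sh ` \<F>)" using F by simp
    show "Q \<noteq> {} \<and> (\<exists>l u. Q = cbox l u)" if "Q \<in> sh ` \<F>" for Q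
      using that m_sh(2) F(2) unfolding sh_def by blast
    show "pairwise disjnt (sh ` \<F>)"
      using dis unfolding pairwise_def disjnt_def by blast
    show "Q \<subseteq> W" if Q: "Q \<in> sh ` \<F>" for Q
    proof -
      obtain K where K: "K \<in> \<D>" "Q = sh K" using Q F(2) by blast
      show ?thesis using sub_sh[OF K(1)] KW[OF K(1)] interior_subset[of K] K(2) by blast
    qed
    show "dist x y < d" if "Q \<in> sh ` \<F>" "x \<in> Q" "y \<in> Q" for Q x y
    proof -
      obtain K where "K \<in> \<D>" "Q = sh K" using \<open>Q \<in> sh ` \<F>\<close> F(2) by blast
      then have "x \<in> K" "y \<in> K" using sub_sh[of K] that(2,3) interior_subset[of K] by blast+
      then show ?thesis using KW[OF \<open>K \<in> \<D>\<close>] by blast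
    qed
    have "?m (\<Union>(sh ` \<F>)) = (\<Sum>K\<in>\<F>. ?m (sh K))"
    proof (rule measure_finite_Union[OF F(1)])
      show "sh ` \<F> \<subseteq> sets lborel" by (auto simp: sh_def)
      show "disjoint_family_on sh \<F>" using dis by (auto simp: disjoint_family_on_def)
      show "emeasure lborel (sh K) \<noteq> \<infinity>" for K
        using emeasure_bounded_finite[of "sh K"] by (auto simp: sh_def)
    qed
    also have "\<dots> = (1 - 2 * \<theta>) ^ DIM('a) * (\<Sum>K\<in>\<F>. ?m K)"
      unfolding sum_distrib_left using m_sh(1) F(2) by (intro sum.cong) auto
    also have "\<dots> \<ge> (1 - 2 * \<theta>) ^ DIM('a) * ?m (A N)"
    proof (rule mult_left_mono)
      have "?m (\<Union>K\<in>\<F>. K) \<le> (\<Sum>K\<in>\<F>. ?m K)"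
        using F Kb by (intro measure_UNION_le) auto
      then show "?m (A N) \<le> (\<Sum>K\<in>\<F>. ?m K)" using F(3) by simp
    qed (use \<theta> in auto)
    finally show "?m W - r \<le> ?m (\<Union>(sh ` \<F>))" using \<theta>(1) N by linarith
  qed
qed

section \<open>Continuous slopes approximated by step functions\<close>

lemma sum_indicator_disjoint:
  fixes g :: "'a set \<Rightarrow> real"
  assumes "finite \<Q>" "pairwise disjnt \<Q>" "Q \<in> \<Q>" "x \<in> Q"
  shows "(\<Sum>P\<in>\<Q>. g P * indicator P x) = g Q"
proof -
  have "g P * indicator P x = 0" if "P \<in> \<Q> - {Q}" for P
    using pairwiseD[OF assms(2), of P Q] that assms(3,4) by (auto simp: disjnt_def indicator_def)
  then have "(\<Sum>P\<in>\<Q>. g P * indicator P x) = g Q * indicator Q x + 0"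
    unfolding sum.remove[OF assms(1,3)] by (intro arg_cong2[where f = "(+)"] sum.neutral refl) auto
  then show ?thesis using assms(4) by simp
qed

lemma box_step_approximation:
  fixes W :: "'a::euclidean_space set" and \<phi> :: "'a \<Rightarrow> real"
  assumes W: "open W" "bounded W" and \<phi>: "continuous_on UNIV \<phi>" "\<And>x. x \<in> W \<Longrightarrow> \<bar>\<phi> x\<bar> \<le> M"
    and M: "0 \<le> M" and r: "0 < r"
  obtains \<Q> a where "finite \<Q>" "\<And>Q. Q \<in> \<Q> \<Longrightarrow> Q \<noteq> {} \<and> (\<exists>l u. Q = cbox l u)" "pairwise disjnt \<Q>"
    "\<And>Q. Q \<in> \<Q> \<Longrightarrow> Q \<subseteq> W" "\<And>Q. Q \<in> \<Q> \<Longrightarrow> \<bar>a Q\<bar> \<le> M"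
    "(\<integral>x. \<bar>indicator W x * \<phi> x - (\<Sum>Q\<in>\<Q>. a Q * indicator Q x)\<bar> \<partial>lborel) \<le> r"
proof -
  let ?m = "measure lborel"
  \<comment> \<open>Oscillation at most \<open>w\<close> on the boxes costs \<open>r / 2\<close>;
    the part of \<open>W\<close> outside the boxes has measure at most \<open>r'\<close> and, with
    \<phi> bounded by \<open>M\<close>, costs the other half.\<close>
  define w where "w = r / (2 * (?m W + 1))"
  have mW: "0 < 2 * (?m W + 1)" by (simp add: add_nonneg_pos)
  then have w: "0 < w" using r by (simp add: w_def)
  have "uniformly_continuous_on (closure W) \<phi>"
    using W \<phi>(1) by (intro compact_uniformly_continuous continuous_on_subset[OF \<phi>(1)]) auto
  then obtain d where d: "0 < d" "\<And>x y. x \<in> closure W \<Longrightarrow> y \<in> closure W \<Longrightarrow> dist x y < d \<Longrightarrow> dist (\<phi> x) (\<phi> y) < w"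
    using w unfolding uniformly_continuous_on_def by metis
  define r' where "r' = r / (2 * (M + 1))"
  have r': "0 < r'" using r M by (simp add: r'_def)
  obtain \<Q> where Q: "finite \<Q>" "\<And>Q. Q \<in> \<Q> \<Longrightarrow> Q \<noteq> {} \<and> (\<exists>l u. Q = cbox l u)" "pairwise disjnt \<Q>"
    "\<And>Q. Q \<in> \<Q> \<Longrightarrow> Q \<subseteq> W" "\<And>Q x y. Q \<in> \<Q> \<Longrightarrow> x \<in> Q \<Longrightarrow> y \<in> Q \<Longrightarrow> dist x y < d"
    "?m W - r' \<le> ?m (\<Union>\<Q>)"
    using open_inner_boxes[OF W d(1) r'] by blast
  define a where "a Q = \<phi> (SOME x. x \<in> Q)" for Q
  have some: "(SOME x. x \<in> Q) \<in> Q" if "Q \<in> \<Q>" for Q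
    using Q(2)[OF that] by (simp add: some_in_eq)
  have UW: "\<Union>\<Q> \<subseteq> W" using Q(4) by (rule Union_least)
  have Wm: "W \<in> fmeasurable lborel" using W by (intro fmeasurable_bounded_borel) auto
  have Qc: "compact Q" if "Q \<in> \<Q>" for Q using Q(2)[OF that] by auto
  then have "closed (\<Union>\<Q>)" using Q(1) by (intro compact_imp_closed compact_Union)
  then have UQm: "\<Union>\<Q> \<in> fmeasurable lborel" using bounded_subset[OF W(2) UW] by (intro fmeasurable_bounded_borel) auto
  let ?R = "W - \<Union>\<Q>"
  have Rm: "?R \<in> fmeasurable lborel" using Wm fmeasurableD[OF UQm] by (rule fmeasurable_Diff)
  have pt: "\<bar>indicator W x * \<phi> x - (\<Sum>Q\<in>\<Q>. a Q * indicator Q x)\<bar> \<le> indicator W x * w + indicator ?R x * M" for x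
  proof (cases "x \<in> \<Union>\<Q>")
    case True
    then obtain Q0 where Q0: "Q0 \<in> \<Q>" "x \<in> Q0" by blast
    have xW: "x \<in> W" using True UW by blast
    have "(SOME y. y \<in> Q0) \<in> closure W" "x \<in> closure W"
      using some[OF Q0(1)] Q(4)[OF Q0(1)] xW closure_subset[of W] by blast+
    then have "dist (\<phi> x) (a Q0) < w"
      unfolding a_def using Q(5)[OF Q0(1) Q0(2) some[OF Q0(1)]] by (intro d(2))
    then show ?thesis
      using sum_indicator_disjoint[OF Q(1,3) Q0, of a] xW True by (simp add: dist_real_def)
  next
    case False
    then have "(\<Sum>Q\<in>\<Q>. a Q * indicator Q x) = 0" by (intro sum.neutral) auto
    then show ?thesis using \<phi>(2)[of x] w False by (cases "x \<in> W") auto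
  qed
  have int1: "integrable lborel (\<lambda>x. indicator W x * w)" "integrable lborel (\<lambda>x. indicator ?R x * M)"
    using Wm Rm by (auto simp: fmeasurable_def intro!: integrable_mult_left integrable_real_indicator)
  have int2: "integrable lborel (\<lambda>x. indicator W x * \<phi> x)"
    using W \<phi> by (intro integrable_indicator_times[where M = M] borel_measurable_continuous_onI) auto
  have int3: "integrable lborel (\<lambda>x. \<Sum>Q\<in>\<Q>. a Q * indicator Q x)"
    using Qc emeasure_bounded_finite[OF compact_imp_bounded[OF Qc]]
    by (intro Bochner_Integration.integrable_sum integrable_mult_right integrable_real_indicator) (auto simp: borel_compact)
  have "(\<integral>x. \<bar>indicator W x * \<phi> x - (\<Sum>Q\<in>\<Q>. a Q * indicator Q x)\<bar> \<partial>lborel) \<le>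
      (\<integral>x. indicator W x * w + indicator ?R x * M \<partial>lborel)"
    by (intro integral_mono integrable_abs Bochner_Integration.integrable_diff Bochner_Integration.integrable_add int1 int2 int3 pt)
  also have "\<dots> = ?m W * w + ?m ?R * M"
    using int1 by simp
  also have "?m ?R = ?m W - ?m (\<Union>\<Q>)"
    using Wm UQm UW by (intro measurable_measure_Diff) (auto dest: fmeasurableD)
  also have "?m W * w + (?m W - ?m (\<Union>\<Q>)) * M \<le> r / 2 + r / 2"
  proof (rule add_mono)
    have "?m W * w \<le> (?m W + 1) * w" using w by (intro mult_right_mono) auto
    also have "\<dots> = r / 2"
    proof -
      have *: "X * (r / (2 * X)) = r / 2" if "0 < X" for X :: real using that by simp
      show ?thesis unfolding w_def by (rule *) (use mW in simp)
    qed
    finally show "?m W * w \<le> r / 2" .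
    have "(?m W - ?m (\<Union>\<Q>)) * M \<le> r' * M" using Q(6) M by (intro mult_right_mono) auto
    also have "\<dots> \<le> r' * (M + 1)" using r' by (intro mult_left_mono) auto
    also have "\<dots> = r / 2"
    proof -
      have *: "r / (2 * X) * X = r / 2" if "0 < X" for X :: real using that by simp
      show ?thesis unfolding r'_def by (rule *) (use M in simp)
    qed
    finally show "(?m W - ?m (\<Union>\<Q>)) * M \<le> r / 2" .
  qed
  finally have "(\<integral>x. \<bar>indicator W x * \<phi> x - (\<Sum>Q\<in>\<Q>. a Q * indicator Q x)\<bar> \<partial>lborel) \<le> r" by simp
  moreover have "\<bar>a Q\<bar> \<le> M" if "Q \<in> \<Q>" for Q
    unfolding a_def using some[OF that] Q(4)[OF that] by (intro \<phi>(2)) blast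
  ultimately show thesis using that[OF Q(1-4)] by blast
qed

text \<open>The step function is fixed before \<open>h\<close> and \<open>t\<close>. Replacing
  \<phi> by it changes the linear term by at most \<open>L * r\<close>, as all difference quotients
  are bounded by \<open>L\<close>, and the halved quadratic term by at most
  \<open>N * r\<close>.\<close>

lemma graph_area_lower_bound:
  fixes f \<phi> :: "'b::euclidean_space \<times> real \<Rightarrow> real"
  assumes W: "open W" "bounded W" and \<phi>: "continuous_on UNIV \<phi>" "\<And>x. x \<in> W \<Longrightarrow> \<bar>\<phi> x\<bar> \<le> M"
    and e: "e \<in> Basis" and f: "L-lipschitz_on UNIV f"
    and D: "\<forall>\<^sub>F t in at_right 0. bounded (D t) \<and> D t \<in> sets borel"
    and v: "\<forall>\<^sub>F t in at_right 0. L-lipschitz_on UNIV (v t)"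
    and v0: "\<And>C. compact C \<Longrightarrow> C \<subseteq> W \<Longrightarrow> \<forall>\<^sub>F t in at_right 0. \<forall>y\<in>C. y \<notin> D t \<longrightarrow> v t y = 0"
    and vf: "\<And>\<epsilon>. 0 < \<epsilon> \<Longrightarrow> \<forall>\<^sub>F t in at_right 0. \<forall>x. \<bar>v t x - f x\<bar> \<le> \<epsilon>"
    and \<eta>: "0 < \<eta>"
  shows "\<forall>\<^sub>F h in at_right 0. \<forall>\<^sub>F t in at_right (0::real).
    ennreal (measure lborel (D t) + t\<^sup>2 * ((\<integral>x. indicator W x * \<phi> x * ((f (x + h *\<^sub>R e) - f x) / h) \<partial>lborel)
        - (\<integral>x. indicator W x * (\<phi> x)\<^sup>2 \<partial>lborel) / 2 - \<eta>))
    \<le> hausdorff_measure DIM('b \<times> real) ((\<lambda>y. (y, t * v t y)) ` D t)"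
proof -
  have L: "0 \<le> L" using f by (rule lipschitz_on_nonneg)
  \<comment> \<open>\<open>M\<close> may be negative when \<open>W\<close> is empty.\<close>
  define N where "N = max M 0"
  have N: "0 \<le> N" "\<And>x. x \<in> W \<Longrightarrow> \<bar>\<phi> x\<bar> \<le> N" using \<phi>(2) by (force simp: N_def)+
  \<comment> \<open>The approximation uses up \<open>\<eta> / 2\<close>; the box error
    \<open>K * h\<close> and the limit in \<open>t\<close> take \<open>\<eta> / 4\<close>
    each.\<close>
  define r where "r = \<eta> / (2 * (L + N + 1))"
  have r: "0 < r" using \<eta> L N by (simp add: r_def)
  obtain \<Q> a where Q: "finite \<Q>" "\<And>Q. Q \<in> \<Q> \<Longrightarrow> Q \<noteq> {} \<and> (\<exists>l u. Q = cbox l u)" "pairwise disjnt \<Q>"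
    "\<And>Q. Q \<in> \<Q> \<Longrightarrow> Q \<subseteq> W" "\<And>Q. Q \<in> \<Q> \<Longrightarrow> \<bar>a Q\<bar> \<le> N"
    "(\<integral>x. \<bar>indicator W x * \<phi> x - (\<Sum>Q\<in>\<Q>. a Q * indicator Q x)\<bar> \<partial>lborel) \<le> r"
  proof (rule box_step_approximation[OF W \<phi>(1) N(2,1) r], goal_cases)
    case (1 x)
    show ?case by (rule 1(2))
  next
    case (2 \<Q> a)
    show thesis by (rule 2(1)[OF 2(2-7)])
  qed
  let ?\<psi> = "\<lambda>x. \<Sum>Q\<in>\<Q>. a Q * indicator Q x"
  let ?df = "\<lambda>h x. (f (x + h *\<^sub>R e) - f x) / h"
  have Qb: "bounded Q" "Q \<in> sets borel" "compact Q" if "Q \<in> \<Q>" for Q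
    using Q(2)[OF that] by auto
  have Wb: "W \<in> sets borel" using W by simp
  have \<phi>m: "\<phi> \<in> borel_measurable borel" using \<phi>(1) by (rule borel_measurable_continuous_onI)
  have \<psi>m: "?\<psi> \<in> borel_measurable borel"
    using Qb by (intro borel_measurable_sum borel_measurable_times borel_measurable_indicator) auto
  have UW: "\<Union>\<Q> \<subseteq> W" using Q(4) by (rule Union_least)
  have \<psi>_out: "(\<Sum>Q\<in>\<Q>. g Q * indicator Q x) = (0::real)" if "x \<notin> \<Union>\<Q>" for x g
    using that by (intro sum.neutral) auto
  have \<psi>b: "\<bar>?\<psi> x\<bar> \<le> N" for x
  proof (cases "x \<in> \<Union>\<Q>")
    case True
    then obtain Q0 where "Q0 \<in> \<Q>" "x \<in> Q0" by blast
    then show ?thesis using sum_indicator_disjoint[OF Q(1,3), of Q0 x a] Q(5) by simp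
  next
    case False
    then show ?thesis using \<psi>_out N by simp
  qed
  let ?d = "\<lambda>x. indicator W x * \<phi> x - ?\<psi> x"
  have dm: "?d \<in> borel_measurable borel"
    using Wb by (intro borel_measurable_diff borel_measurable_times borel_measurable_indicator \<phi>m \<psi>m) auto
  have d_out: "?d x = 0" if "x \<notin> W" for x
  proof -
    have "x \<notin> \<Union>\<Q>" using that UW by blast
    then show ?thesis unfolding \<psi>_out[OF \<open>x \<notin> \<Union>\<Q>\<close>] using that by simp
  qed
  have db: "\<bar>?d x\<bar> \<le> 2 * N" for x
    using \<psi>b[of x] N by (cases "x \<in> W") (auto intro: order_trans[OF abs_triangle_ineq4] dest!: N(2))
  have int_d: "integrable lborel (\<lambda>x. \<bar>?d x\<bar>)"
  proof (rule integrable_bounded_support[where K = W and M = "2 * N", OF borel_measurable_abs[OF dm] W(2)])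
    show "\<bar>?d x\<bar> = 0" if "x \<notin> W" for x unfolding d_out[OF that] by simp
    show "\<bar>\<bar>?d x\<bar>\<bar> \<le> 2 * N" for x unfolding abs_abs by (rule db)
  qed
  have dfm: "?df h \<in> borel_measurable borel" for h
    by (intro difference_quotient_measurable borel_measurable_lipschitz[OF f])
  have dfb: "\<bar>?df h x\<bar> \<le> L" for h x using lipschitz_on_shift[OF f, of x h e] e by simp
  have lin: "(\<integral>x. indicator W x * \<phi> x * ?df h x \<partial>lborel) - L * r \<le> (\<Sum>Q\<in>\<Q>. a Q * (\<integral>x. indicator Q x * ?df h x \<partial>lborel))" for h
  proof -
    have i1: "integrable lborel (\<lambda>x. indicator Q x * ?df h x)" if "Q \<in> \<Q>" for Q
      using Qb[OF that] dfb by (intro integrable_indicator_times[where M = L] dfm) auto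
    have i2: "integrable lborel (\<lambda>x. indicator W x * (\<phi> x * ?df h x))"
    proof (rule integrable_indicator_times[where M = "N * L"])
      show "(\<lambda>x. \<phi> x * ?df h x) \<in> borel_measurable borel" by (intro borel_measurable_times \<phi>m dfm)
      show "\<bar>\<phi> x * ?df h x\<bar> \<le> N * L" if "x \<in> W" for x
        unfolding abs_mult using N that dfb by (intro mult_mono) auto
    qed (use W in auto)
    have eq: "(\<Sum>Q\<in>\<Q>. a Q * (\<integral>x. indicator Q x * ?df h x \<partial>lborel)) = (\<integral>x. ?\<psi> x * ?df h x \<partial>lborel)"
    proof -
      have "(\<integral>x. ?\<psi> x * ?df h x \<partial>lborel) = (\<integral>x. (\<Sum>Q\<in>\<Q>. a Q * (indicator Q x * ?df h x)) \<partial>lborel)"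
        unfolding sum_distrib_right mult.assoc ..
      also have "\<dots> = (\<Sum>Q\<in>\<Q>. \<integral>x. a Q * (indicator Q x * ?df h x) \<partial>lborel)"
        by (intro Bochner_Integration.integral_sum integrable_mult_right i1)
      finally show ?thesis unfolding integral_mult_right_zero ..
    qed
    have i3: "integrable lborel (\<lambda>x. ?\<psi> x * ?df h x)"
      unfolding sum_distrib_right mult.assoc by (intro Bochner_Integration.integrable_sum integrable_mult_right i1)
    have "(\<integral>x. indicator W x * \<phi> x * ?df h x \<partial>lborel) - (\<integral>x. ?\<psi> x * ?df h x \<partial>lborel) =
        (\<integral>x. indicator W x * (\<phi> x * ?df h x) - ?\<psi> x * ?df h x \<partial>lborel)"
      unfolding mult.assoc[of "indicator W _"] using Bochner_Integration.integral_diff[OF i2 i3] by simp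
    also have "\<dots> \<le> (\<integral>x. L * \<bar>?d x\<bar> \<partial>lborel)"
    proof (intro integral_mono Bochner_Integration.integrable_diff i2 i3 integrable_mult_right int_d)
      fix x
      have "indicator W x * (\<phi> x * ?df h x) - ?\<psi> x * ?df h x = ?d x * ?df h x"
        by (simp only: left_diff_distrib mult.assoc)
      also have "\<dots> \<le> \<bar>?d x\<bar> * \<bar>?df h x\<bar>" unfolding abs_mult[symmetric] by (rule abs_ge_self)
      also have "\<dots> \<le> \<bar>?d x\<bar> * L" by (intro mult_left_mono dfb) simp
      finally show "indicator W x * (\<phi> x * ?df h x) - ?\<psi> x * ?df h x \<le> L * \<bar>?d x\<bar>" by (simp only: mult.commute)
    qed
    also have "\<dots> = L * (\<integral>x. \<bar>?d x\<bar> \<partial>lborel)" by (rule integral_mult_right_zero)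
    also have "\<dots> \<le> L * r" using Q(6) L by (rule mult_left_mono)
    finally show ?thesis unfolding eq by linarith
  qed
  have quad: "(\<Sum>Q\<in>\<Q>. (a Q)\<^sup>2 / 2 * measure lborel Q) \<le> (\<integral>x. indicator W x * (\<phi> x)\<^sup>2 \<partial>lborel) / 2 + N * r"
  proof -
    have iQ: "integrable lborel (\<lambda>x. (a Q)\<^sup>2 * indicator Q x)" if "Q \<in> \<Q>" for Q
      using Qb[OF that] emeasure_bounded_finite[OF Qb(1)[OF that]] by (intro integrable_mult_right integrable_real_indicator) auto
    have i2: "integrable lborel (\<lambda>x. indicator W x * (\<phi> x)\<^sup>2)"
      using W N \<phi>m by (intro integrable_indicator_times[where M = "N\<^sup>2"] borel_measurable_power) (auto simp: abs_le_square_iff[symmetric])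
    have "(\<Sum>Q\<in>\<Q>. (a Q)\<^sup>2 * measure lborel Q) = (\<Sum>Q\<in>\<Q>. \<integral>x. (a Q)\<^sup>2 * indicator Q x \<partial>lborel)"
      by (intro sum.cong) (auto simp: Qb)
    also have "\<dots> = (\<integral>x. (\<Sum>Q\<in>\<Q>. (a Q)\<^sup>2 * indicator Q x) \<partial>lborel)"
      by (intro Bochner_Integration.integral_sum[symmetric] iQ)
    also have "\<dots> \<le> (\<integral>x. indicator W x * (\<phi> x)\<^sup>2 + 2 * N * \<bar>?d x\<bar> \<partial>lborel)"
    proof (intro integral_mono Bochner_Integration.integrable_sum iQ Bochner_Integration.integrable_add i2 integrable_mult_right int_d)
      fix x
      show "(\<Sum>Q\<in>\<Q>. (a Q)\<^sup>2 * indicator Q x) \<le> indicator W x * (\<phi> x)\<^sup>2 + 2 * N * \<bar>?d x\<bar>"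
      proof (cases "x \<in> \<Union>\<Q>")
        case True
        then obtain Q0 where Q0: "Q0 \<in> \<Q>" "x \<in> Q0" by blast
        have xW: "x \<in> W" using True UW by blast
        have 1: "(\<Sum>Q\<in>\<Q>. (a Q)\<^sup>2 * indicator Q x) = (a Q0)\<^sup>2"
          using sum_indicator_disjoint[OF Q(1,3) Q0] .
        have 2: "?\<psi> x = a Q0" using sum_indicator_disjoint[OF Q(1,3) Q0] .
        have "(a Q0)\<^sup>2 - (\<phi> x)\<^sup>2 = (a Q0 - \<phi> x) * (a Q0 + \<phi> x)" by (simp add: power2_eq_square algebra_simps)
        also have "\<dots> \<le> \<bar>a Q0 - \<phi> x\<bar> * \<bar>a Q0 + \<phi> x\<bar>" unfolding abs_mult[symmetric] by (rule abs_ge_self)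
        also have "\<dots> \<le> \<bar>a Q0 - \<phi> x\<bar> * (2 * N)"
          using Q(5)[OF Q0(1)] N(2)[OF xW] by (intro mult_left_mono) auto
        finally show ?thesis unfolding 1 2 using xW by (simp add: abs_minus_commute mult_ac)
      next
        case False
        then show ?thesis using \<psi>_out[OF False] N by simp
      qed
    qed
    also have "\<dots> = (\<integral>x. indicator W x * (\<phi> x)\<^sup>2 \<partial>lborel) + 2 * N * (\<integral>x. \<bar>?d x\<bar> \<partial>lborel)"
      by (subst Bochner_Integration.integral_add[OF i2 integrable_mult_right[OF int_d]]) (simp only: integral_mult_right_zero)
    also have "\<dots> \<le> (\<integral>x. indicator W x * (\<phi> x)\<^sup>2 \<partial>lborel) + 2 * N * r"
      using Q(6) N by (intro add_left_mono mult_left_mono) auto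
    finally show ?thesis by (simp add: sum_divide_distrib[symmetric])
  qed
  have v0': "\<forall>\<^sub>F t in at_right 0. \<forall>Q\<in>\<Q>. \<forall>y\<in>Q. y \<notin> D t \<longrightarrow> v t y = 0"
    using Q(1,4) Qb(3) v0 by (simp add: eventually_ball_finite_distrib)
  obtain K where K: "\<And>h \<eta>. 0 < h \<Longrightarrow> 0 < \<eta> \<Longrightarrow> \<forall>\<^sub>F t in at_right (0::real).
    ennreal (measure lborel (D t) + t\<^sup>2 * ((\<Sum>Q\<in>\<Q>. a Q * (\<integral>x. indicator Q x * ?df h x \<partial>lborel)
        - (a Q)\<^sup>2 / 2 * measure lborel Q) - K * h - \<eta>))
    \<le> hausdorff_measure DIM('b \<times> real) ((\<lambda>y. (y, t * v t y)) ` D t)"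
    using graph_area_gain[OF Q(1,2,3) e f D v v0' vf, of a] by blast
  have "((\<lambda>h. K * h) \<longlongrightarrow> K * 0) (at_right 0)" by (intro tendsto_intros)
  then have "\<forall>\<^sub>F h in at_right 0. K * h < \<eta> / 4"
    using \<eta> by (intro order_tendstoD(2)) auto
  moreover have "\<forall>\<^sub>F h in at_right (0::real). 0 < h" by (simp add: eventually_at_filter)
  ultimately show ?thesis
  proof eventually_elim
    case (elim h)
    have "\<forall>\<^sub>F t in at_right (0::real).
      ennreal (measure lborel (D t) + t\<^sup>2 * ((\<Sum>Q\<in>\<Q>. a Q * (\<integral>x. indicator Q x * ?df h x \<partial>lborel)
        - (a Q)\<^sup>2 / 2 * measure lborel Q) - K * h - \<eta> / 4))
      \<le> hausdorff_measure DIM('b \<times> real) ((\<lambda>y. (y, t * v t y)) ` D t)"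
      using elim \<eta> by (intro K) auto
    then show ?case
    proof eventually_elim
      case (elim t)
      have "(L + N) * r \<le> (L + N + 1) * r" using r by (intro mult_right_mono) auto
      also have "\<dots> = \<eta> / 2"
      proof -
        have *: "X * (\<eta> / (2 * X)) = \<eta> / 2" if "0 < X" for X :: real using that by simp
        show ?thesis unfolding r_def by (rule *) (use L N in simp)
      qed
      finally have "L * r + N * r \<le> \<eta> / 2" by (simp add: distrib_right)
      then have "(\<integral>x. indicator W x * \<phi> x * ?df h x \<partial>lborel) - (\<integral>x. indicator W x * (\<phi> x)\<^sup>2 \<partial>lborel) / 2 - \<eta>
          \<le> (\<Sum>Q\<in>\<Q>. a Q * (\<integral>x. indicator Q x * ?df h x \<partial>lborel) - (a Q)\<^sup>2 / 2 * measure lborel Q) - K * h - \<eta> / 4"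
        using lin[of h] quad \<open>K * h < \<eta> / 4\<close> unfolding sum_subtractf by linarith
      then show ?case
        using elim by (meson add_left_mono ennreal_leI mult_left_mono order_trans zero_le_power2)
    qed
  qed
qed

subsection \<open>The moved surface\<close>

lemma sqrt_sum_squares_diff_le:
  fixes a b c d :: real
  shows "\<bar>sqrt (a\<^sup>2 + b\<^sup>2) - sqrt (c\<^sup>2 + d\<^sup>2)\<bar> \<le> \<bar>a - c\<bar> + \<bar>b - d\<bar>"
proof -
  have "\<bar>norm (a, b) - norm (c, d)\<bar> \<le> norm ((a, b) - (c, d))" by (rule norm_triangle_ineq3)
  also have "\<dots> \<le> \<bar>a - c\<bar> + \<bar>b - d\<bar>"
    by (simp add: norm_Pair sqrt_sum_squares_le_sum_abs)
  finally show ?thesis by (simp add: norm_Pair)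
qed

text \<open>With \<open>a = |y|\<close> and \<open>b = t f\<close> this bounds the lift of the
  boundary and produces the weight \<open>1 / |y|\<close>.\<close>

lemma sqrt_sum_squares_minus_le:
  fixes a b :: real
  assumes "0 < a"
  shows "sqrt (a\<^sup>2 + b\<^sup>2) - a \<le> b\<^sup>2 / (2 * a)"
proof -
  have "sqrt (a\<^sup>2 + b\<^sup>2) \<le> a + b\<^sup>2 / (2 * a)"
  proof (rule real_le_lsqrt)
    have "(a + b\<^sup>2 / (2 * a))\<^sup>2 = a\<^sup>2 + b\<^sup>2 + (b\<^sup>2 / (2 * a))\<^sup>2"
      using assms by (simp add: power2_sum)
    then show "a\<^sup>2 + b\<^sup>2 \<le> (a + b\<^sup>2 / (2 * a))\<^sup>2" by simp
  qed (use assms in auto)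
  then show ?thesis by simp
qed

lemma dist_Pair_le: "dist (a, b) (c, d) \<le> dist a c + dist b d"
  by (simp add: dist_Pair_Pair sqrt_sum_squares_le_sum)

text \<open>The function is dominated by a sum over dyadic balls, of radius \<open>r k\<close> and
  height \<open>2 / r k\<close>. In dimension at least two the integrals decay at least like
  \<open>2 ^ (- k)\<close>.\<close>

lemma integrable_inverse_norm:
  assumes dim: "2 \<le> DIM('a::euclidean_space)" and T: "0 < T"
  shows "integrable lborel (\<lambda>x :: 'a. indicator (ball 0 T) x / norm x)"
proof (rule integrableI_bounded)
  let ?m = "DIM('a)"
  define w where "w = unit_ball_vol (real ?m)"
  have w: "0 \<le> w" by (simp add: w_def)
  define r where "r k = T * (1/2) ^ k" for k :: nat
  have r: "0 < r k" for k using T by (simp add: r_def)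
  let ?g = "\<lambda>k x :: 'a. ennreal (2 / r k) * indicator (cball 0 (r k)) x"
  have pt: "ennreal (norm (indicator (ball 0 T) x / norm x)) \<le> (\<Sum>k. ?g k x)" for x :: 'a
  proof (cases "x = 0 \<or> x \<notin> ball 0 T")
    case True
    then show ?thesis by auto
  next
    case False
    then have x: "0 < norm x" "norm x < T" by auto
    have "(\<lambda>k. T * (1/2) ^ k) \<longlonglongrightarrow> T * 0" by (intro tendsto_intros) auto
    then have "r \<longlonglongrightarrow> 0" by (simp add: r_def[abs_def])
    then have "\<forall>\<^sub>F k in sequentially. r k < norm x" using x(1) by (rule order_tendstoD(2))
    then obtain k0 where k0: "r k0 < norm x" by (auto simp: eventually_sequentially)
    \<comment> \<open>The point lies in the annulus between \<open>r k\<close> and the preceding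
      radius, which is \<open>2 * r k\<close>.\<close>
    define k where "k = (LEAST k. r k < norm x)"
    have k: "r k < norm x" unfolding k_def using k0 by (rule LeastI)
    have "k \<noteq> 0"
    proof
      assume "k = 0"
      then show False using k x by (simp add: r_def)
    qed
    then obtain j where j: "k = Suc j" using not0_implies_Suc by blast
    have "\<not> r j < norm x" using not_less_Least[of j "\<lambda>k. r k < norm x"] j by (simp add: k_def[symmetric])
    then have le: "norm x \<le> r j" by simp
    have "r j = 2 * r k" by (simp add: r_def j)
    then have "1 / norm x \<le> 2 / r j" using k r[of k] x by (simp add: field_simps)
    then have "ennreal (norm (indicator (ball 0 T) x / norm x)) \<le> ?g j x"
      using le x by (auto intro!: ennreal_leI)
    also have "\<dots> \<le> (\<Sum>k. ?g k x)"
      using ennreal_suminf_lessD[of "\<lambda>k. ?g k x" "?g j x" j] by (meson less_irrefl not_le)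
    finally show ?thesis .
  qed
  have "(\<integral>\<^sup>+x. ennreal (norm (indicator (ball 0 T) x / norm x)) \<partial>(lborel :: 'a measure)) \<le> (\<integral>\<^sup>+x. (\<Sum>k. ?g k x) \<partial>lborel)"
    by (intro nn_integral_mono pt)
  also have "\<dots> = (\<Sum>k. \<integral>\<^sup>+x. ?g k x \<partial>lborel)"
    by (rule nn_integral_suminf) (intro borel_measurable_times_ennreal borel_measurable_const borel_measurable_indicator, simp)
  also have "\<dots> = (\<Sum>k. ennreal (2 / r k * (w * r k ^ ?m)))"
    using r w by (intro suminf_cong) (simp add: nn_integral_cmult_indicator emeasure_cball less_imp_le w_def ennreal_mult'[symmetric] del: times_divide_eq_left)
  also have "\<dots> \<le> (\<Sum>k. ennreal (2 * w * T ^ (?m - 1) * (1/2) ^ k))"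
  proof (intro suminf_le ennreal_leI)
    fix k
    obtain j where j: "?m = Suc (Suc j)" using dim by (metis Suc_le_D numeral_2_eq_2 Suc_le_mono)
    have "2 / r k * (w * r k ^ ?m) = 2 * w * r k ^ Suc j" using r[of k] by (simp add: j)
    also have "\<dots> = 2 * w * T ^ Suc j * ((1/2) ^ k) ^ Suc j" by (simp add: r_def power_mult_distrib)
    also have "\<dots> \<le> 2 * w * T ^ Suc j * ((1/2) ^ k) ^ 1"
      using w T by (intro mult_left_mono power_decreasing) (auto simp: power_le_one)
    finally show "2 / r k * (w * r k ^ ?m) \<le> 2 * w * T ^ (?m - 1) * (1/2) ^ k" by (simp add: j)
  qed auto
  also have "\<dots> = ennreal (2 * w * T ^ (?m - 1) * 2)"
  proof (rule suminf_ennreal_eq)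
    have "(\<lambda>k. (1/2::real) ^ k) sums 2" using geometric_sums[of "1/2::real"] by simp
    then show "(\<lambda>k. 2 * w * T ^ (?m - 1) * (1/2) ^ k) sums (2 * w * T ^ (?m - 1) * 2)" by (rule sums_mult)
  qed (use w T in auto)
  also have "\<dots> < \<infinity>" by simp
  finally show "(\<integral>\<^sup>+x. ennreal (norm (indicator (ball 0 T) x / norm x)) \<partial>(lborel :: 'a measure)) < \<infinity>" .
qed (auto intro!: borel_measurable_divide borel_measurable_indicator borel_measurable_norm)

text \<open>The function on the closed cone is extended to the whole space by its boundary value at the
  same \<open>fst x\<close>, which keeps it Lipschitz.\<close>

locale flow_data =
  fixes lam L M T :: real and F :: "'b::euclidean_space \<times> real \<Rightarrow> real"
  assumes lam: "0 < lam" and T: "0 < T"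
    and lip: "L-lipschitz_on UNIV F" and bound: "\<bar>F x\<bar> \<le> M"
    and far: "lam * norm (fst x) \<le> snd x \<Longrightarrow> T \<le> norm x \<Longrightarrow> F x = 0"
    and below: "z \<le> lam * norm y \<Longrightarrow> F (y, z) = F (y, lam * norm y)"
begin

lemma L_nonneg: "0 \<le> L" using lip by (rule lipschitz_on_nonneg)

lemma M_nonneg: "0 \<le> M" using bound[of undefined] by linarith

text \<open>Truncation makes the cone bounded. On the closed cone \<open>F\<close> vanishes from
  height \<open>T\<close> on, so the upper face is never moved and contributes no boundary
  term.\<close>

definition W :: "('b \<times> real) set" where
  "W = {x. lam * norm (fst x) < snd x \<and> snd x < T}"

definition boundary_value :: "'b \<Rightarrow> real" where
  "boundary_value y = F (y, lam * norm y)"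

definition B :: real where
  "B = (\<integral>y. (boundary_value y)\<^sup>2 / norm y \<partial>lborel)"

lemma boundary_value_far: "T \<le> norm y \<Longrightarrow> boundary_value y = 0"
  unfolding boundary_value_def
  by (rule far) (auto intro: order_trans[OF _ norm_fst_le[of y "lam * norm y"]])

lemma boundary_value_bound: "\<bar>boundary_value y\<bar> \<le> M" unfolding boundary_value_def by (rule bound)

lemma F_continuous: "continuous_on A F"
  using lipschitz_on_continuous_on[OF lip] continuous_on_subset by blast

lemma F_measurable: "F \<in> borel_measurable borel"
  using lip by (rule borel_measurable_lipschitz)

lemma boundary_value_continuous: "continuous_on A boundary_value"
  unfolding boundary_value_def by (intro continuous_on_compose2[OF F_continuous[of UNIV]] continuous_intros) auto

lemma open_W: "open W"
proof -
  have "W = {x. lam * norm (fst x) < snd x} \<inter> {x. snd x < T}" by (auto simp: W_def)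
  then show ?thesis by (simp only:) (intro open_Int open_Collect_less continuous_intros)
qed

lemma W_norm_le: "x \<in> W \<Longrightarrow> norm x \<le> T / lam + T"
proof -
  assume x: "x \<in> W"
  have "0 \<le> lam * norm (fst x)" using lam by simp
  then have "0 < snd x" "snd x < T" "lam * norm (fst x) < T" using x by (auto simp: W_def)
  then have "norm (fst x) \<le> T / lam" "norm (snd x) \<le> T" using lam by (auto simp: field_simps)
  then show ?thesis using norm_Pair_le[of "fst x" "snd x"] by simp
qed

lemma bounded_W: "bounded W"
  using W_norm_le unfolding bounded_iff by blast

lemma W_measurable: "W \<in> sets borel" "W \<in> fmeasurable lborel"
  using open_W bounded_W by (auto intro: fmeasurable_bounded_borel)

text \<open>The trace is bounded and vanishes far out, but it may be nonzero at the vertex; the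
  weight itself has to be integrable there.\<close>

lemma boundary_value_integrable: "2 \<le> DIM('b) \<Longrightarrow> integrable lborel (\<lambda>y. (boundary_value y)\<^sup>2 / norm y)"
proof -
  assume dim: "2 \<le> DIM('b)"
  have "integrable lborel (\<lambda>y :: 'b. M\<^sup>2 * (indicator (ball 0 T) y / norm y))"
    using integrable_inverse_norm[OF dim T] by (rule integrable_mult_right)
  moreover have "(\<lambda>y. (boundary_value y)\<^sup>2 / norm y) \<in> borel_measurable lborel"
    using borel_measurable_continuous_onI[OF boundary_value_continuous] by auto
  moreover have "norm ((boundary_value y)\<^sup>2 / norm y) \<le> norm (M\<^sup>2 * (indicator (ball 0 T) y / norm y))" for y
  proof (cases "norm y < T")
    case True
    have "(boundary_value y)\<^sup>2 \<le> M\<^sup>2" using boundary_value_bound[of y] by (simp add: abs_le_square_iff[symmetric] M_nonneg)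
    then show ?thesis using True by (auto simp: abs_divide intro!: divide_right_mono)
  next
    case False
    then show ?thesis using boundary_value_far[of y] by simp
  qed
  ultimately show ?thesis by (rule Bochner_Integration.integrable_bound[OF _ _ AE_I2])
qed

section \<open>The vertical flow and its inverse\<close>

definition shift :: "real \<Rightarrow> 'b \<times> real \<Rightarrow> real" where
  "shift t x = lam * (sqrt ((norm (fst x))\<^sup>2 + (t * F x)\<^sup>2) - norm (fst x))"

definition flow :: "real \<Rightarrow> 'b \<times> real \<Rightarrow> 'b \<times> real" where
  "flow t x = (fst x, snd x + shift t x)"

definition unflow :: "real \<Rightarrow> 'b \<times> real \<Rightarrow> 'b \<times> real" where
  "unflow t y = (SOME x. flow t x = y)"

lemma shift_nonneg: "0 \<le> shift t x"
proof -
  have "norm (fst x) \<le> sqrt ((norm (fst x))\<^sup>2 + (t * F x)\<^sup>2)" by (rule real_le_rsqrt) simp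
  then show ?thesis using lam by (simp add: shift_def)
qed

lemma shift_zero: "F x = 0 \<Longrightarrow> shift t x = 0"
  by (simp add: shift_def)

lemma shift_le:
  assumes "0 \<le> t" shows "shift t x \<le> lam * t * M"
proof -
  have "sqrt ((norm (fst x))\<^sup>2 + (t * F x)\<^sup>2) - norm (fst x) \<le> \<bar>t * F x\<bar>"
    using sqrt_sum_squares_diff_le[of "norm (fst x)" "t * F x" "norm (fst x)" 0] by simp
  also have "\<dots> \<le> t * M" using assms bound[of x] by (simp add: abs_mult mult_left_mono)
  finally show ?thesis using lam unfolding shift_def by (metis mult.assoc mult_left_mono less_imp_le)
qed

text \<open>The two contributions are kept apart: the horizontal one has the constant
  \<open>2 * lam\<close>, which is not small in \<open>t\<close>, but it is absent on vertical
  lines; the other one carries the factor \<open>t\<close>.\<close>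

lemma shift_diff:
  assumes "0 \<le> t"
  shows "\<bar>shift t x - shift t y\<bar> \<le> lam * (2 * dist (fst x) (fst y)) + lam * (t * L) * dist x y"
proof -
  let ?n = "\<lambda>x. norm (fst x)"
  have 1: "\<bar>?n x - ?n y\<bar> \<le> dist (fst x) (fst y)" unfolding dist_norm by (rule norm_triangle_ineq3)
  have "\<bar>t * F x - t * F y\<bar> = t * \<bar>F x - F y\<bar>" using assms by (simp add: right_diff_distrib[symmetric] abs_mult)
  also have "\<dots> \<le> t * (L * dist x y)"
    using lipschitz_onD[OF lip, of x y] assms by (intro mult_left_mono) (auto simp: dist_real_def)
  finally have 2: "\<bar>t * F x - t * F y\<bar> \<le> t * L * dist x y" by simp
  have "\<bar>(sqrt ((?n x)\<^sup>2 + (t * F x)\<^sup>2) - ?n x) - (sqrt ((?n y)\<^sup>2 + (t * F y)\<^sup>2) - ?n y)\<bar> \<le>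
      2 * dist (fst x) (fst y) + t * L * dist x y"
    using sqrt_sum_squares_diff_le[of "?n x" "t * F x" "?n y" "t * F y"] 1 2 by linarith
  then have "lam * \<bar>(sqrt ((?n x)\<^sup>2 + (t * F x)\<^sup>2) - ?n x) - (sqrt ((?n y)\<^sup>2 + (t * F y)\<^sup>2) - ?n y)\<bar> \<le>
      lam * (2 * dist (fst x) (fst y) + t * L * dist x y)"
    using lam by (intro mult_left_mono) auto
  then show ?thesis
    using lam unfolding shift_def right_diff_distrib[symmetric, of lam] abs_mult by (simp add: distrib_left)
qed

lemma shift_continuous: "continuous_on A (shift t)"
  unfolding shift_def by (intro continuous_intros F_continuous)

text \<open>This makes \<open>shift t\<close> a contraction on vertical lines, so that \<open>flow t\<close> is bijective.\<close>

definition small :: "real \<Rightarrow> bool" where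
  "small t \<longleftrightarrow> 0 < t \<and> lam * (t * L) \<le> 1 / 2"

lemma eventually_small: "\<forall>\<^sub>F t in at_right 0. small t"
proof -
  have "((\<lambda>t. lam * (t * L)) \<longlongrightarrow> lam * (0 * L)) (at_right 0)" by (intro tendsto_intros)
  then have "\<forall>\<^sub>F t in at_right 0. lam * (t * L) < 1 / 2" by (intro order_tendstoD(2)) auto
  moreover have "\<forall>\<^sub>F t in at_right (0::real). 0 < t" by (simp add: eventually_at_filter)
  ultimately show ?thesis by eventually_elim (simp add: small_def)
qed

context
  fixes t assumes t: "small t"
begin

lemma t_pos: "0 < t" using t by (simp add: small_def)

lemma flow_strict_mono:
  assumes "fst x = fst y" "snd x < snd y"
  shows "snd (flow t x) < snd (flow t y)"
proof -
  have d: "dist x y = snd y - snd x" using assms by (cases x; cases y) (simp add: dist_Pair_Pair dist_real_def)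
  have "\<bar>shift t x - shift t y\<bar> \<le> lam * (t * L) * (snd y - snd x)"
    using shift_diff[of t x y] t_pos assms(1) d by simp
  also have "\<dots> \<le> 1 / 2 * (snd y - snd x)"
    using t assms by (intro mult_right_mono) (auto simp: small_def)
  finally have "\<bar>shift t x - shift t y\<bar> \<le> 1 / 2 * (snd y - snd x)" .
  then have "shift t x - shift t y \<le> 1 / 2 * (snd y - snd x)" by (simp only: abs_le_iff)
  then show ?thesis unfolding flow_def snd_conv using assms(2) by (simp add: field_simps)
qed

lemma flow_inj: "flow t x = flow t y \<Longrightarrow> x = y"
  using flow_strict_mono[of x y] flow_strict_mono[of y x]
  by (metis flow_def fst_conv less_irrefl linorder_neqE prod_eqI)

text \<open>A preimage lies on the same vertical line, lower by at most the largest shift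
  \<open>lam * t * M\<close>; the intermediate value theorem finds it there.\<close>

lemma flow_unflow: "flow t (unflow t y) = y"
proof -
  let ?h = "\<lambda>z. snd (flow t (fst y, z))"
  have "\<exists>z\<ge>snd y - lam * t * M. z \<le> snd y \<and> ?h z = snd y"
  proof (rule IVT')
    show "?h (snd y - lam * t * M) \<le> snd y" using shift_le[of t] t_pos by (simp add: flow_def)
    show "snd y \<le> ?h (snd y)" using shift_nonneg by (simp add: flow_def)
    show "snd y - lam * t * M \<le> snd y" using lam t_pos M_nonneg by simp
    show "continuous_on {snd y - lam * t * M..snd y} ?h"
      unfolding flow_def snd_conv by (intro continuous_intros continuous_on_compose2[OF shift_continuous[of UNIV]]) auto
  qed
  then obtain z where "?h z = snd y" by blast
  then have "flow t (fst y, z) = y" by (simp add: flow_def prod_eq_iff)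
  then show ?thesis unfolding unflow_def by (rule someI)
qed

lemma unflow_flow: "unflow t (flow t x) = x"
  by (rule flow_inj) (rule flow_unflow)

lemma fst_unflow: "fst (unflow t y) = fst y"
  using flow_unflow[of y] by (metis flow_def fst_conv)

lemma snd_unflow: "snd (unflow t y) = snd y - shift t (unflow t y)"
  using flow_unflow[of y] by (metis flow_def snd_conv add_diff_cancel_right')

lemma dist_unflow_le: "dist (unflow t y) y \<le> lam * t * M"
proof -
  have "dist (unflow t y) y \<le> dist (fst (unflow t y)) (fst y) + dist (snd (unflow t y)) (snd y)"
    by (metis dist_Pair_le prod.collapse)
  also have "\<dots> = shift t (unflow t y)" using shift_nonneg by (simp add: fst_unflow snd_unflow dist_real_def)
  also have "\<dots> \<le> lam * t * M" using t_pos by (intro shift_le) auto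
  finally show ?thesis .
qed

lemma dist_unflow_unflow_le: "dist (unflow t y) (unflow t z) \<le> (4 * lam + 4) * dist y z"
proof -
  let ?x = "unflow t y" and ?w = "unflow t z"
  define d1 d2 c where "d1 = dist (fst y) (fst z)" and "d2 = \<bar>snd y - snd z\<bar>" and "c = \<bar>snd ?x - snd ?w\<bar>"
  have "dist (fst ?x, snd ?x) (fst ?w, snd ?w) \<le> dist (fst ?x) (fst ?w) + dist (snd ?x) (snd ?w)"
    by (rule dist_Pair_le)
  then have xw: "dist ?x ?w \<le> d1 + c"
    unfolding prod.collapse by (simp only: d1_def c_def fst_unflow dist_real_def)
  have sh: "\<bar>shift t ?x - shift t ?w\<bar> \<le> lam * (2 * d1) + lam * (t * L) * dist ?x ?w"
    using shift_diff[of t ?x ?w] t_pos by (simp add: d1_def fst_unflow)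
  have "lam * (t * L) * dist ?x ?w \<le> 1 / 2 * (d1 + c)"
    using t xw by (intro mult_mono) (auto simp: small_def)
  then have "\<bar>shift t ?x - shift t ?w\<bar> \<le> 2 * (lam * d1) + 1 / 2 * (d1 + c)"
    by (intro order_trans[OF sh]) simp
  moreover have "snd ?x - snd ?w = (snd y - snd z) - (shift t ?x - shift t ?w)"
    using snd_unflow[of y] snd_unflow[of z] by linarith
  then have "c \<le> d2 + \<bar>shift t ?x - shift t ?w\<bar>"
    unfolding c_def d2_def using abs_triangle_ineq4 by metis
  ultimately have "c \<le> d2 + (2 * (lam * d1) + 1 / 2 * (d1 + c))" by linarith
  \<comment> \<open>The unknown vertical distance \<open>c\<close> occurs on the right with factor
    one half and is absorbed.\<close>
  then have "c \<le> 2 * d2 + 4 * (lam * d1) + d1" by (simp add: field_simps)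
  then have "dist ?x ?w \<le> 2 * d1 + 2 * d2 + 4 * (lam * d1)" using xw by (simp add: field_simps)
  also have "\<dots> \<le> 2 * dist y z + 2 * dist y z + 4 * (lam * dist y z)"
    using dist_fst_le[of y z] dist_snd_le[of y z] lam
    by (intro add_mono mult_left_mono) (auto simp: d1_def d2_def dist_real_def)
  finally show ?thesis by (simp add: algebra_simps)
qed

end

section \<open>The moved surface as a graph\<close>

definition L' :: real where "L' = L * (4 * lam + 4)"

definition v :: "real \<Rightarrow> 'b \<times> real \<Rightarrow> real" where
  "v t y = F (unflow t y)"

text \<open>One constant has to serve the limit \<open>F\<close> and all heights \<open>v t\<close>
  at once; \<open>4 * lam + 4\<close> is the Lipschitz constant of \<open>unflow t\<close>.\<close>

lemma F_lipschitz': "L'-lipschitz_on UNIV F"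
proof -
  have "L * 1 \<le> L'" unfolding L'_def using L_nonneg lam by (intro mult_left_mono) auto
  then show ?thesis using lipschitz_on_mono[OF lip, of UNIV L'] by simp
qed

lemma v_lipschitz: "small t \<Longrightarrow> L'-lipschitz_on UNIV (v t)"
proof (rule lipschitz_onI)
  assume t: "small t"
  fix y z
  have "dist (v t y) (v t z) \<le> L * dist (unflow t y) (unflow t z)"
    unfolding v_def by (rule lipschitz_onD[OF lip]) auto
  also have "\<dots> \<le> L * ((4 * lam + 4) * dist y z)"
    using dist_unflow_unflow_le[OF t] L_nonneg by (intro mult_left_mono) auto
  finally show "dist (v t y) (v t z) \<le> L' * dist y z" by (simp add: L'_def mult.assoc)
next
  show "0 \<le> L'" using L_nonneg lam by (simp add: L'_def)
qed

lemma v_tendsto_F: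
  assumes "0 < \<epsilon>"
  shows "\<forall>\<^sub>F t in at_right 0. \<forall>x. \<bar>v t x - F x\<bar> \<le> \<epsilon>"
proof -
  have "((\<lambda>t. L * (lam * t * M)) \<longlongrightarrow> L * (lam * 0 * M)) (at_right 0)" by (intro tendsto_intros)
  then have "\<forall>\<^sub>F t in at_right 0. L * (lam * t * M) < \<epsilon>" using assms by (intro order_tendstoD(2)) auto
  then show ?thesis using eventually_small
  proof eventually_elim
    case (elim t)
    have "\<bar>v t x - F x\<bar> \<le> L * (lam * t * M)" for x
      using lipschitz_onD[OF lip, of "unflow t x" x] mult_left_mono[OF dist_unflow_le[OF elim(2), of x] L_nonneg]
      by (simp add: v_def dist_real_def)
    then show ?case using elim(1) by (meson less_imp_le order_trans)
  qed
qed

text \<open>The base of the moved surface: near the boundary of the cone it is smaller than \<open>W\<close>.\<close>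

definition Wt :: "real \<Rightarrow> ('b \<times> real) set" where
  "Wt t = {y. lam * sqrt ((norm (fst y))\<^sup>2 + (t * boundary_value (fst y))\<^sup>2) < snd y \<and> snd y < T}"

lemma open_Wt: "open (Wt t)"
proof -
  have "Wt t = {y. lam * sqrt ((norm (fst y))\<^sup>2 + (t * boundary_value (fst y))\<^sup>2) < snd y} \<inter> {y. snd y < T}" by (auto simp: Wt_def)
  then show ?thesis
    by (simp only:) (intro open_Int open_Collect_less continuous_intros continuous_on_compose2[OF boundary_value_continuous[of UNIV]], auto)
qed

lemma Wt_subset_W: "Wt t \<subseteq> W"
proof
  fix y assume y: "y \<in> Wt t"
  have "norm (fst y) \<le> sqrt ((norm (fst y))\<^sup>2 + (t * boundary_value (fst y))\<^sup>2)" by (rule real_le_rsqrt) simp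
  then have "lam * norm (fst y) \<le> lam * sqrt ((norm (fst y))\<^sup>2 + (t * boundary_value (fst y))\<^sup>2)"
    using lam by (intro mult_left_mono) auto
  then show "y \<in> W" using y by (auto simp: W_def Wt_def)
qed

text \<open>The flow is increasing on vertical lines and carries the boundary point below
  \<open>y\<close> to the lower boundary of \<open>Wt t\<close>, so the preimage of \<open>y\<close>
  stays above the cone boundary. It stays below height \<open>T\<close> because points of the cone
  from that height on are fixed.\<close>

lemma unflow_in_W:
  assumes t: "small t" and y: "y \<in> Wt t"
  shows "unflow t y \<in> W"
proof -
  let ?x = "unflow t y" and ?p = "(fst y, lam * norm (fst y))"
  have snd0: "snd (flow t ?p) = lam * sqrt ((norm (fst y))\<^sup>2 + (t * boundary_value (fst y))\<^sup>2)"
    by (simp add: flow_def shift_def boundary_value_def algebra_simps)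
  have lower: "lam * norm (fst y) < snd ?x"
  proof (rule ccontr)
    assume "\<not> ?thesis"
    then have le: "snd (flow t ?x) \<le> snd (flow t ?p)"
      using flow_strict_mono[OF t, of ?x ?p] fst_unflow[OF t, of y]
      by (metis fst_conv less_imp_le not_less order.order_iff_strict prod_eqI snd_conv)
    show False using y le unfolding flow_unflow[OF t] snd0 Wt_def mem_Collect_eq by linarith
  qed
  have upper: "snd ?x < T"
  proof (rule ccontr)
    assume "\<not> ?thesis"
    then have "T \<le> norm ?x" using norm_snd_le[of "snd ?x" "fst ?x"] by simp
    then have "F ?x = 0" using lower by (intro far) (auto simp: fst_unflow[OF t])
    then have "snd ?x = snd y" using snd_unflow[OF t, of y] by (simp add: shift_zero)
    then show False using y \<open>\<not> snd ?x < T\<close> by (simp add: Wt_def)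
  qed
  show ?thesis using lower upper by (simp add: W_def fst_unflow[OF t])
qed

text \<open>A compact subset of \<open>W\<close> keeps a positive vertical distance \<open>m\<close>
  from the boundary, which is lifted by at most \<open>lam * t * M\<close>.\<close>

lemma compact_subset_Wt:
  assumes C: "compact C" "C \<subseteq> W"
  shows "\<forall>\<^sub>F t in at_right 0. C \<subseteq> Wt t"
proof (cases "C = {}")
  case False
  have "continuous_on C (\<lambda>y. snd y - lam * norm (fst y))" by (intro continuous_intros)
  then obtain y0 where y0: "y0 \<in> C" "\<And>y. y \<in> C \<Longrightarrow> snd y0 - lam * norm (fst y0) \<le> snd y - lam * norm (fst y)"
    using continuous_attains_inf[OF C(1) False] by blast
  define m where "m = snd y0 - lam * norm (fst y0)"
  have m: "0 < m" using y0(1) C(2) by (auto simp: m_def W_def)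
  have "((\<lambda>t. lam * (t * M)) \<longlongrightarrow> lam * (0 * M)) (at_right 0)" by (intro tendsto_intros)
  then have "\<forall>\<^sub>F t in at_right 0. lam * (t * M) < m" using m by (intro order_tendstoD(2)) auto
  moreover have "\<forall>\<^sub>F t in at_right (0::real). 0 < t" by (simp add: eventually_at_filter)
  ultimately show ?thesis
  proof eventually_elim
    case (elim t)
    show ?case
    proof
      fix y assume y: "y \<in> C"
      have "sqrt ((norm (fst y))\<^sup>2 + (t * boundary_value (fst y))\<^sup>2) \<le> norm (fst y) + \<bar>t * boundary_value (fst y)\<bar>"
        using sqrt_sum_squares_diff_le[of "norm (fst y)" "t * boundary_value (fst y)" "norm (fst y)" 0] by simp
      also have "\<bar>t * boundary_value (fst y)\<bar> \<le> t * M"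
        using elim(2) boundary_value_bound by (simp add: abs_mult mult_left_mono)
      finally have "lam * sqrt ((norm (fst y))\<^sup>2 + (t * boundary_value (fst y))\<^sup>2) \<le> lam * (norm (fst y) + t * M)"
        using lam by (intro mult_left_mono) auto
      also have "\<dots> < snd y" using y0(2)[OF y] elim(1) by (simp add: m_def distrib_left)
      finally show "y \<in> Wt t" using y C(2) by (auto simp: Wt_def W_def)
    qed
  qed
qed simp

text \<open>By Fubini: over \<open>y\<close> the lost part is contained in the interval between the
  old and the lifted boundary, whose length is at most
  \<open>lam t\<^sup>2 f\<^sup>2 / (2 |y|)\<close>.\<close>

lemma measure_W_minus_Wt:
  assumes dim: "2 \<le> DIM('b)" and t: "0 < t"
  shows "measure lborel W - measure lborel (Wt t) \<le> lam * t\<^sup>2 / 2 * B"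
proof -
  let ?D = "W - Wt t"
  have Dm: "?D \<in> sets borel" using open_W open_Wt by auto
  have B: "0 \<le> B" unfolding B_def by (intro integral_nonneg_AE AE_I2) auto
  have "emeasure lborel ?D = emeasure (lborel \<Otimes>\<^sub>M lborel) ?D" by (simp add: lborel_prod)
  also have "\<dots> = (\<integral>\<^sup>+y. emeasure lborel (Pair y -` ?D) \<partial>lborel)"
    using Dm by (intro lborel.emeasure_pair_measure_alt) (metis lborel_prod sets_lborel)
  also have "\<dots> \<le> (\<integral>\<^sup>+y. ennreal (lam * t\<^sup>2 / 2 * ((boundary_value y)\<^sup>2 / norm y)) \<partial>lborel)"
  proof (rule nn_integral_mono_AE)
    \<comment> \<open>At \<open>y = 0\<close> the right-hand side is zero by the convention for
      division although the slice may be nonempty; the point is null.\<close>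
    have "AE y in lborel. y \<noteq> (0::'b)" by (rule AE_lborel_singleton)
    then show "AE y in lborel. emeasure lborel (Pair y -` ?D) \<le> ennreal (lam * t\<^sup>2 / 2 * ((boundary_value y)\<^sup>2 / norm y))"
    proof eventually_elim
      case (elim y)
      let ?q = "sqrt ((norm y)\<^sup>2 + (t * boundary_value y)\<^sup>2)"
      have le: "norm y \<le> ?q" by (rule real_le_rsqrt) simp
      have "Pair y -` ?D \<subseteq> {lam * norm y..lam * ?q}" by (auto simp: W_def Wt_def)
      then have "emeasure lborel (Pair y -` ?D) \<le> emeasure lborel {lam * norm y..lam * ?q}"
        by (intro emeasure_mono) auto
      also have "\<dots> = ennreal (lam * (?q - norm y))"
        using le lam by (simp add: right_diff_distrib)
      also have "\<dots> \<le> ennreal (lam * ((t * boundary_value y)\<^sup>2 / (2 * norm y)))"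
        using sqrt_sum_squares_minus_le[of "norm y" "t * boundary_value y"] elim lam
        by (intro ennreal_leI mult_left_mono) auto
      also have "lam * ((t * boundary_value y)\<^sup>2 / (2 * norm y)) = lam * t\<^sup>2 / 2 * ((boundary_value y)\<^sup>2 / norm y)"
        by (simp add: power_mult_distrib)
      finally show ?case .
    qed
  qed
  also have "\<dots> = ennreal (\<integral>y. lam * t\<^sup>2 / 2 * ((boundary_value y)\<^sup>2 / norm y) \<partial>lborel)"
    using boundary_value_integrable[OF dim] lam by (intro nn_integral_eq_integral integrable_mult_right) auto
  also have "(\<integral>y. lam * t\<^sup>2 / 2 * ((boundary_value y)\<^sup>2 / norm y) \<partial>lborel) = lam * t\<^sup>2 / 2 * B"
    unfolding B_def by (rule integral_mult_right_zero)
  finally have "measure lborel ?D \<le> lam * t\<^sup>2 / 2 * B"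
    using lam B unfolding measure_def by (intro enn2real_leI) auto
  moreover have "measure lborel ?D = measure lborel W - measure lborel (Wt t)"
    using W_measurable open_Wt Wt_subset_W
    by (intro measurable_measure_Diff) auto
  ultimately show ?thesis by simp
qed

context
  fixes S :: "('b \<times> real) set"
  assumes S: "S \<subseteq> W" "S \<in> sets borel" and S0: "\<And>x. x \<in> W \<Longrightarrow> x \<notin> S \<Longrightarrow> F x = 0"
begin

text \<open>Points of \<open>W\<close> outside \<open>S\<close> are fixed by the flow and do not
  belong to the moved surface, so they are removed from the base.\<close>

definition D :: "real \<Rightarrow> ('b \<times> real) set" where
  "D t = Wt t - (W - S)"

lemma D_measurable: "bounded (D t)" "D t \<in> sets borel"
  using bounded_subset[OF bounded_W] Wt_subset_W S(2) W_measurable open_Wt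
  by (auto simp: D_def intro!: bounded_subset[OF bounded_W])

lemma D_image:
  assumes t: "small t" and y: "y \<in> D t"
  shows "unflow t y \<in> S"
proof (rule ccontr)
  assume x: "unflow t y \<notin> S"
  have W: "unflow t y \<in> W" using y by (intro unflow_in_W t) (simp add: D_def)
  then have "shift t (unflow t y) = 0" using x S0 by (intro shift_zero) auto
  then have "unflow t y = y" using fst_unflow[OF t] snd_unflow[OF t, of y] by (simp add: prod_eq_iff)
  then show False using x W y by (auto simp: D_def)
qed

lemma graph_subset_flow_image:
  assumes t: "small t"
  shows "(\<lambda>y. (y, t * v t y)) ` D t \<subseteq> (\<lambda>x. (flow t x, t * F x)) ` S"
proof
  fix p assume "p \<in> (\<lambda>y. (y, t * v t y)) ` D t"
  then obtain y where y: "y \<in> D t" "p = (y, t * v t y)" by blast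
  then have "p = (flow t (unflow t y), t * F (unflow t y))" by (simp add: v_def flow_unflow[OF t])
  then show "p \<in> (\<lambda>x. (flow t x, t * F x)) ` S" using D_image[OF t y(1)] by (rule image_eqI)
qed

text \<open>Eventually \<open>C\<close> lies in \<open>Wt t\<close>, so a point of \<open>C\<close>
  outside \<open>D t\<close> lies outside \<open>S\<close>; there \<open>F\<close> vanishes and the
  flow fixes the point.\<close>

lemma v_eventually_zero:
  assumes C: "compact C" "C \<subseteq> W"
  shows "\<forall>\<^sub>F t in at_right 0. \<forall>y\<in>C. y \<notin> D t \<longrightarrow> v t y = 0"
  using compact_subset_Wt[OF C] eventually_small
proof eventually_elim
  case (elim t)
  show ?case
  proof (intro ballI impI)
    fix y assume y: "y \<in> C" "y \<notin> D t"
    then have "y \<in> W" "y \<notin> S" using elim(1) by (auto simp: D_def)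
    then have F0: "F y = 0" by (rule S0)
    then have "flow t y = y" by (simp add: flow_def shift_zero)
    then have "unflow t y = y" using unflow_flow[OF elim(2), of y] by simp
    then show "v t y = 0" using F0 by (simp add: v_def)
  qed
qed

lemma measure_D_ge:
  assumes dim: "2 \<le> DIM('b)" and t: "0 < t"
  shows "measure lborel S - lam * t\<^sup>2 / 2 * B \<le> measure lborel (D t)"
proof -
  have Wtm: "Wt t \<in> fmeasurable lborel"
    using bounded_subset[OF bounded_W Wt_subset_W] open_Wt by (intro fmeasurable_bounded_borel) auto
  have Sm: "S \<in> fmeasurable lborel"
    using bounded_subset[OF bounded_W S(1)] S(2) by (intro fmeasurable_bounded_borel) auto
  have WS: "W - S \<in> fmeasurable lborel" using W_measurable(2) S(2) by (intro fmeasurable_Diff) auto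
  have "measure lborel (Wt t) \<le> measure lborel (D t \<union> (W - S))"
    using Wtm fmeasurable.Un[OF fmeasurable_bounded_borel[OF D_measurable] WS]
    by (intro measure_mono_fmeasurable) (auto simp: D_def)
  also have "\<dots> \<le> measure lborel (D t) + measure lborel (W - S)"
    using D_measurable fmeasurableD[OF WS] by (intro measure_Un_le) auto
  also have "measure lborel (W - S) = measure lborel W - measure lborel S"
    using W_measurable(2) Sm S(1) by (intro measurable_measure_Diff) (auto dest: fmeasurableD)
  finally show ?thesis using measure_W_minus_Wt[OF dim t] by linarith
qed

text \<open>The vertical displacement costs at most \<open>lam * B / 2\<close> at second order; tilting the graph in
  direction \<open>e\<close> by the slope \<open>t * \<phi>\<close> gains the two integrals.\<close>

lemma flow_area_lower_bound:
  assumes dim: "2 \<le> DIM('b)" and \<phi>: "continuous_on UNIV \<phi>" "\<And>x. x \<in> W \<Longrightarrow> \<bar>\<phi> x\<bar> \<le> N"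
    and e: "e \<in> Basis" and \<eta>: "0 < \<eta>"
  shows "\<forall>\<^sub>F h in at_right 0. \<forall>\<^sub>F t in at_right (0::real).
    ennreal (measure lborel S + t\<^sup>2 * ((\<integral>x. indicator W x * \<phi> x * ((F (x + h *\<^sub>R e) - F x) / h) \<partial>lborel)
        - (\<integral>x. indicator W x * (\<phi> x)\<^sup>2 \<partial>lborel) / 2 - lam * B / 2 - \<eta>))
    \<le> hausdorff_measure DIM('b \<times> real) ((\<lambda>x. (flow t x, t * F x)) ` S)"
proof -
  have "\<forall>\<^sub>F h in at_right 0. \<forall>\<^sub>F t in at_right (0::real).
    ennreal (measure lborel (D t) + t\<^sup>2 * ((\<integral>x. indicator W x * \<phi> x * ((F (x + h *\<^sub>R e) - F x) / h) \<partial>lborel)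
        - (\<integral>x. indicator W x * (\<phi> x)\<^sup>2 \<partial>lborel) / 2 - \<eta>))
    \<le> hausdorff_measure DIM('b \<times> real) ((\<lambda>y. (y, t * v t y)) ` D t)"
  proof (rule graph_area_lower_bound[OF open_W bounded_W \<phi> e F_lipschitz' _ _ v_eventually_zero v_tendsto_F \<eta>])
    show "\<forall>\<^sub>F t in at_right 0. bounded (D t) \<and> D t \<in> sets borel" using D_measurable by simp
    show "\<forall>\<^sub>F t in at_right 0. L'-lipschitz_on UNIV (v t)"
      using eventually_small by eventually_elim (rule v_lipschitz)
  qed
  then show ?thesis
  proof eventually_elim
    case (elim h)
    then show ?case using eventually_small
    proof eventually_elim
      case (elim t)
      have t: "0 < t" using elim(2) by (simp add: small_def)
      let ?G = "(\<integral>x. indicator W x * \<phi> x * ((F (x + h *\<^sub>R e) - F x) / h) \<partial>lborel) - (\<integral>x. indicator W x * (\<phi> x)\<^sup>2 \<partial>lborel) / 2"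
      have "measure lborel S + t\<^sup>2 * (?G - lam * B / 2 - \<eta>) = measure lborel S - lam * t\<^sup>2 / 2 * B + t\<^sup>2 * (?G - \<eta>)"
        by (simp add: algebra_simps)
      also have "\<dots> \<le> measure lborel (D t) + t\<^sup>2 * (?G - \<eta>)" using measure_D_ge[OF dim t] by simp
      finally have "ennreal (measure lborel S + t\<^sup>2 * (?G - lam * B / 2 - \<eta>)) \<le> ennreal (measure lborel (D t) + t\<^sup>2 * (?G - \<eta>))"
        by (rule ennreal_leI)
      also have "\<dots> \<le> hausdorff_measure DIM('b \<times> real) ((\<lambda>y. (y, t * v t y)) ` D t)" by (rule elim(1))
      also have "\<dots> \<le> hausdorff_measure DIM('b \<times> real) ((\<lambda>x. (flow t x, t * F x)) ` S)"
        by (intro hausdorff_measure_mono graph_subset_flow_image elim(2))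
      finally show ?case .
    qed
  qed
qed

end

end

subsection \<open>A trace Hardy inequality\<close>

text \<open>The square makes the positive part continuously differentiable, so the radial field can
  be cut off at the boundary of the cone without a jump of its derivative.\<close>

lemma DERIV_pos_part_square: "((\<lambda>u. (max 0 u)\<^sup>2) has_real_derivative 2 * max 0 u) (at u)" for u :: real
proof -
  consider "u > 0" | "u < 0" | "u = 0" by linarith
  then show ?thesis
  proof cases
    case 1
    have "((\<lambda>u. u\<^sup>2) has_real_derivative 2 * u) (at u)" by (auto intro!: derivative_eq_intros)
    then show ?thesis
      using 1 by (subst has_field_derivative_cong_eventually[where g = "\<lambda>u. u\<^sup>2"])
        (auto intro!: eventually_mono[OF eventually_nhds_in_open[of "{0<..}" u]] simp: eventually_at_filter)
  next
    case 2
    have "((\<lambda>u. 0) has_real_derivative 0) (at u)" by simp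
    then show ?thesis
      using 2 by (subst has_field_derivative_cong_eventually[where g = "\<lambda>u. 0"])
        (auto intro!: eventually_mono[OF eventually_nhds_in_open[of "{..<0}" u]] simp: eventually_at_filter)
  next
    case 3
    have "((\<lambda>h. (max 0 h)\<^sup>2 / h) \<longlongrightarrow> 0) (at (0::real))"
    proof (rule Lim_null_comparison)
      have "norm ((max 0 h)\<^sup>2 / h) \<le> \<bar>h\<bar>" for h :: real
        by (cases "h \<le> 0") (auto simp: max_def power2_eq_square)
      then show "\<forall>\<^sub>F h in at (0::real). norm ((max 0 h)\<^sup>2 / h) \<le> \<bar>h\<bar>" by simp
      show "((\<lambda>h. \<bar>h\<bar>) \<longlongrightarrow> 0) (at (0::real))" by (intro tendsto_eq_intros) auto
    qed
    then show ?thesis using 3 by (simp add: DERIV_def)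
  qed
qed

lemma dominated_convergence_at_right:
  fixes s :: "real \<Rightarrow> 'a \<Rightarrow> real" and g w :: "'a \<Rightarrow> real"
  assumes "\<And>h. 0 < h \<Longrightarrow> h < 1 \<Longrightarrow> s h \<in> borel_measurable N" "g \<in> borel_measurable N" "integrable N w"
    and lim: "\<And>x. ((\<lambda>h. s h x) \<longlongrightarrow> g x) (at_right 0)"
    and le: "\<And>h x. 0 < h \<Longrightarrow> h < 1 \<Longrightarrow> \<bar>s h x\<bar> \<le> w x"
  shows "((\<lambda>h. \<integral>x. s h x \<partial>N) \<longlongrightarrow> (\<integral>x. g x \<partial>N)) (at_right 0)"
proof (rule tendsto_at_right_sequentially[of 0 1])
  fix S :: "nat \<Rightarrow> real"
  assume S: "\<And>n. 0 < S n" "\<And>n. S n < 1" "decseq S" "S \<longlonglongrightarrow> 0"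
  have "filterlim S (at_right 0) sequentially"
    unfolding filterlim_at using S(1,4) by (auto simp: less_le intro!: always_eventually)
  then have "(\<lambda>n. s (S n) x) \<longlonglongrightarrow> g x" for x
    using lim[of x] by (rule filterlim_compose[rotated])
  then show "(\<lambda>n. \<integral>x. s (S n) x \<partial>N) \<longlonglongrightarrow> (\<integral>x. g x \<partial>N)"
    using assms(1-3) le S(1,2) by (intro integral_dominated_convergence[where w = w]) auto
qed simp

lemma integral_translate:
  fixes g :: "'a::euclidean_space \<Rightarrow> real"
  assumes "g \<in> borel_measurable borel"
  shows "(\<integral>x. g (x + c) \<partial>lborel) = (\<integral>x. g x \<partial>lborel)"
proof -
  have "(\<integral>x. g x \<partial>lborel) = (\<integral>x. g x \<partial>distr lborel borel ((+) c))" by (simp add: lborel_distr_plus)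
  also have "\<dots> = (\<integral>x. g (c + x) \<partial>lborel)" using assms by (intro integral_distr) auto
  finally show ?thesis by (simp add: add.commute)
qed

text \<open>Any constant \<open>c\<close> with \<open>c / 32\<^sup>2 \<ge> 4\<close> would do, see \<open>divergence_le\<close>.\<close>

definition hardy_const :: real where "hardy_const = 4096"

section \<open>The regularised vector field\<close>

context flow_data
begin

context
  fixes \<eta> :: real
  assumes \<eta>: "0 < \<eta>"
begin

text \<open>Squared distance from the vertex; \<eta> removes the singularity there, so that the
  field can be differentiated and integrated on all of \<open>W\<close>.\<close>

definition R :: "'b \<times> real \<Rightarrow> real" where
  "R x = (norm x)\<^sup>2 + \<eta>\<^sup>2"

text \<open>The quadratic form that vanishes on the boundary of the cone; in the half-space
  \<open>snd x > 0\<close> it is positive exactly inside the cone.\<close>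

definition P :: "'b \<times> real \<Rightarrow> real" where
  "P x = (snd x)\<^sup>2 - lam\<^sup>2 * (norm (fst x))\<^sup>2"

definition gradP :: "'b \<times> real \<Rightarrow> 'b \<times> real" where
  "gradP x = (- (2 * lam\<^sup>2) *\<^sub>R fst x, 2 * snd x)"

text \<open>The components \<open>A e x\<close> of a smooth vector field whose radial part vanishes outside the cone
  \<open>P > 0\<close>; its divergence is at most \<open>- 1 / R\<close> in the cone, and its flux out of the boundary is at
  least the trace of \<open>1 / sqrt R\<close>. The function \<open>E e\<close> is the derivative of \<open>A e\<close> in direction \<open>e\<close>.\<close>

definition A :: "'b \<times> real \<Rightarrow> 'b \<times> real \<Rightarrow> real" where
  "A e x = - (hardy_const * ((max 0 (P x))\<^sup>2 / (R x) ^ 3 * (x \<bullet> e))) - (1 / sqrt (R x) + 2 * snd x / R x) * snd e"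

definition E :: "'b \<times> real \<Rightarrow> 'b \<times> real \<Rightarrow> real" where
  "E e x = - (hardy_const * ((2 * max 0 (P x) * (gradP x \<bullet> e) * (x \<bullet> e) + (max 0 (P x))\<^sup>2 * (e \<bullet> e)) / (R x) ^ 3
      - 6 * (max 0 (P x))\<^sup>2 * (x \<bullet> e)\<^sup>2 / (R x) ^ 4))
    - (- (x \<bullet> e) / (R x * sqrt (R x)) + (2 * snd e / R x - 4 * snd x * (x \<bullet> e) / (R x)\<^sup>2)) * snd e"

lemma R_pos: "0 < R x"
  using \<eta> by (simp add: R_def add_nonneg_pos)

lemma A_derivative_0: "((\<lambda>t. A e (x + t *\<^sub>R e)) has_real_derivative E e x) (at 0)"
proof -
  have R: "R (x + t *\<^sub>R e) = R x + 2 * t * (x \<bullet> e) + t\<^sup>2 * (e \<bullet> e)" for t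
    unfolding R_def power2_norm_eq_inner inner_add_left inner_add_right
    by (simp add: inner_commute power2_eq_square algebra_simps)
  have dR: "((\<lambda>t. R (x + t *\<^sub>R e)) has_real_derivative 2 * (x \<bullet> e)) (at 0)"
    unfolding R by (auto intro!: derivative_eq_intros)
  have P: "P (x + t *\<^sub>R e) = P x + t * (gradP x \<bullet> e) + t\<^sup>2 * ((snd e)\<^sup>2 - lam\<^sup>2 * (fst e \<bullet> fst e))" for t
    unfolding P_def power2_norm_eq_inner
    by (simp add: gradP_def inner_prod_def inner_add_left inner_add_right inner_commute power2_eq_square algebra_simps)
  have dP: "((\<lambda>t. P (x + t *\<^sub>R e)) has_real_derivative gradP x \<bullet> e) (at 0)"
    unfolding P by (auto intro!: derivative_eq_intros)
  have dQ: "((\<lambda>t. (max 0 (P (x + t *\<^sub>R e)))\<^sup>2) has_real_derivative 2 * max 0 (P x) * (gradP x \<bullet> e)) (at 0)"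
    using DERIV_chain2[OF DERIV_pos_part_square dP] by simp
  have dX: "((\<lambda>t. (x + t *\<^sub>R e) \<bullet> e) has_real_derivative e \<bullet> e) (at 0)"
    unfolding inner_add_left by (auto intro!: derivative_eq_intros)
  have dS: "((\<lambda>t. snd (x + t *\<^sub>R e)) has_real_derivative snd e) (at 0)"
    by (auto intro!: derivative_eq_intros)
  note Rx = R_pos[of x]
  define q where "q = max 0 (P x)"
  have d1: "((\<lambda>t. (max 0 (P (x + t *\<^sub>R e)))\<^sup>2 / (R (x + t *\<^sub>R e)) ^ 3 * ((x + t *\<^sub>R e) \<bullet> e)) has_real_derivative
      (2 * q * (gradP x \<bullet> e) * (x \<bullet> e) + q\<^sup>2 * (e \<bullet> e)) / (R x) ^ 3 - 6 * q\<^sup>2 * (x \<bullet> e)\<^sup>2 / (R x) ^ 4) (at 0)"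
  proof -
    have "((\<lambda>t. (max 0 (P (x + t *\<^sub>R e)))\<^sup>2 / (R (x + t *\<^sub>R e)) ^ 3 * ((x + t *\<^sub>R e) \<bullet> e)) has_real_derivative
      ((2 * q * (gradP x \<bullet> e) * (R x) ^ 3 - q\<^sup>2 * (3 * (R x)\<^sup>2 * (2 * (x \<bullet> e)))) / ((R x) ^ 3 * (R x) ^ 3)) * (x \<bullet> e) + q\<^sup>2 / (R x) ^ 3 * (e \<bullet> e)) (at 0)"
    proof -
      have nz: "(R (x + 0 *\<^sub>R e)) ^ 3 \<noteq> 0" using Rx by simp
      show ?thesis
        by (rule DERIV_cong[OF DERIV_mult[OF DERIV_divide[OF dQ DERIV_power[OF dR, of 3] nz] dX]])
          (simp add: q_def mult_ac)
    qed
    moreover have "((2 * q * (gradP x \<bullet> e) * (R x) ^ 3 - q\<^sup>2 * (3 * (R x)\<^sup>2 * (2 * (x \<bullet> e)))) / ((R x) ^ 3 * (R x) ^ 3)) * (x \<bullet> e) + q\<^sup>2 / (R x) ^ 3 * (e \<bullet> e)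
        = (2 * q * (gradP x \<bullet> e) * (x \<bullet> e) + q\<^sup>2 * (e \<bullet> e)) / (R x) ^ 3 - 6 * q\<^sup>2 * (x \<bullet> e)\<^sup>2 / (R x) ^ 4"
    proof -
      have frac: "(a * (R x) ^ 3 - b * (R x)\<^sup>2) / ((R x) ^ 3 * (R x) ^ 3) = a / (R x) ^ 3 - b / (R x) ^ 4" for a b
        using Rx by (simp add: field_simps eval_nat_numeral)
      have "(2 * q * (gradP x \<bullet> e) * (R x) ^ 3 - q\<^sup>2 * (3 * (R x)\<^sup>2 * (2 * (x \<bullet> e)))) / ((R x) ^ 3 * (R x) ^ 3) =
          2 * q * (gradP x \<bullet> e) / (R x) ^ 3 - 6 * q\<^sup>2 * (x \<bullet> e) / (R x) ^ 4"
        using frac[of "2 * q * (gradP x \<bullet> e)" "6 * q\<^sup>2 * (x \<bullet> e)"] by (simp add: mult_ac)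
      then show ?thesis by (simp only:) (simp add: add_divide_distrib power2_eq_square[of "x \<bullet> e"] algebra_simps)
    qed
    ultimately show ?thesis by simp
  qed
  have d2: "((\<lambda>t. 1 / sqrt (R (x + t *\<^sub>R e))) has_real_derivative - (x \<bullet> e) / (R x * sqrt (R x))) (at 0)"
  proof -
    have ds: "((\<lambda>t. sqrt (R (x + t *\<^sub>R e))) has_real_derivative (inverse (sqrt (R x)) / 2) * (2 * (x \<bullet> e))) (at 0)"
      using DERIV_chain2[OF DERIV_real_sqrt dR] Rx by simp
    then have "((\<lambda>t. inverse (sqrt (R (x + t *\<^sub>R e)))) has_real_derivative
        - (inverse (sqrt (R x)) * ((inverse (sqrt (R x)) / 2) * (2 * (x \<bullet> e))) * inverse (sqrt (R x)))) (at 0)"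
      using DERIV_inverse'[OF ds] Rx by simp
    moreover have "- (inverse (sqrt (R x)) * ((inverse (sqrt (R x)) / 2) * (2 * (x \<bullet> e))) * inverse (sqrt (R x))) = - (x \<bullet> e) / (R x * sqrt (R x))"
      using Rx by (simp add: field_simps)
    ultimately show ?thesis using Rx by (simp add: inverse_eq_divide)
  qed
  have d3: "((\<lambda>t. 2 * snd (x + t *\<^sub>R e) / R (x + t *\<^sub>R e)) has_real_derivative
      2 * snd e / R x - 4 * snd x * (x \<bullet> e) / (R x)\<^sup>2) (at 0)"
  proof -
    have "((\<lambda>t. 2 * snd (x + t *\<^sub>R e) / R (x + t *\<^sub>R e)) has_real_derivative
        (2 * snd e * R x - 2 * snd x * (2 * (x \<bullet> e))) / (R x * R x)) (at 0)"
      using Rx by (auto intro!: derivative_eq_intros dR dS)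
    moreover have "(2 * snd e * R x - 2 * snd x * (2 * (x \<bullet> e))) / (R x * R x) = 2 * snd e / R x - 4 * snd x * (x \<bullet> e) / (R x)\<^sup>2"
      using Rx by (simp add: field_simps power2_eq_square)
    ultimately show ?thesis by simp
  qed
  show ?thesis
    unfolding A_def E_def q_def[symmetric]
    by (intro DERIV_diff DERIV_minus DERIV_cmult DERIV_cmult_right DERIV_add d1 d2 d3)
qed

lemma A_derivative: "((\<lambda>t. A e (x + t *\<^sub>R e)) has_real_derivative E e (x + t *\<^sub>R e)) (at t)"
proof -
  have "((\<lambda>s. A e (x + (s + t) *\<^sub>R e)) has_real_derivative E e (x + t *\<^sub>R e)) (at 0)"
    using A_derivative_0[of e "x + t *\<^sub>R e"] by (simp add: algebra_simps)
  then show ?thesis using DERIV_shift[of "\<lambda>t. A e (x + t *\<^sub>R e)" "E e (x + t *\<^sub>R e)" 0 t] by simp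
qed

text \<open>Backward quotients arise when a forward difference of \<open>F\<^sup>2\<close> is moved
  to \<open>A\<close> by a translation.\<close>

lemma A_quotient_tendsto: "((\<lambda>h. (A e (x - h *\<^sub>R e) - A e x) / h) \<longlongrightarrow> - E e x) (at_right 0)"
proof -
  have "((\<lambda>t. A e (x + t *\<^sub>R e)) has_real_derivative E e x) (at (- 0))" using A_derivative_0 by simp
  then have "((\<lambda>h. A e (x + (- h) *\<^sub>R e)) has_real_derivative - E e x) (at 0)"
    using DERIV_mirror[of "\<lambda>t. A e (x + t *\<^sub>R e)" "E e x" 0] by simp
  then have "((\<lambda>h. (A e (x - h *\<^sub>R e) - A e x) / h) \<longlongrightarrow> - E e x) (at 0)"
    by (simp add: DERIV_def)
  then show ?thesis by (rule filterlim_mono[OF _ order_refl at_le]) simp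
qed

text \<open>The mean value theorem bounds the quotients by the continuous function \<open>E\<close>,
  uniformly in the step; this is the domination for the limits below.\<close>

lemma A_quotient_eq:
  assumes "0 < h"
  obtains s where "0 < s" "s < h" "(A e (x - h *\<^sub>R e) - A e x) / h = - E e (x - s *\<^sub>R e)"
proof -
  have "\<exists>z>- h. z < 0 \<and> A e (x + 0 *\<^sub>R e) - A e (x + (- h) *\<^sub>R e) = (0 - (- h)) * E e (x + z *\<^sub>R e)"
    using assms A_derivative by (intro MVT2) auto
  then obtain z where z: "- h < z" "z < 0" "A e x - A e (x - h *\<^sub>R e) = h * E e (x + z *\<^sub>R e)" by auto
  show thesis
    using z assms by (intro that[of "- z"]) (auto simp: field_simps)
qed

lemma R_continuous: "continuous_on X R"
  unfolding R_def by (intro continuous_intros)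

lemma P_continuous: "continuous_on X P"
  unfolding P_def by (intro continuous_intros)

lemma A_continuous: "continuous_on X (A e)"
  unfolding A_def using R_pos by (intro continuous_intros R_continuous P_continuous) (auto simp: less_imp_neq[symmetric] less_imp_le not_le)

lemma E_continuous: "continuous_on X (E e)"
  unfolding E_def gradP_def using R_pos by (intro continuous_intros R_continuous P_continuous) (auto simp: less_imp_neq[symmetric])

lemma A_measurable: "A e \<in> borel_measurable borel"
  by (rule borel_measurable_continuous_onI[OF A_continuous])

lemma E_measurable: "E e \<in> borel_measurable borel"
  by (rule borel_measurable_continuous_onI[OF E_continuous])

lemma bounded_on_ball:
  fixes g :: "'b \<times> real \<Rightarrow> real"
  assumes "\<And>X. continuous_on X g"
  obtains C where "0 \<le> C" "\<And>x. norm x \<le> r \<Longrightarrow> \<bar>g x\<bar> \<le> C"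
proof -
  have "bounded (g ` cball 0 r)"
    by (intro compact_imp_bounded compact_continuous_image assms) simp
  then obtain C where "0 < C" "\<And>x. norm x \<le> r \<Longrightarrow> \<bar>g x\<bar> \<le> C" unfolding bounded_pos by auto
  then show thesis by (intro that[of C]) auto
qed

lemma norm_le_sqrt_R: "norm x \<le> sqrt (R x)" "\<eta> \<le> sqrt (R x)"
  using \<eta> by (auto simp: R_def intro!: real_le_rsqrt)

lemma pos_part_P_le: "max 0 (P x) \<le> R x"
proof -
  have "P x \<le> (snd x)\<^sup>2" by (simp add: P_def)
  also have "\<dots> \<le> (norm x)\<^sup>2" using norm_snd_le[of "snd x" "fst x"] by (simp add: abs_le_square_iff[symmetric])
  also have "\<dots> \<le> R x" by (simp add: R_def)
  finally show ?thesis using R_pos[of x] by simp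
qed

text \<open>The numbers \<open>A e x\<close> are minus the coordinates of
  \<open>V = a x + w (0, 1)\<close>. With \<open>P \<le> R\<close> and
  \<open>|x| \<le> sqrt R\<close>, the radial part has norm at most
  \<open>hardy_const / sqrt R\<close> and the vertical part at most
  \<open>3 / sqrt R\<close>.\<close>

lemma sum_A_square_le: "(\<Sum>e\<in>Basis. (A e x)\<^sup>2) \<le> (hardy_const + 3)\<^sup>2 / R x"
proof -
  define s where "s = sqrt (R x)"
  have s: "0 < s" "R x = s\<^sup>2" "norm x \<le> s" using R_pos[of x] norm_le_sqrt_R[of x] by (auto simp: s_def)
  define a w where "a = hardy_const * ((max 0 (P x))\<^sup>2 / (R x) ^ 3)" and "w = 1 / s + 2 * snd x / R x"
  define V where "V = a *\<^sub>R x + w *\<^sub>R (0, 1)"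
  have a: "0 \<le> a" using R_pos[of x] by (simp add: a_def hardy_const_def)
  have vert: "(0 :: 'b, b) \<bullet> e = b * snd e" for b :: real and e :: "'b \<times> real"
    by (simp add: inner_prod_def)
  have "A e x = - (V \<bullet> e)" for e
    by (simp add: A_def V_def a_def w_def s_def inner_add_left vert algebra_simps)
  then have "(\<Sum>e\<in>Basis. (A e x)\<^sup>2) = V \<bullet> V"
    by (simp add: euclidean_inner[of V V] power2_eq_square)
  also have "\<dots> = (norm V)\<^sup>2" by (simp add: power2_norm_eq_inner)
  also have "\<dots> \<le> ((hardy_const + 3) / s)\<^sup>2"
  proof (rule power_mono)
    have "norm V \<le> a * norm x + \<bar>w\<bar>"
      unfolding V_def using norm_triangle_ineq[of "a *\<^sub>R x" "w *\<^sub>R (0, 1)"] a by (simp add: norm_Pair)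
    also have "a * norm x \<le> hardy_const * ((R x)\<^sup>2 / (R x) ^ 3) * s"
      unfolding a_def using pos_part_P_le[of x] R_pos[of x] s
      by (intro mult_mono mult_left_mono divide_right_mono power_mono) (auto simp: hardy_const_def)
    also have "hardy_const * ((R x)\<^sup>2 / (R x) ^ 3) * s = hardy_const / s"
      unfolding s(2) using s(1) by (simp add: power2_eq_square power3_eq_cube)
    also have "\<bar>w\<bar> \<le> 1 / s + 2 * s / R x"
    proof -
      have "\<bar>2 * snd x / R x\<bar> \<le> 2 * s / R x"
        using norm_snd_le[of "snd x" "fst x"] s R_pos[of x] by (auto simp: abs_divide abs_mult intro!: divide_right_mono)
      then show ?thesis unfolding w_def using s(1) by (intro order_trans[OF abs_triangle_ineq]) auto
    qed
    also have "1 / s + 2 * s / R x = 3 / s" unfolding s(2) using s(1) by (simp add: power2_eq_square)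
    finally show "norm V \<le> (hardy_const + 3) / s" by (simp add: add_divide_distrib)
  qed simp
  finally show ?thesis by (simp add: power_divide s(2))
qed

lemma sum_E:
  "(\<Sum>e\<in>Basis. E e x) = - (hardy_const * ((4 * (max 0 (P x))\<^sup>2 + real DIM('b \<times> real) * (max 0 (P x))\<^sup>2) / (R x) ^ 3
      - 6 * (max 0 (P x))\<^sup>2 * (norm x)\<^sup>2 / (R x) ^ 4))
    - (- snd x / (R x * sqrt (R x)) + (2 / R x - 4 * (snd x)\<^sup>2 / (R x)\<^sup>2))"
proof -
  define q where "q = max 0 (P x)"
  have snd: "snd e = (0, 1) \<bullet> e" for e :: "'b \<times> real" by (simp add: inner_prod_def)
  have in1: "(\<Sum>e\<in>Basis. (y \<bullet> e) * (z \<bullet> e)) = y \<bullet> z" for y z :: "'b \<times> real"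
    by (rule euclidean_inner[symmetric])
  \<comment> \<open>Euler's relation for the quadratic form \<open>P\<close>; it yields the
    coefficient four of the squared positive part.\<close>
  have s1: "(\<Sum>e\<in>Basis. (gradP x \<bullet> e) * (x \<bullet> e)) = 2 * P x"
    unfolding in1 by (simp add: gradP_def P_def inner_prod_def dot_square_norm power2_eq_square algebra_simps)
  have s2: "(\<Sum>e\<in>(Basis :: ('b \<times> real) set). e \<bullet> e) = real DIM('b \<times> real)"
    using sum.cong[OF refl, of "Basis :: ('b \<times> real) set" "\<lambda>e. e \<bullet> e" "\<lambda>e. 1"] by (simp add: inner_Basis)
  have s3: "(\<Sum>e\<in>Basis. (x \<bullet> e)\<^sup>2) = (norm x)\<^sup>2"
    using in1[of x x] by (simp add: power2_eq_square[symmetric] power2_norm_eq_inner)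
  have s4: "(\<Sum>e\<in>Basis. (x \<bullet> e) * snd e) = snd x"
    unfolding snd in1 by (simp add: inner_prod_def)
  have s5: "(\<Sum>e\<in>(Basis :: ('b \<times> real) set). snd e * snd e) = 1"
    unfolding snd in1 by (simp add: inner_prod_def)
  have "E e x = (- (hardy_const * 2 * q / (R x) ^ 3)) * ((gradP x \<bullet> e) * (x \<bullet> e)) + (- (hardy_const * q\<^sup>2 / (R x) ^ 3)) * (e \<bullet> e)
      + (hardy_const * 6 * q\<^sup>2 / (R x) ^ 4) * (x \<bullet> e)\<^sup>2 + (1 / (R x * sqrt (R x)) + 4 * snd x / (R x)\<^sup>2) * ((x \<bullet> e) * snd e)
      + (- (2 / R x)) * (snd e * snd e)" for e
    unfolding E_def q_def[symmetric] by (simp add: add_divide_distrib algebra_simps)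
  then have "(\<Sum>e\<in>Basis. E e x) = (- (hardy_const * 2 * q / (R x) ^ 3)) * (2 * P x) + (- (hardy_const * q\<^sup>2 / (R x) ^ 3)) * real DIM('b \<times> real)
      + (hardy_const * 6 * q\<^sup>2 / (R x) ^ 4) * (norm x)\<^sup>2 + (1 / (R x * sqrt (R x)) + 4 * snd x / (R x)\<^sup>2) * snd x
      + (- (2 / R x)) * 1"
    by (simp only: sum.distrib sum_distrib_left[symmetric] s1 s2 s3 s4 s5)
  moreover have "(- (hardy_const * 2 * q / (R x) ^ 3)) * (2 * P x) = - (hardy_const * 4 * q\<^sup>2 / (R x) ^ 3)"
  proof -
    have "(- (hardy_const * 2 * q / (R x) ^ 3)) * (2 * P x) = - (hardy_const * 4 * (q * P x) / (R x) ^ 3)" by (simp add: mult_ac)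
    also have "q * P x = q\<^sup>2" by (simp add: q_def max_def power2_eq_square)
    finally show ?thesis .
  qed
  ultimately show ?thesis
    unfolding q_def[symmetric] by (simp only:) (simp add: add_divide_distrib power2_eq_square[of "snd x"] algebra_simps)
qed

text \<open>With \<open>z = snd x / sqrt R\<close> in \<open>(0, 1]\<close> and \<open>q\<close> the
  positive part of \<open>P\<close>, the negative divergence times \<open>R\<close> is at least
  \<open>hardy_const * (q / R)\<^sup>2 + 2 - z - 4 * z\<^sup>2\<close>. The polynomial comes from
  the vertical part and is large near the boundary, where \<open>z\<close> is small. The radial
  part, whose coefficient \<open>4 + n - 6\<close> is at least one for \<open>n \<ge> 3\<close>,
  compensates where \<open>z\<close> is large.\<close>

lemma divergence_le:
  assumes lam6: "lam \<le> 1 / 6" and dim: "2 \<le> DIM('b)" and x: "x \<in> W"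
  shows "1 / R x \<le> - (\<Sum>e\<in>Basis. E e x)"
proof -
  define s q z where "s = sqrt (R x)" and "q = max 0 (P x)" and "z = snd x / s"
  have s: "0 < s" "R x = s\<^sup>2" "norm x \<le> s" using R_pos[of x] norm_le_sqrt_R[of x] by (auto simp: s_def)
  have "0 \<le> lam * norm (fst x)" using lam by simp
  then have pos: "0 < snd x" using x by (simp add: W_def)
  have "snd x \<le> s" using norm_snd_le[of "snd x" "fst x"] pos s by simp
  then have z: "0 < z" "z \<le> 1" "snd x = z * s" using pos s by (auto simp: z_def)
  have "0 \<le> real DIM('b) - 2" using dim by simp
  have n: "3 \<le> real DIM('b \<times> real)" using dim by simp
  have "6 * q\<^sup>2 * (norm x)\<^sup>2 / (R x) ^ 4 \<le> 6 * q\<^sup>2 * R x / (R x) ^ 4"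
    using R_pos[of x] by (intro divide_right_mono mult_left_mono) (auto simp: R_def)
  also have "\<dots> = 6 * q\<^sup>2 / (R x) ^ 3" using R_pos[of x] by (simp add: power4_eq_xxxx power3_eq_cube)
  finally have "(4 * q\<^sup>2 + real DIM('b \<times> real) * q\<^sup>2) / (R x) ^ 3 - 6 * q\<^sup>2 * (norm x)\<^sup>2 / (R x) ^ 4 \<ge>
      (4 * q\<^sup>2 + real DIM('b \<times> real) * q\<^sup>2) / (R x) ^ 3 - 6 * q\<^sup>2 / (R x) ^ 3" by simp
  also have "(4 * q\<^sup>2 + real DIM('b \<times> real) * q\<^sup>2) / (R x) ^ 3 - 6 * q\<^sup>2 / (R x) ^ 3 = (real DIM('b \<times> real) - 2) * q\<^sup>2 / (R x) ^ 3"
    by (simp add: diff_divide_distrib[symmetric] algebra_simps)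
  also have "\<dots> \<ge> 1 * q\<^sup>2 / (R x) ^ 3"
    using R_pos[of x] n by (intro divide_right_mono mult_right_mono) auto
  finally have first: "q\<^sup>2 / (R x) ^ 3 \<le> (4 * q\<^sup>2 + real DIM('b \<times> real) * q\<^sup>2) / (R x) ^ 3 - 6 * q\<^sup>2 * (norm x)\<^sup>2 / (R x) ^ 4" by simp
  have "hardy_const * (q\<^sup>2 / (R x) ^ 3) \<le> hardy_const * ((4 * q\<^sup>2 + real DIM('b \<times> real) * q\<^sup>2) / (R x) ^ 3 - 6 * q\<^sup>2 * (norm x)\<^sup>2 / (R x) ^ 4)"
    by (intro mult_left_mono first) (simp add: hardy_const_def)
  then have "hardy_const * (q\<^sup>2 / (R x) ^ 3) + (- snd x / (R x * s) + (2 / R x - 4 * (snd x)\<^sup>2 / (R x)\<^sup>2)) \<le> - (\<Sum>e\<in>Basis. E e x)"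
    unfolding sum_E q_def[symmetric] s_def[symmetric] by simp
  moreover have "hardy_const * (q\<^sup>2 / (R x) ^ 3) + (- snd x / (R x * s) + (2 / R x - 4 * (snd x)\<^sup>2 / (R x)\<^sup>2))
      = (hardy_const * (q / R x)\<^sup>2 + 2 - z - 4 * z\<^sup>2) / R x"
    unfolding z(3) s(2) using s(1) by (simp add: field_simps power2_eq_square power3_eq_cube)
  moreover have "1 \<le> hardy_const * (q / R x)\<^sup>2 + 2 - z - 4 * z\<^sup>2"
  \<comment> \<open>For \<open>z \<le> 1 / 4\<close> the polynomial alone is at least
    \<open>3 / 2\<close>. Otherwise
    \<open>z\<^sup>2 - lam\<^sup>2 \<ge> 1 / 16 - 1 / 36 \<ge> 1 / 32\<close>, so the radial term is
    at least \<open>4096 / 32\<^sup>2 = 4\<close>, which offsets the worst value \<open>-3\<close>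
    of the polynomial at \<open>z = 1\<close>.\<close>
  proof (cases "z \<le> 1 / 4")
    case True
    then have "z\<^sup>2 \<le> (1 / 4)\<^sup>2" using z by (intro power_mono) auto
    moreover have "0 \<le> hardy_const * (q / R x)\<^sup>2" by (simp add: hardy_const_def)
    ultimately show ?thesis using True by (simp add: power2_eq_square)
  next
    case False
    have "(1 / 4)\<^sup>2 \<le> z\<^sup>2" using False by (intro power_mono) auto
    moreover have "lam\<^sup>2 \<le> (1 / 6)\<^sup>2" using lam lam6 by (intro power_mono) auto
    ultimately have num: "1 / 32 \<le> z\<^sup>2 - lam\<^sup>2" by (simp add: power2_eq_square)
    have "norm (fst x) \<le> s" using norm_fst_le[of "fst x" "snd x"] s by simp
    then have "lam\<^sup>2 * (norm (fst x))\<^sup>2 \<le> lam\<^sup>2 * s\<^sup>2" by (intro mult_left_mono power_mono) auto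
    then have "(z\<^sup>2 - lam\<^sup>2) * s\<^sup>2 \<le> q" unfolding q_def P_def z(3) by (simp add: power_mult_distrib algebra_simps)
    then have "z\<^sup>2 - lam\<^sup>2 \<le> q / R x" unfolding s(2) using s(1) by (simp add: pos_le_divide_eq)
    with num have "1 / 32 \<le> q / R x" by (rule order_trans)
    then have "(1 / 32)\<^sup>2 \<le> (q / R x)\<^sup>2" by (rule power_mono) simp
    then have "4 \<le> hardy_const * (q / R x)\<^sup>2" by (simp add: hardy_const_def power2_eq_square)
    moreover have "z\<^sup>2 \<le> 1" using z by (simp add: power_le_one)
    ultimately show ?thesis using z by linarith
  qed
  then have "1 / R x \<le> (hardy_const * (q / R x)\<^sup>2 + 2 - z - 4 * z\<^sup>2) / R x"
    using R_pos[of x] by (intro divide_right_mono) auto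
  ultimately show ?thesis by simp
qed

section \<open>Integration by parts with difference quotients\<close>

definition J :: "'b \<times> real \<Rightarrow> real \<Rightarrow> real" where
  "J e h = (\<integral>x. indicator W x * (A e x * (((F (x + h *\<^sub>R e))\<^sup>2 - (F x)\<^sup>2) / h)) \<partial>lborel)"

lemma F_square_bound: "(F x)\<^sup>2 \<le> M\<^sup>2"
  using bound[of x] M_nonneg by (simp add: abs_le_square_iff[symmetric])

lemma F_shift_measurable: "(\<lambda>x. F (x + c)) \<in> borel_measurable borel"
  by (intro borel_measurable_continuous_onI continuous_on_compose2[OF F_continuous[of UNIV]] continuous_intros) auto

lemma A_bound_W: obtains C where "0 \<le> C" "\<And>x. x \<in> W \<Longrightarrow> \<bar>A e x\<bar> \<le> C"
proof -
  obtain C where C: "0 \<le> C" "\<And>x. norm x \<le> T / lam + T \<Longrightarrow> \<bar>A e x\<bar> \<le> C"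
    using bounded_on_ball[of "A e" "T / lam + T"] A_continuous by metis
  show thesis using that[of C] C W_norm_le by blast
qed

text \<open>Translating the variable turns the forward difference of \<open>F\<^sup>2\<close> into a
  backward difference of the field. The indicator of \<open>W\<close> is kept under the difference:
  its jump is what produces the boundary term.\<close>

lemma J_shift:
  assumes "0 < h"
  shows J_integrable: "integrable lborel (\<lambda>x. (indicator W (x - h *\<^sub>R e) * A e (x - h *\<^sub>R e) - indicator W x * A e x) / h * (F x)\<^sup>2)"
    and J_eq: "J e h = (\<integral>x. (indicator W (x - h *\<^sub>R e) * A e (x - h *\<^sub>R e) - indicator W x * A e x) / h * (F x)\<^sup>2 \<partial>lborel)"
proof -
  define \<psi> where "\<psi> x = indicator W x * A e x" for x
  obtain C where C: "0 \<le> C" "\<And>x. x \<in> W \<Longrightarrow> \<bar>A e x\<bar> \<le> C" using A_bound_W[of e] by blast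
  have \<psi>m: "\<psi> \<in> borel_measurable borel"
    unfolding \<psi>_def using W_measurable by (intro borel_measurable_times borel_measurable_indicator A_measurable) auto
  have i1: "integrable lborel (\<lambda>x. \<psi> x * (F (x + c))\<^sup>2)" for c
  proof (rule integrable_bounded_support[OF _ bounded_W])
    show "(\<lambda>x. \<psi> x * (F (x + c))\<^sup>2) \<in> borel_measurable borel"
      by (intro borel_measurable_times borel_measurable_power \<psi>m F_shift_measurable)
    show "\<bar>\<psi> x * (F (x + c))\<^sup>2\<bar> \<le> C * M\<^sup>2" if "x \<in> W" for x
      using mult_mono[OF C(2)[OF that] F_square_bound[of "x + c"] C(1)] that by (simp add: \<psi>_def abs_mult)
  qed (simp add: \<psi>_def)
  have m2: "(\<lambda>x. \<psi> (x - h *\<^sub>R e) * (F x)\<^sup>2) \<in> borel_measurable borel"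
  proof (intro borel_measurable_times borel_measurable_power F_measurable)
    have "(\<lambda>x. x - h *\<^sub>R e) \<in> borel_measurable borel" by (intro borel_measurable_continuous_onI continuous_intros)
    then show "(\<lambda>x. \<psi> (x - h *\<^sub>R e)) \<in> borel_measurable borel" using \<psi>m by (rule measurable_compose)
  qed
  have i2: "integrable lborel (\<lambda>x. \<psi> (x - h *\<^sub>R e) * (F x)\<^sup>2)"
  proof (rule integrable_bounded_support[OF m2])
    show "bounded ((\<lambda>x. x + h *\<^sub>R e) ` W)" using bounded_translation[OF bounded_W, of "h *\<^sub>R e"] by (simp add: add.commute)
    have out: "x - h *\<^sub>R e \<notin> W" if "x \<notin> (\<lambda>x. x + h *\<^sub>R e) ` W" for x
      using that by (auto simp: image_iff)
    show "\<psi> (x - h *\<^sub>R e) * (F x)\<^sup>2 = 0" if "x \<notin> (\<lambda>x. x + h *\<^sub>R e) ` W" for x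
      using out[OF that] by (simp add: \<psi>_def)
    show "\<bar>\<psi> (x - h *\<^sub>R e) * (F x)\<^sup>2\<bar> \<le> C * M\<^sup>2" if "x \<in> (\<lambda>x. x + h *\<^sub>R e) ` W" for x
    proof (cases "x - h *\<^sub>R e \<in> W")
      case True
      then show ?thesis
        using mult_mono[OF C(2)[OF True] F_square_bound[of x] C(1)] by (simp add: \<psi>_def abs_mult)
    next
      case False
      then show ?thesis using C(1) by (simp add: \<psi>_def)
    qed
  qed
  have "J e h = (\<integral>x. 1 / h * (\<psi> x * (F (x + h *\<^sub>R e))\<^sup>2 - \<psi> x * (F (x + 0))\<^sup>2) \<partial>lborel)"
    unfolding J_def \<psi>_def by (intro Bochner_Integration.integral_cong) (auto simp: field_simps)
  also have "\<dots> = 1 / h * ((\<integral>x. \<psi> x * (F (x + h *\<^sub>R e))\<^sup>2 \<partial>lborel) - (\<integral>x. \<psi> x * (F (x + 0))\<^sup>2 \<partial>lborel))"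
    unfolding integral_mult_right_zero Bochner_Integration.integral_diff[OF i1 i1] ..
  also have "(\<integral>x. \<psi> x * (F (x + h *\<^sub>R e))\<^sup>2 \<partial>lborel) = (\<integral>x. \<psi> (x - h *\<^sub>R e) * (F x)\<^sup>2 \<partial>lborel)"
    using integral_translate[OF m2, of "h *\<^sub>R e"] by simp
  also have "1 / h * ((\<integral>x. \<psi> (x - h *\<^sub>R e) * (F x)\<^sup>2 \<partial>lborel) - (\<integral>x. \<psi> x * (F (x + 0))\<^sup>2 \<partial>lborel))
      = (\<integral>x. 1 / h * (\<psi> (x - h *\<^sub>R e) * (F x)\<^sup>2 - \<psi> x * (F (x + 0))\<^sup>2) \<partial>lborel)"
    unfolding integral_mult_right_zero Bochner_Integration.integral_diff[OF i2 i1] ..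
  also have "\<dots> = (\<integral>x. (\<psi> (x - h *\<^sub>R e) - \<psi> x) / h * (F x)\<^sup>2 \<partial>lborel)"
    by (intro Bochner_Integration.integral_cong) (auto simp: algebra_simps diff_divide_distrib)
  finally show "J e h = (\<integral>x. (indicator W (x - h *\<^sub>R e) * A e (x - h *\<^sub>R e) - indicator W x * A e x) / h * (F x)\<^sup>2 \<partial>lborel)"
    unfolding \<psi>_def .
  have "integrable lborel (\<lambda>x. 1 / h * (\<psi> (x - h *\<^sub>R e) * (F x)\<^sup>2 - \<psi> x * (F (x + 0))\<^sup>2))"
    by (intro integrable_mult_right Bochner_Integration.integrable_diff i1 i2)
  also have "(\<lambda>x. 1 / h * (\<psi> (x - h *\<^sub>R e) * (F x)\<^sup>2 - \<psi> x * (F (x + 0))\<^sup>2)) = (\<lambda>x. (\<psi> (x - h *\<^sub>R e) - \<psi> x) / h * (F x)\<^sup>2)"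
    by (auto simp: algebra_simps diff_divide_distrib)
  finally show "integrable lborel (\<lambda>x. (indicator W (x - h *\<^sub>R e) * A e (x - h *\<^sub>R e) - indicator W x * A e x) / h * (F x)\<^sup>2)"
    unfolding \<psi>_def .
qed

lemma A_quotient_measurable: "(\<lambda>x. (A e (x - h *\<^sub>R e) - A e x) / h) \<in> borel_measurable borel"
proof -
  have "continuous_on UNIV (\<lambda>x. A e (x - h *\<^sub>R e))"
    by (intro continuous_on_compose2[OF A_continuous[of UNIV]] continuous_intros) auto
  then show ?thesis
    by (intro borel_measurable_divide borel_measurable_diff A_measurable) (auto intro: borel_measurable_continuous_onI)
qed

lemma A_quotient_bound:
  assumes e: "e \<in> Basis"
  obtains C where "0 \<le> C" "\<And>h x. 0 < h \<Longrightarrow> h < 1 \<Longrightarrow> norm x \<le> r \<Longrightarrow> \<bar>(A e (x - h *\<^sub>R e) - A e x) / h\<bar> \<le> C"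
proof -
  obtain C where C: "0 \<le> C" "\<And>x. norm x \<le> r + 1 \<Longrightarrow> \<bar>E e x\<bar> \<le> C"
    using bounded_on_ball[of "E e" "r + 1"] E_continuous by metis
  have "\<bar>(A e (x - h *\<^sub>R e) - A e x) / h\<bar> \<le> C" if h: "0 < h" "h < 1" and x: "norm x \<le> r" for h x
  proof -
    obtain s where s: "0 < s" "s < h" "(A e (x - h *\<^sub>R e) - A e x) / h = - E e (x - s *\<^sub>R e)"
      using A_quotient_eq[OF h(1)] .
    have "norm (x - s *\<^sub>R e) \<le> norm x + norm (s *\<^sub>R e)" by (rule norm_triangle_ineq4)
    also have "\<dots> \<le> r + 1" using s h x e by simp
    finally show ?thesis unfolding s(3) using C(2) by simp
  qed
  then show thesis using that C(1) by blast
qed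

text \<open>For a horizontal direction \<open>A e\<close> and \<open>E e\<close> contain only the
  cut-off radial part, which vanishes in the slab \<open>H\<close> outside the cone. So
  \<open>W\<close> may be replaced by \<open>H\<close>, which horizontal translations preserve, and
  there is no boundary term.\<close>

lemma J_tendsto_horizontal:
  assumes e: "e \<in> Basis" "snd e = 0"
  shows "(J e \<longlongrightarrow> - (\<integral>x. indicator W x * (E e x * (F x)\<^sup>2) \<partial>lborel)) (at_right 0)"
proof -
  define H where "H = {x :: 'b \<times> real. 0 < snd x \<and> snd x < T}"
  have WH: "W \<subseteq> H"
  proof
    fix x assume x: "x \<in> W"
    have "0 \<le> lam * norm (fst x)" using lam by simp
    then show "x \<in> H" using x by (auto simp: W_def H_def)
  qed
  have "H = {x. 0 < snd x} \<inter> {x. snd x < T}" by (auto simp: H_def)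
  then have Hm: "H \<in> sets borel" by (simp only:) (intro sets.Int borel_open open_Collect_less continuous_intros)
  have P0: "max 0 (P x) = 0" if "x \<in> H" "x \<notin> W" for x
  proof -
    have "snd x \<le> lam * norm (fst x)" "0 < snd x" using that by (auto simp: H_def W_def)
    then have "(snd x)\<^sup>2 \<le> (lam * norm (fst x))\<^sup>2" by (intro power_mono) auto
    then show ?thesis by (simp add: P_def power_mult_distrib)
  qed
  have A0: "A e x = 0" "E e x = 0" if "x \<in> H" "x \<notin> W" for x
    using P0[OF that] e(2) by (simp_all add: A_def E_def)
  have \<psi>: "indicator W x * A e x = A e x" if "x \<in> H" for x
    using A0(1)[OF that] by (cases "x \<in> W") auto
  let ?s = "\<lambda>h x. indicator H x * ((A e (x - h *\<^sub>R e) - A e x) / h) * (F x)\<^sup>2"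
  let ?r = "2 * T"
  obtain C where C: "0 \<le> C" "\<And>h x. 0 < h \<Longrightarrow> h < 1 \<Longrightarrow> norm x \<le> ?r \<Longrightarrow> \<bar>(A e (x - h *\<^sub>R e) - A e x) / h\<bar> \<le> C"
    using A_quotient_bound[OF e(1), of ?r] by blast
  \<comment> \<open>In the slab, norm above \<open>2 * T\<close> forces
    \<open>norm (fst x) \<ge> T\<close>. Then \<open>F\<close> vanishes in the cone by
    \<open>far\<close>, and below it because it equals the boundary value over the same base
    point.\<close>
  have Fout: "F x = 0" if "x \<in> H" "?r < norm x" for x
  proof -
    have "norm x \<le> norm (fst x) + norm (snd x)" using norm_Pair_le[of "fst x" "snd x"] by simp
    then have far1: "T \<le> norm (fst x)" using that by (auto simp: H_def)
    show ?thesis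
    proof (cases "lam * norm (fst x) \<le> snd x")
      case True
      then show ?thesis using that(2) T by (intro far) auto
    next
      case False
      then have "F x = boundary_value (fst x)" unfolding boundary_value_def using below[of "snd x" "fst x"] by simp
      then show ?thesis using boundary_value_far[OF far1] by simp
    qed
  qed
  have "((\<lambda>h. \<integral>x. ?s h x \<partial>lborel) \<longlongrightarrow> (\<integral>x. indicator H x * (- E e x) * (F x)\<^sup>2 \<partial>lborel)) (at_right 0)"
  proof (rule dominated_convergence_at_right[where w = "\<lambda>x. indicator (cball 0 ?r) x * (C * M\<^sup>2)"])
    show "?s h \<in> borel_measurable lborel" for h
      using borel_measurable_times[OF borel_measurable_times[OF borel_measurable_indicator[OF Hm] A_quotient_measurable[of e h]] borel_measurable_power[OF F_measurable, of 2]] by simp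
    show "(\<lambda>x. indicator H x * (- E e x) * (F x)\<^sup>2) \<in> borel_measurable lborel"
      using Hm by (intro borel_measurable_times borel_measurable_indicator borel_measurable_power borel_measurable_uminus) (auto simp: F_measurable E_measurable)
    show "integrable lborel (\<lambda>x :: 'b \<times> real. indicator (cball 0 ?r) x * (C * M\<^sup>2))"
      using C by (intro integrable_indicator_times[where M = "C * M\<^sup>2"]) auto
    show "((\<lambda>h. ?s h x) \<longlongrightarrow> indicator H x * (- E e x) * (F x)\<^sup>2) (at_right 0)" for x
      by (intro tendsto_intros A_quotient_tendsto)
    show "\<bar>?s h x\<bar> \<le> indicator (cball 0 ?r) x * (C * M\<^sup>2)" if h: "0 < h" "h < 1" for h x
    proof (cases "x \<in> H \<and> norm x \<le> ?r")
      case True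
      have "\<bar>(A e (x - h *\<^sub>R e) - A e x) / h\<bar> * (F x)\<^sup>2 \<le> C * M\<^sup>2"
        using C(2)[OF h, of x] True F_square_bound C(1) by (intro mult_mono) auto
      then show ?thesis using True by (simp add: abs_mult)
    next
      case False
      then have "?s h x = 0" using Fout[of x] by (cases "x \<in> H") auto
      then show ?thesis using C(1) by (simp only: abs_zero) simp
    qed
  qed
  also have "(\<integral>x. indicator H x * (- E e x) * (F x)\<^sup>2 \<partial>lborel) = (\<integral>x. - (indicator W x * (E e x * (F x)\<^sup>2)) \<partial>lborel)"
  proof (rule Bochner_Integration.integral_cong[OF refl])
    fix x
    show "indicator H x * (- E e x) * (F x)\<^sup>2 = - (indicator W x * (E e x * (F x)\<^sup>2))"
      using A0(2)[of x] WH by (cases "x \<in> H"; cases "x \<in> W") auto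
  qed
  also have "\<dots> = - (\<integral>x. indicator W x * (E e x * (F x)\<^sup>2) \<partial>lborel)" by (rule integral_minus)
  finally have lim: "((\<lambda>h. \<integral>x. ?s h x \<partial>lborel) \<longlongrightarrow> - (\<integral>x. indicator W x * (E e x * (F x)\<^sup>2) \<partial>lborel)) (at_right 0)" .
  have eq: "J e h = (\<integral>x. ?s h x \<partial>lborel)" if "0 < h" for h
    unfolding J_eq[OF that]
  proof (rule Bochner_Integration.integral_cong[OF refl])
    fix x
    have H': "x - h *\<^sub>R e \<in> H \<longleftrightarrow> x \<in> H" using e(2) by (simp add: H_def)
    show "(indicator W (x - h *\<^sub>R e) * A e (x - h *\<^sub>R e) - indicator W x * A e x) / h * (F x)\<^sup>2 = ?s h x"
    proof (cases "x \<in> H")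
      case True
      then show ?thesis unfolding \<psi>[OF True] \<psi>[OF iffD2[OF H' True]] by simp
    next
      case False
      then have "x \<notin> W" "x - h *\<^sub>R e \<notin> W" using H' WH by auto
      then show ?thesis using False by simp
    qed
  qed
  have "\<forall>\<^sub>F h in at_right 0. (\<integral>x. ?s h x \<partial>lborel) = J e h"
    using eventually_at_right_less[of 0] by eventually_elim (simp add: eq)
  then show ?thesis using lim by (rule Lim_transform_eventually[rotated])
qed

section \<open>The flux through the boundary of the cone\<close>

definition \<beta> :: "'b \<Rightarrow> real" where
  "\<beta> y = (boundary_value y)\<^sup>2 / sqrt (R (y, lam * norm y))"

text \<open>On the boundary the radial part vanishes and the field is vertical; as the boundary is a
  graph over \<open>y\<close>, its flux has the vertical component as density with respect to
  \<open>dy\<close>. Only the part \<open>1 / sqrt R\<close> of that component is retained in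
  \<beta>.\<close>

definition flux :: real where
  "flux = (\<integral>y. \<beta> y \<partial>lborel)"

lemma \<beta>_nonneg: "0 \<le> \<beta> y"
  using R_pos[of "(y, lam * norm y)"] by (simp add: \<beta>_def less_imp_le)

lemma \<beta>_measurable: "\<beta> \<in> borel_measurable borel"
proof (rule borel_measurable_continuous_onI)
  show "continuous_on UNIV \<beta>"
    unfolding \<beta>_def using R_pos
    by (intro continuous_intros boundary_value_continuous continuous_on_compose2[OF R_continuous[of UNIV]])
      (auto simp: less_imp_neq[symmetric] not_le intro!: continuous_intros)
qed

lemma \<beta>_far: "y \<notin> ball 0 T \<Longrightarrow> \<beta> y = 0"
  using boundary_value_far[of y] by (simp add: \<beta>_def)

lemma \<beta>_bound: "\<bar>\<beta> y\<bar> \<le> M\<^sup>2 / \<eta>"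
proof -
  have "\<beta> y \<le> M\<^sup>2 / \<eta>"
    unfolding \<beta>_def boundary_value_def
    using F_square_bound norm_le_sqrt_R(2) \<eta> by (intro frac_le) auto
  then show ?thesis using \<beta>_nonneg[of y] by simp
qed

lemma \<beta>_integrable: "integrable lborel \<beta>"
  using \<beta>_measurable \<beta>_far \<beta>_bound by (intro integrable_bounded_support[where K = "ball 0 T" and M = "M\<^sup>2 / \<eta>"]) auto

text \<open>Along a vertical segment of length \<open>h\<close>, \<open>F\<^sup>2\<close> changes by
  at most \<open>2 * M * L * h\<close> and \<open>1 / sqrt R\<close> by at most
  \<open>h / \<eta>\<^sup>2\<close>.\<close>

lemma vertical_lower_bound:
  assumes "lam * norm y \<le> z" "z \<le> lam * norm y + h"
  shows "\<beta> y - (2 * M * L / \<eta> + M\<^sup>2 / \<eta>\<^sup>2) * h \<le> (F (y, z))\<^sup>2 / sqrt (R (y, z))"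
proof -
  let ?x = "(y, z)" and ?p = "(y, lam * norm y)"
  define r r0 where "r = sqrt (R ?x)" and "r0 = sqrt (R ?p)"
  have d: "dist ?x ?p \<le> h" using assms by (simp add: dist_Pair_Pair dist_real_def)
  have h: "0 \<le> h" using assms by simp
  have r: "\<eta> \<le> r" "\<eta> \<le> r0" unfolding r_def r0_def by (rule norm_le_sqrt_R)+
  have "\<bar>r - r0\<bar> \<le> \<bar>norm ?x - norm ?p\<bar>"
    using sqrt_sum_squares_diff_le[of "norm ?x" \<eta> "norm ?p" \<eta>] by (simp add: r_def r0_def R_def)
  also have "\<dots> \<le> dist ?x ?p" unfolding dist_norm by (rule norm_triangle_ineq3)
  finally have rr: "\<bar>r - r0\<bar> \<le> h" using d by simp
  have "\<bar>F ?x - F ?p\<bar> \<le> L * h"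
    using lipschitz_onD[OF lip, of ?x ?p] mult_left_mono[OF d L_nonneg] by (simp add: dist_real_def)
  then have "\<bar>(F ?x - F ?p) * (F ?x + F ?p)\<bar> \<le> (L * h) * (2 * M)"
    unfolding abs_mult using bound[of ?x] bound[of ?p] L_nonneg h by (intro mult_mono) auto
  moreover have "(F ?x - F ?p) * (F ?x + F ?p) = (F ?x)\<^sup>2 - (F ?p)\<^sup>2"
    by (simp add: power2_eq_square algebra_simps)
  ultimately have FF: "(F ?p)\<^sup>2 - (F ?x)\<^sup>2 \<le> 2 * M * L * h" by (simp add: abs_le_iff algebra_simps)
  have "\<beta> y - (F ?x)\<^sup>2 / r = ((F ?p)\<^sup>2 - (F ?x)\<^sup>2) / r + (F ?p)\<^sup>2 * (1 / r0 - 1 / r)"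
    by (simp add: \<beta>_def boundary_value_def r0_def diff_divide_distrib right_diff_distrib)
  also have "\<dots> \<le> 2 * M * L * h / \<eta> + M\<^sup>2 * (h / \<eta>\<^sup>2)"
  proof (rule add_mono)
    have "((F ?p)\<^sup>2 - (F ?x)\<^sup>2) / r \<le> 2 * M * L * h / r"
      using FF r \<eta> by (intro divide_right_mono) auto
    also have "\<dots> \<le> 2 * M * L * h / \<eta>"
      using r \<eta> M_nonneg L_nonneg h by (intro divide_left_mono mult_nonneg_nonneg mult_pos_pos) auto
    finally show "((F ?p)\<^sup>2 - (F ?x)\<^sup>2) / r \<le> 2 * M * L * h / \<eta>" .
    have "1 / r0 - 1 / r = (r - r0) / (r0 * r)" using r \<eta> by (simp add: field_simps)
    also have "\<dots> \<le> h / (r0 * r)" using rr r \<eta> by (intro divide_right_mono) auto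
    also have "\<dots> \<le> h / \<eta>\<^sup>2"
      unfolding power2_eq_square using r \<eta> h by (intro divide_left_mono mult_mono mult_pos_pos) auto
    finally have le: "1 / r0 - 1 / r \<le> h / \<eta>\<^sup>2" .
    have "(F ?p)\<^sup>2 * (1 / r0 - 1 / r) \<le> (F ?p)\<^sup>2 * (h / \<eta>\<^sup>2)" using le by (intro mult_left_mono) auto
    also have "\<dots> \<le> M\<^sup>2 * (h / \<eta>\<^sup>2)" using F_square_bound h by (intro mult_right_mono) auto
    finally show "(F ?p)\<^sup>2 * (1 / r0 - 1 / r) \<le> M\<^sup>2 * (h / \<eta>\<^sup>2)" .
  qed
  also have "\<dots> = (2 * M * L / \<eta> + M\<^sup>2 / \<eta>\<^sup>2) * h" by (simp add: distrib_right)
  finally show ?thesis unfolding r_def by linarith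
qed

text \<open>The points of the open cone that leave it when moved down by \<open>h\<close>.\<close>

definition layer :: "real \<Rightarrow> ('b \<times> real) set" where
  "layer h = {x. lam * norm (fst x) < snd x \<and> snd x \<le> lam * norm (fst x) + h}"

lemma layer_measurable: "layer h \<in> sets borel"
proof -
  have "layer h = {x. lam * norm (fst x) < snd x} \<inter> {x. snd x \<le> lam * norm (fst x) + h}" by (auto simp: layer_def)
  then show ?thesis
    by (simp only:) (intro sets.Int borel_open borel_closed open_Collect_less closed_Collect_le continuous_intros)
qed

lemma layer_integrable:
  "integrable lborel (\<lambda>x. indicator (layer h) x * ((F x)\<^sup>2 / sqrt (R x)))"
proof (rule integrable_bounded_support[where K = "ball 0 T" and M = "M\<^sup>2 / \<eta>"])
  have "(\<lambda>x. (F x)\<^sup>2 / sqrt (R x)) \<in> borel_measurable borel"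
    using R_pos by (intro borel_measurable_continuous_onI continuous_intros F_continuous R_continuous) (auto simp: less_imp_neq[symmetric] not_le)
  then show "(\<lambda>x. indicator (layer h) x * ((F x)\<^sup>2 / sqrt (R x))) \<in> borel_measurable borel"
    by (intro borel_measurable_times borel_measurable_indicator layer_measurable)
  show "indicator (layer h) x * ((F x)\<^sup>2 / sqrt (R x)) = 0" if "x \<notin> ball 0 T" for x
    using far[of x] that by (cases "x \<in> layer h") (auto simp: layer_def)
  show "\<bar>indicator (layer h) x * ((F x)\<^sup>2 / sqrt (R x))\<bar> \<le> M\<^sup>2 / \<eta>" for x
  proof -
    have "(F x)\<^sup>2 / sqrt (R x) \<le> M\<^sup>2 / \<eta>" using F_square_bound norm_le_sqrt_R(2) \<eta> by (intro frac_le) auto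
    moreover have "0 \<le> (F x)\<^sup>2 / sqrt (R x)" using R_pos[of x] by (simp add: less_imp_le)
    ultimately show ?thesis by (cases "x \<in> layer h") auto
  qed
qed simp

text \<open>By Fubini the layer has thickness \<open>h\<close> over each \<open>y\<close>, and its
  integrand is \<beta> up to an error of order \<open>h\<close>. After division by \<open>h\<close>
  the flux remains and the error vanishes with \<open>h\<close>.\<close>

lemma layer_integral_ge:
  assumes h: "0 < h"
  defines "c \<equiv> 2 * M * L / \<eta> + M\<^sup>2 / \<eta>\<^sup>2"
  shows "flux * h - c * measure lborel (ball (0::'b) T) * h\<^sup>2 \<le> (\<integral>x. indicator (layer h) x * ((F x)\<^sup>2 / sqrt (R x)) \<partial>lborel)"
proof -
  let ?g = "\<lambda>x. indicator (layer h) x * ((F x)\<^sup>2 / sqrt (R x))"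
  have g': "integrable (lborel \<Otimes>\<^sub>M lborel) ?g" using layer_integrable by (simp add: lborel_prod)
  have g0: "0 \<le> ?g x" for x using R_pos[of x] by (simp add: less_imp_le)
  let ?l = "\<lambda>y :: 'b. \<beta> y * h - indicator (ball 0 T) y * (c * h\<^sup>2)"
  have li: "integrable lborel (\<lambda>y :: 'b. indicator (ball 0 T) y * (c * h\<^sup>2))"
    by (intro integrable_indicator_times[where M = "\<bar>c * h\<^sup>2\<bar>"]) auto
  have inner: "?l y \<le> (\<integral>z. ?g (y, z) \<partial>lborel)" for y
  proof (cases "y \<in> ball 0 T")
    case True
    let ?I = "{lam * norm y<..lam * norm y + h}"
    have ind: "indicator (layer h) (y, z) = (indicator ?I z :: real)" for z by (simp add: layer_def indicator_def)
    have "?l y = (\<beta> y - c * h) * h" using True by (simp add: power2_eq_square algebra_simps)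
    also have "\<dots> = (\<integral>z. indicator ?I z * (\<beta> y - c * h) \<partial>lborel)" using h by simp
    also have "\<dots> \<le> (\<integral>z. ?g (y, z) \<partial>lborel)"
    proof (rule integral_mono)
      show "integrable lborel (\<lambda>z. indicator ?I z * (\<beta> y - c * h))"
        by (intro integrable_indicator_times[where M = "\<bar>\<beta> y - c * h\<bar>"]) auto
      have cont: "continuous_on UNIV (\<lambda>z. (F (y, z))\<^sup>2 / sqrt (R (y, z)))"
        using R_pos by (intro continuous_intros continuous_on_compose2[OF F_continuous[of UNIV]] continuous_on_compose2[OF R_continuous[of UNIV]])
          (auto simp: less_imp_neq[symmetric] not_le)
      show "integrable lborel (\<lambda>z. ?g (y, z))"
        unfolding ind
      proof (rule integrable_indicator_times[where M = "M\<^sup>2 / \<eta>"])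
        show "(\<lambda>z. (F (y, z))\<^sup>2 / sqrt (R (y, z))) \<in> borel_measurable borel" using cont by (rule borel_measurable_continuous_onI)
        show "\<bar>(F (y, z))\<^sup>2 / sqrt (R (y, z))\<bar> \<le> M\<^sup>2 / \<eta>" for z
        proof -
          have "(F (y, z))\<^sup>2 / sqrt (R (y, z)) \<le> M\<^sup>2 / \<eta>" using F_square_bound norm_le_sqrt_R(2) \<eta> by (intro frac_le) auto
          moreover have "0 \<le> (F (y, z))\<^sup>2 / sqrt (R (y, z))" using R_pos[of "(y, z)"] by (simp add: less_imp_le)
          ultimately show ?thesis by simp
        qed
      qed auto
      show "indicator ?I z * (\<beta> y - c * h) \<le> ?g (y, z)" for z
        unfolding ind using vertical_lower_bound[of y z h] by (cases "z \<in> ?I") (auto simp: c_def)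
    qed
    finally show ?thesis .
  next
    case False
    then show ?thesis using \<beta>_far[OF False] g0 by (simp add: integral_nonneg_AE)
  qed
  have "flux * h - c * measure lborel (ball (0::'b) T) * h\<^sup>2 = (\<integral>y. ?l y \<partial>lborel)"
    using \<beta>_integrable li by (simp add: flux_def)
  also have "\<dots> \<le> (\<integral>y. \<integral>z. ?g (y, z) \<partial>lborel \<partial>lborel)"
  proof (rule integral_mono[OF _ _ inner])
    show "integrable lborel ?l" using \<beta>_integrable li by auto
    show "integrable lborel (\<lambda>y. \<integral>z. ?g (y, z) \<partial>lborel)"
      using lborel_pair.integrable_fst'[OF g'] by simp
  qed
  also have "\<dots> = (\<integral>x. ?g x \<partial>lborel)"
    using lborel_pair.integral_fst'[OF g'] by (simp add: lborel_prod)
  finally show ?thesis .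
qed

text \<open>The difference quotient splits according to whether the point moved down by
  \<open>h\<close> stays in \<open>W\<close>. If it does, dominated convergence yields
  \<open>- E\<close>. On the layer, where it does not, the quotient is \<open>- A / h\<close>, and
  \<open>- A \<ge> 1 / sqrt R\<close> because the remaining terms are nonnegative for
  \<open>snd x \<ge> 0\<close>; this part tends to at least the flux.\<close>

lemma J_vertical_ge:
  assumes \<delta>: "0 < \<delta>"
  shows "\<forall>\<^sub>F h in at_right 0. flux - (\<integral>x. indicator W x * (E (0, 1) x * (F x)\<^sup>2) \<partial>lborel) - \<delta> \<le> J (0, 1) h"
proof -
  define e :: "'b \<times> real" where "e = (0, 1)"
  have e: "e \<in> Basis" unfolding e_def by (rule vertical_in_Basis)
  let ?r = "T / lam + T"
  obtain C where C: "0 \<le> C" "\<And>h x. 0 < h \<Longrightarrow> h < 1 \<Longrightarrow> norm x \<le> ?r \<Longrightarrow> \<bar>(A e (x - h *\<^sub>R e) - A e x) / h\<bar> \<le> C"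
    using A_quotient_bound[OF e, of ?r] by blast
  let ?s = "\<lambda>h x. indicator W x * (indicator W (x - h *\<^sub>R e) * ((A e (x - h *\<^sub>R e) - A e x) / h)) * (F x)\<^sup>2"
  have sm: "?s h \<in> borel_measurable borel" for h
  proof -
    have "(\<lambda>x. x - h *\<^sub>R e) \<in> borel_measurable borel" by (intro borel_measurable_continuous_onI continuous_intros)
    moreover have "(indicator W :: 'b \<times> real \<Rightarrow> real) \<in> borel_measurable borel" using W_measurable by simp
    ultimately have "(\<lambda>x. indicator W (x - h *\<^sub>R e) :: real) \<in> borel_measurable borel" by (rule measurable_compose)
    then show ?thesis
      using W_measurable by (intro borel_measurable_times borel_measurable_indicator borel_measurable_power A_quotient_measurable F_measurable)
  qed
  have sb: "\<bar>?s h x\<bar> \<le> indicator W x * (C * M\<^sup>2)" if h: "0 < h" "h < 1" for h x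
  proof (cases "x \<in> W \<and> x - h *\<^sub>R e \<in> W")
    case True
    have "\<bar>(A e (x - h *\<^sub>R e) - A e x) / h\<bar> * (F x)\<^sup>2 \<le> C * M\<^sup>2"
      using C(2)[OF h, of x] True W_norm_le[of x] F_square_bound C(1) by (intro mult_mono) auto
    then show ?thesis using True by (simp add: abs_mult)
  next
    case False
    then have "?s h x = 0" by auto
    then show ?thesis using C(1) by (simp only: abs_zero) simp
  qed
  have wi: "integrable lborel (\<lambda>x. indicator W x * (C * M\<^sup>2))"
    using C bounded_W W_measurable by (intro integrable_indicator_times[where M = "C * M\<^sup>2"]) auto
  have "((\<lambda>h. \<integral>x. ?s h x \<partial>lborel) \<longlongrightarrow> (\<integral>x. indicator W x * (1 * (- E e x)) * (F x)\<^sup>2 \<partial>lborel)) (at_right 0)"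
  proof (rule dominated_convergence_at_right[OF _ _ wi])
    show "?s h \<in> borel_measurable lborel" for h using sm by simp
    show "(\<lambda>x. indicator W x * (1 * (- E e x)) * (F x)\<^sup>2) \<in> borel_measurable lborel"
      using W_measurable by (intro borel_measurable_times borel_measurable_indicator borel_measurable_power borel_measurable_uminus) (auto simp: F_measurable E_measurable)
    show "((\<lambda>h. ?s h x) \<longlongrightarrow> indicator W x * (1 * (- E e x)) * (F x)\<^sup>2) (at_right 0)" for x
    proof (cases "x \<in> W")
      case True
      then have pos: "0 < snd x - lam * norm (fst x)" by (simp add: W_def)
      have "\<forall>\<^sub>F h in at_right 0. h < snd x - lam * norm (fst x)"
        using pos by (auto intro: eventually_at_rightI[of 0 "snd x - lam * norm (fst x)"])
      then have "\<forall>\<^sub>F h in at_right 0. 1 = (indicator W (x - h *\<^sub>R e) :: real)"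
        using eventually_at_right_less[of 0]
        by eventually_elim (use True in \<open>auto simp: W_def e_def indicator_def\<close>)
      then have "((\<lambda>h. indicator W (x - h *\<^sub>R e) :: real) \<longlongrightarrow> 1) (at_right 0)"
        by (rule Lim_transform_eventually[rotated]) simp
      then show ?thesis by (intro tendsto_intros A_quotient_tendsto)
    qed simp
    show "\<bar>?s h x\<bar> \<le> indicator W x * (C * M\<^sup>2)" if "0 < h" "h < 1" for h x using sb[OF that] .
  qed
  also have "(\<integral>x. indicator W x * (1 * (- E e x)) * (F x)\<^sup>2 \<partial>lborel) = - (\<integral>x. indicator W x * (E e x * (F x)\<^sup>2) \<partial>lborel)"
    by (subst integral_minus[symmetric]) (intro Bochner_Integration.integral_cong, auto)
  finally have ev1: "\<forall>\<^sub>F h in at_right 0. - (\<integral>x. indicator W x * (E e x * (F x)\<^sup>2) \<partial>lborel) - \<delta> / 2 < (\<integral>x. ?s h x \<partial>lborel)"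
    using \<delta> by (intro order_tendstoD(1)) auto
  define c where "c = (2 * M * L / \<eta> + M\<^sup>2 / \<eta>\<^sup>2) * measure lborel (ball (0::'b) T)"
  have "((\<lambda>h. c * h) \<longlongrightarrow> c * 0) (at_right 0)" by (intro tendsto_intros)
  then have ev2: "\<forall>\<^sub>F h in at_right 0. c * h < \<delta> / 2" using \<delta> by (intro order_tendstoD(2)) auto
  have ev3: "\<forall>\<^sub>F h in at_right (0::real). 0 < h \<and> h < 1"
    by (auto intro: eventually_at_rightI[of 0 1])
  show ?thesis
    unfolding e_def[symmetric] using ev1 ev2 ev3
  proof eventually_elim
    case (elim h)
    let ?\<psi> = "\<lambda>x. indicator W x * A e x"
    let ?g = "\<lambda>x. indicator (layer h) x * ((F x)\<^sup>2 / sqrt (R x))"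
    have h: "0 < h" "h < 1" using elim by auto
    \<comment> \<open>A point outside \<open>W\<close> that is moved into \<open>W\<close> would lie
      in the cone above height \<open>T\<close>, where \<open>F\<close> vanishes; so the top face
      contributes nothing.\<close>
    have pt: "?s h x + 1 / h * ?g x \<le> (?\<psi> (x - h *\<^sub>R e) - ?\<psi> x) / h * (F x)\<^sup>2" for x
    proof (cases "F x = 0")
      case False
      have cone: "snd x < T" if "lam * norm (fst x) \<le> snd x"
      proof (rule ccontr)
        assume "\<not> snd x < T"
        then have "T \<le> norm x" using norm_snd_le[of "snd x" "fst x"] by simp
        then show False using far[of x] that False by simp
      qed
      have f: "fst (x - h *\<^sub>R e) = fst x" "snd (x - h *\<^sub>R e) = snd x - h" by (simp_all add: e_def)
      consider "x \<in> W" "x - h *\<^sub>R e \<in> W" | "x \<in> W" "x - h *\<^sub>R e \<notin> W" | "x \<notin> W" "x - h *\<^sub>R e \<notin> W" | "x \<notin> W" "x - h *\<^sub>R e \<in> W" by blast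
      then show ?thesis
      proof cases
        case 1
        have "lam * norm (fst x) < snd x - h" using 1(2) unfolding W_def mem_Collect_eq f by simp
        then have "x \<notin> layer h" by (simp add: layer_def)
        then show ?thesis using 1 by simp
      next
        case 2
        have sx: "0 \<le> snd x" using 2(1) lam by (auto simp: W_def intro: order_trans[of 0 "lam * norm (fst x)"] less_imp_le)
        have "0 \<le> hardy_const * ((max 0 (P x))\<^sup>2 / (R x) ^ 3 * snd x)" "0 \<le> 2 * snd x / R x"
          using sx R_pos[of x] by (auto simp: hardy_const_def)
        then have A: "1 / sqrt (R x) \<le> - A e x" by (simp add: A_def e_def inner_prod_def)
        have "?g x \<le> (F x)\<^sup>2 * (1 / sqrt (R x))"
          using R_pos[of x] by (simp add: indicator_def less_imp_le)
        also have "\<dots> \<le> (F x)\<^sup>2 * (- A e x)" using A by (intro mult_left_mono) auto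
        finally have "1 / h * ?g x \<le> 1 / h * ((F x)\<^sup>2 * (- A e x))" using h by (intro mult_left_mono) auto
        then show ?thesis using 2 by (simp add: mult_ac)
      next
        case 3
        then have "x \<notin> layer h" using cone by (auto simp: W_def layer_def)
        then show ?thesis using 3 by simp
      next
        case 4
        then have "lam * norm (fst x) < snd x" using h unfolding W_def mem_Collect_eq f by simp
        then show ?thesis using cone 4(1) by (auto simp: W_def)
      qed
    qed simp
    have si: "integrable lborel (?s h)"
    proof (rule Bochner_Integration.integrable_bound[OF wi _ AE_I2])
      show "?s h \<in> borel_measurable lborel" using sm by simp
      show "norm (?s h x) \<le> norm (indicator W x * (C * M\<^sup>2))" for x
        unfolding real_norm_def by (rule order_trans[OF sb[OF h] abs_ge_self])
    qed
    have ri: "integrable lborel (\<lambda>x. (?\<psi> (x - h *\<^sub>R e) - ?\<psi> x) / h * (F x)\<^sup>2)"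
      using J_integrable[OF h(1)] .
    have "flux - c * h = 1 / h * (flux * h - c * h\<^sup>2)" using h by (simp add: field_simps power2_eq_square)
    also have "\<dots> \<le> 1 / h * (\<integral>x. ?g x \<partial>lborel)"
      using layer_integral_ge[OF h(1)] h unfolding c_def by (intro mult_left_mono) auto
    finally have "flux - c * h \<le> 1 / h * (\<integral>x. ?g x \<partial>lborel)" .
    moreover have "(\<integral>x. ?s h x \<partial>lborel) + 1 / h * (\<integral>x. ?g x \<partial>lborel) = (\<integral>x. ?s h x + 1 / h * ?g x \<partial>lborel)"
      unfolding Bochner_Integration.integral_add[OF si integrable_mult_right[OF layer_integrable]] integral_mult_right_zero ..
    moreover have "\<dots> \<le> J e h"
      unfolding J_eq[OF h(1)]
      by (intro integral_mono pt ri Bochner_Integration.integrable_add si integrable_mult_right layer_integrable)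
    ultimately show ?case using elim(1,2) by linarith
  qed
qed

text \<open>This inserts \<open>\<phi> = \<epsilon> F A\<^sub>e\<close> into the gain of a tilt and
  evaluates its linear term through \<open>J\<close>. The factor \<open>(snd e)\<^sup>2\<close>
  makes the flux appear for the vertical direction only.\<close>

lemma directional_gain:
  assumes e: "e \<in> Basis" and \<delta>: "0 < \<delta>" and \<epsilon>: "0 < \<epsilon>"
  shows "\<forall>\<^sub>F h in at_right 0.
    \<epsilon> / 2 * ((snd e)\<^sup>2 * flux - (\<integral>x. indicator W x * (E e x * (F x)\<^sup>2) \<partial>lborel))
      - \<epsilon>\<^sup>2 / 2 * (\<integral>x. indicator W x * ((A e x)\<^sup>2 * (F x)\<^sup>2) \<partial>lborel) - \<delta>
    \<le> (\<integral>x. indicator W x * (\<epsilon> * F x * A e x) * ((F (x + h *\<^sub>R e) - F x) / h) \<partial>lborel)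
      - (\<integral>x. indicator W x * (\<epsilon> * F x * A e x)\<^sup>2 \<partial>lborel) / 2"
proof -
  let ?I = "\<integral>x. indicator W x * (E e x * (F x)\<^sup>2) \<partial>lborel"
  define \<delta>' where "\<delta>' = \<delta> / \<epsilon>"
  have \<delta>': "0 < \<delta>'" using \<delta> \<epsilon> by (simp add: \<delta>'_def)
  have ev1: "\<forall>\<^sub>F h in at_right 0. (snd e)\<^sup>2 * flux - ?I - \<delta>' \<le> J e h"
  proof (cases "e = (0, 1)")
    case True
    then show ?thesis using J_vertical_ge[OF \<delta>'] by simp
  next
    case False
    then have "snd e = 0" using e by (auto simp: Basis_prod_def)
    then have "(J e \<longlongrightarrow> - ?I) (at_right 0)" by (rule J_tendsto_horizontal[OF e])
    then have "\<forall>\<^sub>F h in at_right 0. - ?I - \<delta>' < J e h" using \<delta>' by (intro order_tendstoD(1)) auto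
    then show ?thesis using \<open>snd e = 0\<close> by (auto elim: eventually_mono)
  qed
  obtain C where C: "0 \<le> C" "\<And>x. x \<in> W \<Longrightarrow> \<bar>A e x\<bar> \<le> C" using A_bound_W[of e] by blast
  define c where "c = measure lborel W * (C * L\<^sup>2)"
  have "((\<lambda>h. c * h) \<longlongrightarrow> c * 0) (at_right 0)" by (intro tendsto_intros)
  then have ev2: "\<forall>\<^sub>F h in at_right 0. c * h < \<delta>'" using \<delta>' by (intro order_tendstoD(2)) auto
  show ?thesis using ev1 ev2 eventually_at_right_less[of 0]
  proof eventually_elim
    case (elim h)
    let ?df = "\<lambda>x. (F (x + h *\<^sub>R e) - F x) / h"
    let ?dG = "\<lambda>x. ((F (x + h *\<^sub>R e))\<^sup>2 - (F x)\<^sup>2) / h"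
    have dfm: "?df \<in> borel_measurable borel" by (rule difference_quotient_measurable[OF F_measurable])
    have dfb: "\<bar>?df x\<bar> \<le> L" for x using lipschitz_on_shift[OF lip, of x h e] e by simp
    have dG: "?dG x = ?df x * (F (x + h *\<^sub>R e) + F x)" for x by (simp add: power2_eq_square algebra_simps)
    have i1: "integrable lborel (\<lambda>x. indicator W x * (A e x * ?dG x))"
    proof (rule integrable_indicator_times[OF bounded_W W_measurable(1), where M = "C * (L * (2 * M))"])
      show "(\<lambda>x. A e x * ?dG x) \<in> borel_measurable borel"
        unfolding dG by (intro borel_measurable_times borel_measurable_add A_measurable dfm F_shift_measurable F_measurable)
      fix x assume x: "x \<in> W"
      have "\<bar>F (x + h *\<^sub>R e) + F x\<bar> \<le> 2 * M" using bound[of x] bound[of "x + h *\<^sub>R e"] by linarith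
      then have dd: "\<bar>?df x\<bar> * \<bar>F (x + h *\<^sub>R e) + F x\<bar> \<le> L * (2 * M)"
        by (intro mult_mono[OF dfb _ L_nonneg]) simp_all
      have "\<bar>A e x\<bar> * (\<bar>?df x\<bar> * \<bar>F (x + h *\<^sub>R e) + F x\<bar>) \<le> C * (L * (2 * M))"
        by (rule mult_mono[OF C(2)[OF x] dd C(1)]) simp
      then show "\<bar>A e x * ?dG x\<bar> \<le> C * (L * (2 * M))" unfolding dG abs_mult .
    qed
    have i2: "integrable lborel (\<lambda>x. indicator W x * (A e x * (?df x)\<^sup>2))"
    proof (rule integrable_indicator_times[OF bounded_W W_measurable(1), where M = "C * L\<^sup>2"])
      show "(\<lambda>x. A e x * (?df x)\<^sup>2) \<in> borel_measurable borel"
        by (intro borel_measurable_times borel_measurable_power A_measurable dfm)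
      fix x assume x: "x \<in> W"
      have "(?df x)\<^sup>2 \<le> L\<^sup>2" using dfb[of x] L_nonneg by (simp add: abs_le_square_iff[symmetric] del: abs_divide)
      then show "\<bar>A e x * (?df x)\<^sup>2\<bar> \<le> C * L\<^sup>2"
        unfolding abs_mult using C(2)[OF x] C(1) by (intro mult_mono) auto
    qed
    have iW: "integrable lborel (\<lambda>x. indicator W x * (C * L\<^sup>2))"
      using C by (intro integrable_indicator_times[OF bounded_W W_measurable(1), where M = "C * L\<^sup>2"]) auto
    have "(\<integral>x. indicator W x * (A e x * (?df x)\<^sup>2) \<partial>lborel) \<le> (\<integral>x. indicator W x * (C * L\<^sup>2) \<partial>lborel)"
    proof (rule integral_mono[OF i2 iW])
      fix x
      show "indicator W x * (A e x * (?df x)\<^sup>2) \<le> indicator W x * (C * L\<^sup>2)"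
      proof (cases "x \<in> W")
        case True
        have "(?df x)\<^sup>2 \<le> L\<^sup>2" using dfb[of x] L_nonneg by (simp add: abs_le_square_iff[symmetric] del: abs_divide)
        moreover have "A e x \<le> C" using C(2)[OF True] by simp
        ultimately have "A e x * (?df x)\<^sup>2 \<le> C * L\<^sup>2" using C(1) by (intro mult_mono) auto
        then show ?thesis using True by simp
      qed simp
    qed
    also have "\<dots> = c" using W_measurable by (simp add: c_def)
    finally have err: "(\<integral>x. indicator W x * (A e x * (?df x)\<^sup>2) \<partial>lborel) \<le> c" .
    have "indicator W x * (\<epsilon> * F x * A e x) * ?df x =
        \<epsilon> / 2 * (indicator W x * (A e x * ?dG x)) - \<epsilon> * h / 2 * (indicator W x * (A e x * (?df x)\<^sup>2))" for x
    proof -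
      define X Y where "X = ?dG x" and "Y = (?df x)\<^sup>2"
      \<comment> \<open>Discrete product rule: \<open>F \<partial>F = \<partial>(F\<^sup>2) / 2 - (h
        / 2) (\<partial>F)\<^sup>2\<close> for the forward quotient. The last term is controlled by
        the Lipschitz constant and vanishes with \<open>h\<close>.\<close>
      have XY: "F x * ?df x = X / 2 - h / 2 * Y"
        unfolding X_def Y_def dG using elim(3) by (simp add: field_simps power2_eq_square)
      have "indicator W x * (\<epsilon> * F x * A e x) * ?df x = \<epsilon> * (indicator W x * A e x) * (F x * ?df x)"
        by (simp only: mult_ac)
      also have "\<dots> = \<epsilon> / 2 * (indicator W x * (A e x * X)) - \<epsilon> * h / 2 * (indicator W x * (A e x * Y))"
        unfolding XY by (simp add: algebra_simps)
      finally show ?thesis unfolding X_def Y_def .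
    qed
    then have "(\<integral>x. indicator W x * (\<epsilon> * F x * A e x) * ?df x \<partial>lborel) =
        (\<integral>x. \<epsilon> / 2 * (indicator W x * (A e x * ?dG x)) - \<epsilon> * h / 2 * (indicator W x * (A e x * (?df x)\<^sup>2)) \<partial>lborel)"
      by (simp only:)
    also have "\<dots> = \<epsilon> / 2 * J e h - \<epsilon> * h / 2 * (\<integral>x. indicator W x * (A e x * (?df x)\<^sup>2) \<partial>lborel)"
      unfolding Bochner_Integration.integral_diff[OF integrable_mult_right[OF i1] integrable_mult_right[OF i2]] integral_mult_right_zero J_def ..
    also have "\<dots> \<ge> \<epsilon> / 2 * ((snd e)\<^sup>2 * flux - ?I - \<delta>') - \<epsilon> * h / 2 * c"
      using elim \<epsilon> err by (intro diff_mono mult_left_mono) auto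
    also have "\<epsilon> / 2 * ((snd e)\<^sup>2 * flux - ?I - \<delta>') - \<epsilon> * h / 2 * c \<ge> \<epsilon> / 2 * ((snd e)\<^sup>2 * flux - ?I) - \<delta>"
    proof -
      have "\<epsilon> / 2 * (c * h) \<le> \<epsilon> / 2 * \<delta>'" using elim(2) \<epsilon> by (intro mult_left_mono) auto
      moreover have "\<epsilon> * \<delta>' = \<delta>" using \<epsilon> by (simp add: \<delta>'_def)
      ultimately show ?thesis by (simp add: algebra_simps)
    qed
    finally have lin: "\<epsilon> / 2 * ((snd e)\<^sup>2 * flux - ?I) - \<delta> \<le> (\<integral>x. indicator W x * (\<epsilon> * F x * A e x) * ?df x \<partial>lborel)" .
    have "(\<integral>x. indicator W x * (\<epsilon> * F x * A e x)\<^sup>2 \<partial>lborel) = (\<integral>x. \<epsilon>\<^sup>2 * (indicator W x * ((A e x)\<^sup>2 * (F x)\<^sup>2)) \<partial>lborel)"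
      by (intro Bochner_Integration.integral_cong) (auto simp: power_mult_distrib mult_ac)
    also have "\<dots> = \<epsilon>\<^sup>2 * (\<integral>x. indicator W x * ((A e x)\<^sup>2 * (F x)\<^sup>2) \<partial>lborel)" by (rule integral_mult_right_zero)
    finally show ?case using lin by simp
  qed
qed

lemma mass_integrable: "integrable lborel (\<lambda>x. indicator W x * ((F x)\<^sup>2 / R x))"
proof (rule integrable_indicator_times[OF bounded_W W_measurable(1), where M = "M\<^sup>2 / \<eta>\<^sup>2"])
  show "(\<lambda>x. (F x)\<^sup>2 / R x) \<in> borel_measurable borel"
    using R_pos by (intro borel_measurable_continuous_onI continuous_intros F_continuous R_continuous) (auto simp: less_imp_neq[symmetric])
  fix x
  have "(F x)\<^sup>2 / R x \<le> M\<^sup>2 / \<eta>\<^sup>2" using F_square_bound \<eta> by (intro frac_le) (auto simp: R_def)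
  then show "\<bar>(F x)\<^sup>2 / R x\<bar> \<le> M\<^sup>2 / \<eta>\<^sup>2" using R_pos[of x] by (simp add: less_imp_le)
qed

text \<open>Summing over the basis turns the \<open>E e\<close> into the divergence and the
  \<open>(A e)\<^sup>2\<close> into the squared length of the field, both controlled by
  \<open>1 / R\<close>. The condition on \<epsilon> makes the quadratic term at most half of the
  linear one, which leaves \<open>\<epsilon> / 4\<close>.\<close>

lemma total_gain:
  assumes lam6: "lam \<le> 1 / 6" and dim: "2 \<le> DIM('b)" and \<epsilon>: "0 < \<epsilon>" "\<epsilon> * (hardy_const + 3)\<^sup>2 \<le> 1 / 2"
  shows "\<epsilon> / 4 * (\<integral>x. indicator W x * ((F x)\<^sup>2 / R x) \<partial>lborel) + \<epsilon> / 2 * flux \<le>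
    (\<Sum>e\<in>Basis. \<epsilon> / 2 * ((snd e)\<^sup>2 * flux - (\<integral>x. indicator W x * (E e x * (F x)\<^sup>2) \<partial>lborel))
      - \<epsilon>\<^sup>2 / 2 * (\<integral>x. indicator W x * ((A e x)\<^sup>2 * (F x)\<^sup>2) \<partial>lborel))"
proof -
  let ?m = "\<integral>x. indicator W x * ((F x)\<^sup>2 / R x) \<partial>lborel"
  have iE: "integrable lborel (\<lambda>x. indicator W x * (E e x * (F x)\<^sup>2))" for e
  proof -
    obtain C where C: "0 \<le> C" "\<And>x. norm x \<le> T / lam + T \<Longrightarrow> \<bar>E e x\<bar> \<le> C"
      using bounded_on_ball[of "E e" "T / lam + T"] E_continuous by metis
    show ?thesis
    proof (rule integrable_indicator_times[OF bounded_W W_measurable(1), where M = "C * M\<^sup>2"])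
      show "(\<lambda>x. E e x * (F x)\<^sup>2) \<in> borel_measurable borel"
        by (intro borel_measurable_times borel_measurable_power E_measurable F_measurable)
      show "\<bar>E e x * (F x)\<^sup>2\<bar> \<le> C * M\<^sup>2" if "x \<in> W" for x
        using mult_mono[OF C(2)[OF W_norm_le[OF that]] F_square_bound[of x] C(1)] by (simp add: abs_mult)
    qed
  qed
  have iA: "integrable lborel (\<lambda>x. indicator W x * ((A e x)\<^sup>2 * (F x)\<^sup>2))" for e
  proof -
    obtain C where C: "0 \<le> C" "\<And>x. x \<in> W \<Longrightarrow> \<bar>A e x\<bar> \<le> C" using A_bound_W[of e] by blast
    show ?thesis
    proof (rule integrable_indicator_times[OF bounded_W W_measurable(1), where M = "C\<^sup>2 * M\<^sup>2"])
      show "(\<lambda>x. (A e x)\<^sup>2 * (F x)\<^sup>2) \<in> borel_measurable borel"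
        by (intro borel_measurable_times borel_measurable_power A_measurable F_measurable)
      show "\<bar>(A e x)\<^sup>2 * (F x)\<^sup>2\<bar> \<le> C\<^sup>2 * M\<^sup>2" if "x \<in> W" for x
      proof -
        have A2: "(A e x)\<^sup>2 \<le> C\<^sup>2" using C(2)[OF that] C(1) by (simp add: abs_le_square_iff[symmetric])
        show ?thesis using mult_mono[OF A2 F_square_bound[of x]] by (simp add: abs_mult)
      qed
    qed
  qed
  have "(\<Sum>e\<in>Basis. \<integral>x. indicator W x * (E e x * (F x)\<^sup>2) \<partial>lborel) = (\<integral>x. (\<Sum>e\<in>Basis. indicator W x * (E e x * (F x)\<^sup>2)) \<partial>lborel)"
    by (rule Bochner_Integration.integral_sum[symmetric]) (rule iE)
  also have "\<dots> \<le> (\<integral>x. - (indicator W x * ((F x)\<^sup>2 / R x)) \<partial>lborel)"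
  proof (intro integral_mono Bochner_Integration.integrable_sum iE integrable_minus mass_integrable)
    fix x
    show "(\<Sum>e\<in>Basis. indicator W x * (E e x * (F x)\<^sup>2)) \<le> - (indicator W x * ((F x)\<^sup>2 / R x))"
    proof (cases "x \<in> W")
      case True
      have "(F x)\<^sup>2 * (1 / R x) \<le> (F x)\<^sup>2 * (- (\<Sum>e\<in>Basis. E e x))"
        by (intro mult_left_mono divergence_le[OF lam6 dim True]) auto
      then show ?thesis using True by (simp add: sum_distrib_left sum_distrib_right mult.commute)
    qed simp
  qed
  also have "\<dots> = - ?m" by (rule integral_minus)
  finally have SE: "(\<Sum>e\<in>Basis. \<integral>x. indicator W x * (E e x * (F x)\<^sup>2) \<partial>lborel) \<le> - ?m" .
  have "(\<Sum>e\<in>Basis. \<integral>x. indicator W x * ((A e x)\<^sup>2 * (F x)\<^sup>2) \<partial>lborel) = (\<integral>x. (\<Sum>e\<in>Basis. indicator W x * ((A e x)\<^sup>2 * (F x)\<^sup>2)) \<partial>lborel)"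
    by (rule Bochner_Integration.integral_sum[symmetric]) (rule iA)
  also have "\<dots> \<le> (\<integral>x. (hardy_const + 3)\<^sup>2 * (indicator W x * ((F x)\<^sup>2 / R x)) \<partial>lborel)"
  proof (intro integral_mono Bochner_Integration.integrable_sum iA integrable_mult_right mass_integrable)
    fix x
    show "(\<Sum>e\<in>Basis. indicator W x * ((A e x)\<^sup>2 * (F x)\<^sup>2)) \<le> (hardy_const + 3)\<^sup>2 * (indicator W x * ((F x)\<^sup>2 / R x))"
    proof (cases "x \<in> W")
      case True
      have "(\<Sum>e\<in>Basis. (A e x)\<^sup>2) * (F x)\<^sup>2 \<le> (hardy_const + 3)\<^sup>2 / R x * (F x)\<^sup>2"
        by (intro mult_right_mono sum_A_square_le) auto
      then show ?thesis using True by (simp add: sum_distrib_right)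
    qed simp
  qed
  also have "\<dots> = (hardy_const + 3)\<^sup>2 * ?m" by (rule integral_mult_right_zero)
  finally have SA: "(\<Sum>e\<in>Basis. \<integral>x. indicator W x * ((A e x)\<^sup>2 * (F x)\<^sup>2) \<partial>lborel) \<le> (hardy_const + 3)\<^sup>2 * ?m" .
  have m: "0 \<le> ?m" using R_pos by (intro integral_nonneg_AE AE_I2) (auto simp: less_imp_le)
  have s5: "(\<Sum>e\<in>(Basis :: ('b \<times> real) set). (snd e)\<^sup>2) = 1"
  proof -
    have "snd e = (0, 1) \<bullet> e" for e :: "'b \<times> real" by (simp add: inner_prod_def)
    then have "(\<Sum>e\<in>(Basis :: ('b \<times> real) set). (snd e)\<^sup>2) = (\<Sum>e\<in>(Basis :: ('b \<times> real) set). ((0, 1) \<bullet> e) * ((0, 1) \<bullet> e))"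
      by (simp only: power2_eq_square)
    also have "\<dots> = (0 :: 'b, 1 :: real) \<bullet> (0, 1)" by (rule euclidean_inner[symmetric])
    finally show ?thesis by (simp add: inner_prod_def)
  qed
  have "\<epsilon>\<^sup>2 / 2 * (\<Sum>e\<in>Basis. \<integral>x. indicator W x * ((A e x)\<^sup>2 * (F x)\<^sup>2) \<partial>lborel) \<le> \<epsilon>\<^sup>2 / 2 * ((hardy_const + 3)\<^sup>2 * ?m)"
    using SA by (intro mult_left_mono) auto
  also have "\<dots> = \<epsilon> / 2 * ((\<epsilon> * (hardy_const + 3)\<^sup>2) * ?m)" by (simp add: power2_eq_square)
  also have "\<dots> \<le> \<epsilon> / 2 * (1 / 2 * ?m)"
    using \<epsilon> m by (intro mult_left_mono mult_right_mono) auto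
  finally have quad: "\<epsilon>\<^sup>2 / 2 * (\<Sum>e\<in>Basis. \<integral>x. indicator W x * ((A e x)\<^sup>2 * (F x)\<^sup>2) \<partial>lborel) \<le> \<epsilon> / 4 * ?m" by simp
  have "\<epsilon> / 2 * (flux + ?m) \<le> \<epsilon> / 2 * (flux - (\<Sum>e\<in>Basis. \<integral>x. indicator W x * (E e x * (F x)\<^sup>2) \<partial>lborel))"
    using SE \<epsilon> by (intro mult_left_mono) auto
  moreover have "(\<Sum>e\<in>Basis. \<epsilon> / 2 * ((snd e)\<^sup>2 * flux - (\<integral>x. indicator W x * (E e x * (F x)\<^sup>2) \<partial>lborel))
      - \<epsilon>\<^sup>2 / 2 * (\<integral>x. indicator W x * ((A e x)\<^sup>2 * (F x)\<^sup>2) \<partial>lborel)) =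
      \<epsilon> / 2 * (flux - (\<Sum>e\<in>Basis. \<integral>x. indicator W x * (E e x * (F x)\<^sup>2) \<partial>lborel))
      - \<epsilon>\<^sup>2 / 2 * (\<Sum>e\<in>Basis. \<integral>x. indicator W x * ((A e x)\<^sup>2 * (F x)\<^sup>2) \<partial>lborel)"
    using s5 by (simp only: sum_subtractf sum_distrib_left[symmetric] sum_distrib_right[symmetric] mult_1)
  ultimately show ?thesis using quad by (simp add: distrib_left)
qed

end

subsection \<open>Growth of the area\<close>

text \<open>The Hardy term at \<open>\<eta> = 1\<close>. It bounds the terms for all smaller \<eta>
  from below, so it survives the limit, and its positivity gives the strict inequality.\<close>

definition mass :: real where
  "mass = (\<integral>x. indicator W x * ((F x)\<^sup>2 / ((norm x)\<^sup>2 + 1)) \<partial>lborel)"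

lemma mass_integrable_1: "integrable lborel (\<lambda>x. indicator W x * ((F x)\<^sup>2 / ((norm x)\<^sup>2 + 1)))"
  using mass_integrable[of 1] by (simp add: R_def)

lemma mass_nonneg: "0 \<le> mass"
  unfolding mass_def by (intro integral_nonneg_AE AE_I2) (auto simp: add_nonneg_pos less_imp_le)

lemma mass_pos:
  assumes x: "x \<in> W" "F x \<noteq> 0"
  shows "0 < mass"
proof (rule ccontr)
  assume "\<not> 0 < mass"
  then have "mass = 0" using mass_nonneg by simp
  moreover have "0 < (norm x)\<^sup>2 + 1" for x :: "'b \<times> real" by (simp add: add_nonneg_pos)
  ultimately have "AE x in lborel. indicator W x * ((F x)\<^sup>2 / ((norm x)\<^sup>2 + 1)) = 0"
    using integral_nonneg_eq_0_iff_AE[OF mass_integrable_1] unfolding mass_def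
    by (auto simp: less_imp_le)
  then have AE: "AE x in lborel. x \<notin> W \<inter> {x. F x \<noteq> 0}"
  proof eventually_elim
    case (elim x)
    have "0 < (norm x)\<^sup>2 + 1" by (simp add: add_nonneg_pos)
    then show ?case using elim by auto
  qed
  have "{x. F x \<noteq> 0} = F -` (- {0})" by auto
  then have "open {x. F x \<noteq> 0}" using F_continuous[of UNIV] by (simp only:) (rule open_vimage, auto)
  then have U: "open (W \<inter> {x. F x \<noteq> 0})" using open_W by blast
  have "W \<inter> {x. F x \<noteq> 0} \<in> null_sets lborel"
    using AE U by (subst AE_iff_null_sets) auto
  then have "negligible (W \<inter> {x. F x \<noteq> 0})"
    unfolding negligible_iff_null_sets by (rule null_sets_completionI)
  then show False using open_not_negligible[OF U] x by blast
qed

text \<open>As \<eta> tends to zero the weight increases to the inverse norm of the boundary point,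
  dominated by \<open>1 / |y|\<close>. For \<open>lam \<le> 1 / 6\<close> that norm is at most
  \<open>7 / 6 * |y|\<close>, whence the factor \<open>6 / 7\<close>.\<close>

lemma eventually_flux_ge:
  assumes dim: "2 \<le> DIM('b)" and lam6: "lam \<le> 1 / 6" and \<delta>: "0 < \<delta>"
  shows "\<forall>\<^sub>F \<eta> in at_right 0. 6 / 7 * B - \<delta> \<le> flux \<eta>"
proof -
  let ?n = "\<lambda>y :: 'b. norm (y, lam * norm y)"
  let ?w = "\<lambda>y. (boundary_value y)\<^sup>2 / norm y"
  \<comment> \<open>The origin is removed: there \<open>\<beta> \<eta>\<close> may blow up as \<eta>
    tends to zero, while \<open>?w\<close> is zero by the convention for division.\<close>
  let ?s = "\<lambda>\<eta> y. indicator (- {0}) y * \<beta> \<eta> y"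
  let ?g = "\<lambda>y. indicator (- {0}) y * ((boundary_value y)\<^sup>2 / ?n y)"
  have le_n: "norm y \<le> ?n y" for y by (rule norm_fst_le)
  have \<beta>: "\<beta> \<eta> y = (boundary_value y)\<^sup>2 / sqrt ((?n y)\<^sup>2 + \<eta>\<^sup>2)" if "0 < \<eta>" for \<eta> y
    by (simp only: \<beta>_def[OF that] R_def[OF that])
  have le: "norm y \<le> sqrt ((?n y)\<^sup>2 + \<eta>\<^sup>2)" for y \<eta>
    using le_n[of y] by (intro real_le_rsqrt) (meson abs_le_square_iff le_add_same_cancel1 norm_ge_zero order_trans power_mono zero_le_power2)
  have bm: "(\<lambda>y. (boundary_value y)\<^sup>2) \<in> borel_measurable borel"
    by (intro borel_measurable_power borel_measurable_continuous_onI boundary_value_continuous)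
  have nm: "?n \<in> borel_measurable borel" by (intro borel_measurable_continuous_onI continuous_intros)
  have lim: "((\<lambda>\<eta>. \<integral>y. ?s \<eta> y \<partial>lborel) \<longlongrightarrow> (\<integral>y. ?g y \<partial>lborel)) (at_right 0)"
  proof (rule dominated_convergence_at_right[where w = ?w])
    show "?s \<eta> \<in> borel_measurable lborel" if "0 < \<eta>" for \<eta>
      using \<beta>_measurable[OF that] by (auto intro!: borel_measurable_times borel_measurable_indicator)
    show "?g \<in> borel_measurable lborel"
      using bm nm by (auto intro!: borel_measurable_times borel_measurable_indicator borel_measurable_divide)
    show "integrable lborel ?w" by (rule boundary_value_integrable[OF dim])
    show "((\<lambda>\<eta>. ?s \<eta> y) \<longlongrightarrow> ?g y) (at_right 0)" for y
    proof (cases "y = 0")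
      case False
      then have "0 < ?n y" using le_n[of y] by (meson less_le_trans zero_less_norm_iff)
      then have "((\<lambda>\<eta>. (boundary_value y)\<^sup>2 / sqrt ((?n y)\<^sup>2 + \<eta>\<^sup>2)) \<longlongrightarrow> (boundary_value y)\<^sup>2 / sqrt ((?n y)\<^sup>2 + 0\<^sup>2)) (at_right 0)"
        by (intro tendsto_intros) auto
      moreover have "\<forall>\<^sub>F \<eta> in at_right 0. ?s \<eta> y = (boundary_value y)\<^sup>2 / sqrt ((?n y)\<^sup>2 + \<eta>\<^sup>2)"
        using eventually_at_right_less[of 0] by eventually_elim (use False in \<open>simp add: \<beta>\<close>)
      ultimately show ?thesis using False by (simp add: tendsto_cong)
    qed simp
    show "\<bar>?s \<eta> y\<bar> \<le> ?w y" if "0 < \<eta>" for \<eta> y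
    proof (cases "y = 0")
      case False
      then have "(boundary_value y)\<^sup>2 / sqrt ((?n y)\<^sup>2 + \<eta>\<^sup>2) \<le> ?w y"
        using le[of y \<eta>] that by (intro divide_left_mono mult_pos_pos) (auto simp: add_nonneg_pos)
      then show ?thesis using False \<beta>_nonneg[OF that, of y] \<beta>[OF that, of y] by simp
    qed simp
  qed
  have "integrable lborel ?g"
  proof (rule Bochner_Integration.integrable_bound[OF boundary_value_integrable[OF dim] _ AE_I2])
    show "?g \<in> borel_measurable lborel"
      using bm nm by (auto intro!: borel_measurable_times borel_measurable_indicator borel_measurable_divide)
    show "norm (?g y) \<le> norm (?w y)" for y
      using le_n[of y] by (cases "y = 0") (auto simp: abs_divide intro!: divide_left_mono mult_pos_pos less_le_trans[of 0 "norm y" "?n y"])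
  qed
  moreover have "6 / 7 * ?w y \<le> ?g y" for y
  proof (cases "y = 0")
    case False
    have "?n y \<le> norm y + \<bar>lam * norm y\<bar>" using norm_Pair_le[of y "lam * norm y"] by simp
    also have "\<bar>lam * norm y\<bar> \<le> 1 / 6 * norm y" using lam mult_right_mono[OF lam6 norm_ge_zero[of y]] by (simp add: abs_mult)
    finally have "?n y \<le> 7 / 6 * norm y" by simp
    then have "(boundary_value y)\<^sup>2 / (7 / 6 * norm y) \<le> (boundary_value y)\<^sup>2 / ?n y"
      using False le_n[of y] by (intro divide_left_mono mult_pos_pos) (auto intro: less_le_trans[of 0 "norm y"])
    then show ?thesis using False by simp
  qed simp
  ultimately have "(\<integral>y. 6 / 7 * ?w y \<partial>lborel) \<le> (\<integral>y. ?g y \<partial>lborel)"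
    using boundary_value_integrable[OF dim] by (intro integral_mono integrable_mult_right)
  then have "6 / 7 * B \<le> (\<integral>y. ?g y \<partial>lborel)" unfolding B_def integral_mult_right_zero .
  then have "6 / 7 * B - \<delta> < (\<integral>y. ?g y \<partial>lborel)" using \<delta> by linarith
  with lim have "\<forall>\<^sub>F \<eta> in at_right 0. 6 / 7 * B - \<delta> < (\<integral>y. ?s \<eta> y \<partial>lborel)"
    by (rule order_tendstoD(1))
  then show ?thesis using eventually_at_right_less[of 0]
  proof eventually_elim
    case (elim \<eta>)
    have "(\<integral>y. ?s \<eta> y \<partial>lborel) = flux \<eta>"
      unfolding flux_def[OF elim(2)]
    proof (rule integral_cong_AE)
      have "AE y in lborel. y \<noteq> (0::'b)" by (rule AE_lborel_singleton)
      then show "AE y in lborel. ?s \<eta> y = \<beta> \<eta> y" by eventually_elim simp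
    qed (use \<beta>_measurable[OF elim(2)] in \<open>auto intro!: borel_measurable_times borel_measurable_indicator\<close>)
    then show ?case using elim(1) by simp
  qed
qed

text \<open>The parameters are fixed in the order \<eta>, \<open>e\<close>, \<open>h\<close>, and
  only then \<open>t\<close> tends to zero. The flux share of the chosen direction pays for
  \<open>lam * B / 2\<close>, so the Hardy term remains as growth rate.\<close>

lemma flow_area_growth:
  assumes S: "S \<subseteq> W" "S \<in> sets borel" "\<And>x. x \<in> W \<Longrightarrow> x \<notin> S \<Longrightarrow> F x = 0"
    and dim: "2 \<le> DIM('b)" and lam6: "lam \<le> 1 / 6"
    and \<epsilon>: "0 < \<epsilon>" "\<epsilon> * (hardy_const + 3)\<^sup>2 \<le> 1 / 2" and lam_le: "lam \<le> \<epsilon> / (2 * real DIM('b \<times> real))"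
    and \<kappa>: "\<kappa> < \<epsilon> / (4 * real DIM('b \<times> real)) * mass"
  shows "\<forall>\<^sub>F t in at_right (0::real). ennreal (measure lborel S + t\<^sup>2 * \<kappa>)
    \<le> hausdorff_measure DIM('b \<times> real) ((\<lambda>x. (flow t x, t * F x)) ` S)"
proof -
  define n where "n = real DIM('b \<times> real)"
  have n: "3 \<le> n" using dim by (simp add: n_def)
  \<comment> \<open>The slack below the rate is spent three times: on the regularisation \<eta>, on
    the directional gain and on the area bound.\<close>
  define gap where "gap = \<epsilon> / (4 * n) * mass - \<kappa>"
  have gap: "0 < gap" using \<kappa> by (simp add: gap_def n_def)
  have "\<epsilon> * 1 \<le> \<epsilon> * (hardy_const + 3)\<^sup>2" using \<epsilon> by (intro mult_left_mono) (auto simp: hardy_const_def)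
  then have \<epsilon>_half: "\<epsilon> \<le> 1 / 2" using \<epsilon>(2) by linarith
  have B: "0 \<le> B" unfolding B_def by (intro integral_nonneg_AE AE_I2) auto
  have "\<forall>\<^sub>F \<eta> in at_right (0::real). 0 < \<eta> \<and> \<eta> < 1" by (auto intro: eventually_at_rightI[of 0 1])
  with eventually_flux_ge[OF dim lam6 gap]
  have "\<forall>\<^sub>F \<eta> in at_right 0. 6 / 7 * B - gap \<le> flux \<eta> \<and> 0 < \<eta> \<and> \<eta> < 1" by (rule eventually_conj)
  then obtain \<eta> where \<eta>: "6 / 7 * B - gap \<le> flux \<eta>" "0 < \<eta>" "\<eta> < 1"
    using eventually_happens'[OF trivial_limit_at_right_real] by blast
  define val where "val e = \<epsilon> / 2 * ((snd e)\<^sup>2 * flux \<eta> - (\<integral>x. indicator W x * (E \<eta> e x * (F x)\<^sup>2) \<partial>lborel))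
      - \<epsilon>\<^sup>2 / 2 * (\<integral>x. indicator W x * ((A \<eta> e x)\<^sup>2 * (F x)\<^sup>2) \<partial>lborel)" for e
  have "mass \<le> (\<integral>x. indicator W x * ((F x)\<^sup>2 / R \<eta> x) \<partial>lborel)"
    unfolding mass_def
  proof (intro integral_mono mass_integrable_1 mass_integrable \<eta>)
    fix x
    have "\<eta>\<^sup>2 \<le> 1" using \<eta> by (simp add: power_le_one)
    then have "(F x)\<^sup>2 / ((norm x)\<^sup>2 + 1) \<le> (F x)\<^sup>2 / R \<eta> x"
      using R_pos[OF \<eta>(2), of x] by (intro divide_left_mono mult_pos_pos) (auto simp: R_def[OF \<eta>(2)] add_nonneg_pos)
    then show "indicator W x * ((F x)\<^sup>2 / ((norm x)\<^sup>2 + 1)) \<le> indicator W x * ((F x)\<^sup>2 / R \<eta> x)"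
      by (intro mult_left_mono) auto
  qed
  then have "\<epsilon> / 4 * mass + \<epsilon> / 2 * (6 / 7 * B - gap) \<le>
      \<epsilon> / 4 * (\<integral>x. indicator W x * ((F x)\<^sup>2 / R \<eta> x) \<partial>lborel) + \<epsilon> / 2 * flux \<eta>"
    using \<epsilon> \<eta> by (intro add_mono mult_left_mono) auto
  also have "\<dots> \<le> (\<Sum>e\<in>Basis. val e)"
    unfolding val_def by (rule total_gain[OF \<eta>(2) lam6 dim \<epsilon>])
  finally have total: "\<epsilon> / 4 * mass + \<epsilon> / 2 * (6 / 7 * B - gap) \<le> (\<Sum>e\<in>Basis. val e)" .
  \<comment> \<open>Some direction attains at least the average.\<close>
  have "\<exists>e\<in>Basis. (\<epsilon> / 4 * mass + \<epsilon> / 2 * (6 / 7 * B - gap)) / n \<le> val e"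
  proof (rule ccontr)
    assume "\<not> ?thesis"
    then have "(\<Sum>e\<in>Basis. val e) < (\<Sum>e\<in>(Basis :: ('b \<times> real) set). (\<epsilon> / 4 * mass + \<epsilon> / 2 * (6 / 7 * B - gap)) / n)"
      by (intro sum_strict_mono) auto
    also have "\<dots> = n * ((\<epsilon> / 4 * mass + \<epsilon> / 2 * (6 / 7 * B - gap)) / n)" unfolding n_def by simp
    also have "\<dots> = \<epsilon> / 4 * mass + \<epsilon> / 2 * (6 / 7 * B - gap)" using n by simp
    finally show False using total by simp
  qed
  then obtain e where e: "e \<in> Basis" "(\<epsilon> / 4 * mass + \<epsilon> / 2 * (6 / 7 * B - gap)) / n \<le> val e" by blast
  have split: "(\<epsilon> / 4 * mass + \<epsilon> / 2 * (6 / 7 * B - gap)) / n = (\<kappa> + gap) + 3 / 7 * (\<epsilon> / n * B) - \<epsilon> / n * gap / 2"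
    using n by (simp add: gap_def field_simps)
  \<comment> \<open>Here \<open>l = lam * B\<close>, \<open>X = \<epsilon> / n * B\<close>,
    \<open>Y = \<epsilon> / n * gap\<close> and \<open>g = gap\<close>. The loss is at most
    \<open>X / 4\<close>, below the flux share \<open>3 / 7 * X\<close>; of the slack,
    \<open>g / 12 + g / 2\<close> is used.\<close>
  have arith: "k \<le> v - g / 4 - l / 2 - g / 4"
    if "l \<le> X / 2" "0 \<le> X" "Y \<le> g / 6" "(k + g) + 3 / 7 * X - Y / 2 \<le> v" "0 < g" for k v g l X Y :: real
    using that by (simp add: field_simps)
  have "lam * B \<le> \<epsilon> / (2 * n) * B" using lam_le B by (intro mult_right_mono) (auto simp: n_def)
  then have lamB: "lam * B \<le> \<epsilon> / n * B / 2" by simp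
  have "\<epsilon> / n \<le> (1 / 2) / 3" using \<epsilon> \<epsilon>_half n by (intro frac_le) auto
  then have "\<epsilon> / n * gap \<le> (1 / 2) / 3 * gap" using gap by (intro mult_right_mono) auto
  then have gap6: "\<epsilon> / n * gap \<le> gap / 6" by simp
  have "0 \<le> \<epsilon> / n * B" using \<epsilon> n B by simp
  then have enough: "\<kappa> \<le> val e - gap / 4 - lam * B / 2 - gap / 4"
    by (rule arith[OF lamB _ gap6 e(2)[unfolded split] gap])
  define \<phi> where "\<phi> x = \<epsilon> * F x * A \<eta> e x" for x
  obtain C where C: "0 \<le> C" "\<And>x. x \<in> W \<Longrightarrow> \<bar>A \<eta> e x\<bar> \<le> C" using A_bound_W[OF \<eta>(2), of e] by blast
  have \<phi>c: "continuous_on UNIV \<phi>" unfolding \<phi>_def by (intro continuous_intros F_continuous A_continuous \<eta>)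
  have \<phi>b: "\<bar>\<phi> x\<bar> \<le> \<epsilon> * M * C" if "x \<in> W" for x
    unfolding \<phi>_def abs_mult using bound[of x] C(2)[OF that] C(1) \<epsilon> M_nonneg by (intro mult_mono) auto
  let ?gain = "\<lambda>h. (\<integral>x. indicator W x * \<phi> x * ((F (x + h *\<^sub>R e) - F x) / h) \<partial>lborel) - (\<integral>x. indicator W x * (\<phi> x)\<^sup>2 \<partial>lborel) / 2"
  have g4: "0 < gap / 4" using gap by simp
  have "\<forall>\<^sub>F h in at_right 0. val e - gap / 4 \<le> ?gain h"
    unfolding val_def \<phi>_def by (rule directional_gain[OF \<eta>(2) e(1) g4 \<epsilon>(1)])
  moreover have "\<forall>\<^sub>F h in at_right 0. \<forall>\<^sub>F t in at_right (0::real).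
    ennreal (measure lborel S + t\<^sup>2 * (?gain h - lam * B / 2 - gap / 4))
    \<le> hausdorff_measure DIM('b \<times> real) ((\<lambda>x. (flow t x, t * F x)) ` S)"
    by (rule flow_area_lower_bound[OF S dim \<phi>c \<phi>b e(1) g4])
  ultimately have "\<forall>\<^sub>F h in at_right 0. val e - gap / 4 \<le> ?gain h \<and> (\<forall>\<^sub>F t in at_right (0::real).
    ennreal (measure lborel S + t\<^sup>2 * (?gain h - lam * B / 2 - gap / 4))
    \<le> hausdorff_measure DIM('b \<times> real) ((\<lambda>x. (flow t x, t * F x)) ` S))"
    by (rule eventually_conj)
  then obtain h where h: "val e - gap / 4 \<le> ?gain h" and ev: "\<forall>\<^sub>F t in at_right (0::real).
    ennreal (measure lborel S + t\<^sup>2 * (?gain h - lam * B / 2 - gap / 4))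
    \<le> hausdorff_measure DIM('b \<times> real) ((\<lambda>x. (flow t x, t * F x)) ` S)"
    using eventually_happens'[OF trivial_limit_at_right_real] by blast
  have le: "\<kappa> \<le> ?gain h - lam * B / 2 - gap / 4" using h enough by linarith
  from ev show ?thesis
  proof eventually_elim
    case (elim t)
    have "ennreal (measure lborel S + t\<^sup>2 * \<kappa>) \<le> ennreal (measure lborel S + t\<^sup>2 * (?gain h - lam * B / 2 - gap / 4))"
      using le by (intro ennreal_leI add_left_mono mult_left_mono) auto
    also note elim
    finally show ?case .
  qed
qed

end

section \<open>From the extended function to the theorem\<close>

lemma cone_extension:
  fixes f :: "(real ^ 'm) \<times> real \<Rightarrow> real"
  assumes lam: "0 < lam" and f: "f \<in> Lipschitz_compact lam"
  defines "F \<equiv> \<lambda>x. f (fst x, max (snd x) (lam * norm (fst x)))"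
  obtains L M T where "flow_data lam L M T F" "\<And>x. x \<in> spt lam f \<Longrightarrow> norm x < T"
proof -
  let ?C = "closure (Sigma_cone lam) :: ((real ^ 'm) \<times> real) set"
  have C: "x \<in> ?C \<longleftrightarrow> lam * norm (fst x) \<le> snd x" for x
    by (cases x) (simp add: closure_Sigma_cone_eq)
  obtain L0 where L0: "L0-lipschitz_on ?C f" and comp: "compact (spt lam f)"
    using f by (auto simp: Lipschitz_compact_def)
  have zero: "f x = 0" if "x \<in> ?C" "x \<notin> spt lam f" for x
    using that closure_subset[of "{x \<in> ?C. f x \<noteq> 0}"] by (auto simp: spt_def)
  have sptC: "spt lam f \<subseteq> ?C" unfolding spt_def by (rule closure_minimal) auto
  obtain T where T: "0 < T" "\<And>x. x \<in> spt lam f \<Longrightarrow> norm x < T"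
    using bounded_pos_less compact_imp_bounded[OF comp] by metis
  have "bounded (f ` spt lam f)"
    using lipschitz_on_continuous_on[OF L0] sptC comp
    by (intro compact_imp_bounded compact_continuous_image) (auto intro: continuous_on_subset)
  then obtain M0 where M0: "0 < M0" "\<And>x. x \<in> spt lam f \<Longrightarrow> \<bar>f x\<bar> \<le> M0"
    unfolding bounded_pos by auto
  \<comment> \<open>A retraction onto the closed cone that raises the points below it vertically;
    its Lipschitz constant \<open>lam + 2\<close> passes to \<open>F\<close>.\<close>
  define \<pi> where "\<pi> x = (fst x, max (snd x) (lam * norm (fst x)))" for x :: "(real ^ 'm) \<times> real"
  have \<pi>C: "\<pi> x \<in> ?C" for x by (simp add: \<pi>_def C)
  have F: "F x = f (\<pi> x)" for x by (simp add: F_def \<pi>_def)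
  have "flow_data lam ((lam + 2) * L0) M0 T F"
  proof
    show "0 < lam" "0 < T" by (fact lam, fact T(1))
    show "((lam + 2) * L0)-lipschitz_on UNIV F"
    proof (rule lipschitz_onI)
      fix x y :: "(real ^ 'm) \<times> real"
      have "\<bar>max (snd x) (lam * norm (fst x)) - max (snd y) (lam * norm (fst y))\<bar>
          \<le> \<bar>snd x - snd y\<bar> + \<bar>lam * norm (fst x) - lam * norm (fst y)\<bar>" by linarith
      also have "\<bar>lam * norm (fst x) - lam * norm (fst y)\<bar> = lam * \<bar>norm (fst x) - norm (fst y)\<bar>"
        using lam by (simp add: right_diff_distrib[symmetric] abs_mult)
      also have "\<dots> \<le> lam * dist (fst x) (fst y)"
        unfolding dist_norm using lam by (intro mult_left_mono norm_triangle_ineq3) auto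
      finally have "dist (\<pi> x) (\<pi> y) \<le> dist (fst x) (fst y) + (dist (snd x) (snd y) + lam * dist (fst x) (fst y))"
        unfolding \<pi>_def by (intro order_trans[OF dist_Pair_le] add_left_mono) (simp add: dist_real_def)
      also have "\<dots> \<le> dist x y + (dist x y + lam * dist x y)"
        using lam by (intro add_mono mult_left_mono dist_fst_le dist_snd_le) auto
      finally have "dist (\<pi> x) (\<pi> y) \<le> (lam + 2) * dist x y" by (simp add: algebra_simps)
      then have "L0 * dist (\<pi> x) (\<pi> y) \<le> L0 * ((lam + 2) * dist x y)"
        using lipschitz_on_nonneg[OF L0] by (rule mult_left_mono)
      moreover have "dist (F x) (F y) \<le> L0 * dist (\<pi> x) (\<pi> y)"
        unfolding F by (rule lipschitz_onD[OF L0 \<pi>C \<pi>C])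
      ultimately show "dist (F x) (F y) \<le> (lam + 2) * L0 * dist x y" by (simp add: mult_ac)
    qed (use lam lipschitz_on_nonneg[OF L0] in auto)
    show "\<bar>F x\<bar> \<le> M0" for x
      using M0 zero[OF \<pi>C, of x] unfolding F by (cases "\<pi> x \<in> spt lam f") auto
    show "F x = 0" if "lam * norm (fst x) \<le> snd x" "T \<le> norm x" for x
    proof -
      have "\<pi> x = x" using that(1) by (simp add: \<pi>_def max_def prod_eq_iff)
      moreover have "x \<notin> spt lam f" using T(2)[of x] that(2) by auto
      ultimately show ?thesis using zero[OF \<pi>C, of x] unfolding F by simp
    qed
    show "F (y, z) = F (y, lam * norm y)" if "z \<le> lam * norm y" for y z
      using that by (simp add: F_def max_def)
  qed
  then show thesis using T(2) by (rule that)
qed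

text \<open>\<open>F\<close> agrees with \<open>f\<close> on the closed cone, so its flow moves the
  support exactly as \<open>Phi\<close> does. One and the same number bounds the area at time zero
  from above and is the leading term of the lower bound at time \<open>t\<close>, so it cancels in
  the difference quotient.\<close>

lemma area_growth:
  fixes f :: "(real ^ 'm) \<times> real \<Rightarrow> real"
  assumes m: "2 \<le> CARD('m)" and lam_pos: "0 < lam" and lam_small: "lam \<le> 1 / 6"
    and \<epsilon>: "0 < \<epsilon>" "\<epsilon> * (hardy_const + 3)\<^sup>2 \<le> 1 / 2" and lam_le: "lam \<le> \<epsilon> / (2 * (real CARD('m) + 1))"
    and f: "f \<in> Lipschitz_compact lam"
  obtains \<kappa> where "0 \<le> \<kappa>" "(\<exists>x \<in> closure (Sigma_cone lam). f x \<noteq> 0) \<Longrightarrow> 0 < \<kappa>"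
    "\<And>c. c < \<kappa> \<Longrightarrow> \<forall>\<^sub>F t in at_right 0.
      ennreal (measure lborel (Sigma_cone lam \<inter> spt lam f) + t\<^sup>2 * c) \<le> area lam f t"
    "area lam f 0 \<le> ennreal (measure lborel (Sigma_cone lam \<inter> spt lam f))"
proof -
  define F where "F x = f (fst x, max (snd x) (lam * norm (fst x)))" for x :: "(real ^ 'm) \<times> real"
  obtain L M T where fd: "flow_data lam L M T F" and spt_T: "\<And>x. x \<in> spt lam f \<Longrightarrow> norm x < T"
    using cone_extension[OF lam_pos f] unfolding F_def by blast
  interpret flow_data lam L M T F by (rule fd)
  let ?S = "Sigma_cone lam \<inter> spt lam f"
  let ?n = "real CARD('m) + 1"
  have dim: "2 \<le> DIM(real ^ 'm)" using m by simp
  have DIM: "DIM((real ^ 'm) \<times> real) = CARD('m) + 1" by simp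
  have Fin: "F x = f x" if "lam * norm (fst x) \<le> snd x" for x
    using that by (simp add: F_def max_def)
  have Sig: "x \<in> Sigma_cone lam \<longleftrightarrow> lam * norm (fst x) < snd x" for x :: "(real ^ 'm) \<times> real"
    by (cases x) (simp add: Sigma_cone_eq)
  have C: "x \<in> closure (Sigma_cone lam) \<longleftrightarrow> lam * norm (fst x) \<le> snd x" for x :: "(real ^ 'm) \<times> real"
    by (cases x) (simp add: closure_Sigma_cone_eq)
  have SW: "?S \<subseteq> W"
  proof
    fix x assume x: "x \<in> ?S"
    then have "norm x < T" by (intro spt_T) simp
    then have "snd x < T" using norm_snd_le[of "snd x" "fst x"] by simp
    then show "x \<in> W" using x by (simp add: W_def Sig)
  qed
  have "Sigma_cone lam = {x :: (real ^ 'm) \<times> real. lam * norm (fst x) < snd x}" using Sig by blast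
  then have "open (Sigma_cone lam :: ((real ^ 'm) \<times> real) set)"
    by (simp only:) (intro open_Collect_less continuous_intros)
  moreover have "closed (spt lam f)" by (simp add: spt_def)
  ultimately have Sb: "?S \<in> sets borel" by (intro sets.Int borel_open borel_closed)
  have S0: "F x = 0" if "x \<in> W" "x \<notin> ?S" for x
  proof -
    have x: "x \<in> Sigma_cone lam" "lam * norm (fst x) \<le> snd x" using that(1) by (auto simp: W_def Sig)
    then have "x \<notin> spt lam f" using that(2) by blast
    then have "f x = 0" using x(2) closure_subset[of "{x \<in> closure (Sigma_cone lam). f x \<noteq> 0}"] C[of x] by (auto simp: spt_def)
    then show ?thesis using Fin[OF x(2)] by simp
  qed
  have Phi: "Phi lam f x t = (flow t x, t * F x)" if "x \<in> ?S" for x t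
    using that Fin[of x] by (simp add: Phi_def flow_def shift_def Sig power_mult_distrib algebra_simps)
  have area: "area lam f t = hausdorff_measure DIM((real ^ 'm) \<times> real) ((\<lambda>x. (flow t x, t * F x)) ` ?S)" for t
    unfolding area_def DIM using Phi by (intro arg_cong[where f = "hausdorff_measure _"] image_cong) auto
  define \<kappa> where "\<kappa> = \<epsilon> / (4 * ?n) * mass"
  show thesis
  proof (rule that[of \<kappa>])
    show "0 \<le> \<kappa>" using \<epsilon> mass_nonneg by (simp add: \<kappa>_def)
    show "0 < \<kappa>" if nz: "\<exists>x \<in> closure (Sigma_cone lam). f x \<noteq> 0"
    proof -
      obtain x where x: "x \<in> closure (Sigma_cone lam)" "f x \<noteq> 0" using nz by blast
      have "F x \<noteq> 0" using x Fin[of x] C[of x] by simp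
      moreover have "open {x. F x \<noteq> 0}"
      proof -
        have "{x. F x \<noteq> 0} = F -` (- {0})" by auto
        then show ?thesis using F_continuous[of UNIV] by (simp only:) (rule open_vimage, auto)
      qed
      \<comment> \<open>The given nonzero value may sit on the boundary; by continuity there is also
        one inside the open cone.\<close>
      ultimately obtain z where z: "z \<in> Sigma_cone lam" "F z \<noteq> 0"
        using x(1) unfolding closure_iff_nhds_not_empty by blast
      then have "norm z < T" using far[of z] by (cases "norm z < T") (auto simp: Sig)
      then have "snd z < T" using norm_snd_le[of "snd z" "fst z"] by simp
      then have "z \<in> W" using z(1) by (simp add: W_def Sig)
      then show ?thesis using mass_pos[OF _ z(2)] \<epsilon> by (simp add: \<kappa>_def add_nonneg_pos)
    qed
    show "\<forall>\<^sub>F t in at_right 0. ennreal (measure lborel ?S + t\<^sup>2 * c) \<le> area lam f t" if c: "c < \<kappa>" for c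
      unfolding area
    proof (rule flow_area_growth[OF SW Sb S0 dim lam_small \<epsilon>])
      show "lam \<le> \<epsilon> / (2 * real DIM((real ^ 'm) \<times> real))" using lam_le by (simp add: add.commute)
      show "c < \<epsilon> / (4 * real DIM((real ^ 'm) \<times> real)) * mass" using c by (simp add: \<kappa>_def add.commute)
    qed
    have "area lam f 0 = hausdorff_measure DIM((real ^ 'm) \<times> real) ((\<lambda>x. (x, 0 :: real)) ` ?S)"
      unfolding area by (simp add: flow_def shift_def)
    also have "\<dots> \<le> hausdorff_measure DIM((real ^ 'm) \<times> real) ?S"
      by (intro hausdorff_measure_contraction) (simp add: dist_Pair_Pair)
    also have "\<dots> \<le> emeasure lborel ?S"
      using bounded_subset[OF bounded_W SW] Sb by (rule hausdorff_measure_le_lborel)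
    also have "\<dots> = ennreal (measure lborel ?S)"
      using bounded_subset[OF bounded_W SW] Sb by (intro emeasure_eq_measure2 fmeasurable_bounded_borel)
    finally show "area lam f 0 \<le> ennreal (measure lborel ?S)" .
  qed
qed

lemma lower_right_deriv_0_ge:
  assumes growth: "\<And>c. c < \<kappa> \<Longrightarrow> \<forall>\<^sub>F s in at_right 0. ennreal (a + s * c) \<le> G s"
    and G0: "G 0 \<le> ennreal a" and a: "0 \<le> a"
  shows "ereal \<kappa> \<le> lower_right_deriv_0 G"
proof (rule ereal_le_epsilon2)
  fix e :: real assume e: "0 < e"
  have "\<forall>\<^sub>F s in at_right 0. ennreal (a + s * (\<kappa> - e)) \<le> G s" using e by (intro growth) simp
  then have "\<forall>\<^sub>F s in at_right 0. ereal (\<kappa> - e) \<le> (enn2ereal (G s) - enn2ereal (G 0)) / ereal s"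
    using eventually_at_right_less[of 0]
  proof eventually_elim
    case (elim s)
    \<comment> \<open>Truncation of a negative number to zero in \<open>ennreal\<close> only
      enlarges it.\<close>
    have "ereal (a + s * (\<kappa> - e)) \<le> enn2ereal (ennreal (a + s * (\<kappa> - e)))"
      by (cases "0 \<le> a + s * (\<kappa> - e)") (auto simp: enn2ereal_ennreal ennreal_neg zero_ennreal.rep_eq)
    also have "\<dots> \<le> enn2ereal (G s)" using elim(1) by (simp add: less_eq_ennreal.rep_eq)
    finally have 1: "ereal (a + s * (\<kappa> - e)) \<le> enn2ereal (G s)" .
    have 2: "enn2ereal (G 0) \<le> ereal a"
      using G0 a by (simp add: less_eq_ennreal.rep_eq enn2ereal_ennreal)
    have "ereal (s * (\<kappa> - e)) = ereal (a + s * (\<kappa> - e)) - ereal a" by simp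
    also have "\<dots> \<le> enn2ereal (G s) - enn2ereal (G 0)" using 1 2 by (rule ereal_minus_mono)
    finally have "ereal (s * (\<kappa> - e)) / ereal s \<le> (enn2ereal (G s) - enn2ereal (G 0)) / ereal s"
      using elim(2) by (intro ereal_divide_right_mono) auto
    then show ?case using elim(2) by simp
  qed
  then have "ereal (\<kappa> - e) \<le> lower_right_deriv_0 G"
    unfolding lower_right_deriv_0_def by (rule Liminf_bounded)
  then have "ereal (\<kappa> - e) + ereal e \<le> lower_right_deriv_0 G + ereal e" by (rule add_right_mono)
  then show "ereal \<kappa> \<le> lower_right_deriv_0 G + ereal e" by simp
qed

theorem theorem3p5:
  fixes n :: nat
  assumes "n \<ge> 3" and "CARD('m::finite) = n - 1"
  shows "\<exists>lam_star > (0::real). \<forall>lam. 0 < lam \<and> lam \<le> lam_star \<longrightarrow>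
    (\<forall>f \<in> (Lipschitz_compact lam :: ((real ^ 'm) \<times> real \<Rightarrow> real) set).
        0 \<le> lower_right_deriv_0 (area_sqrt lam f) \<and>
        ((\<exists>x \<in> closure (Sigma_cone lam). f x \<noteq> 0) \<longrightarrow> 0 < lower_right_deriv_0 (area_sqrt lam f)))"
proof -
  \<comment> \<open>The largest value that \<open>total_gain\<close> admits.\<close>
  define \<epsilon> where "\<epsilon> = 1 / (2 * (hardy_const + 3)\<^sup>2)"
  have \<epsilon>: "0 < \<epsilon>" "\<epsilon> * (hardy_const + 3)\<^sup>2 \<le> 1 / 2" by (simp_all add: \<epsilon>_def hardy_const_def)
  \<comment> \<open>\<open>1 / 6\<close> serves the divergence bound and the factor
    \<open>6 / 7\<close> of the flux; the second bound keeps the loss \<open>lam * B / 2\<close>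
    below the flux share of one direction among \<open>n = CARD('m) + 1\<close>.\<close>
  define lam_star where "lam_star = min (1 / 6) (\<epsilon> / (2 * (real CARD('m) + 1)))"
  have m: "2 \<le> CARD('m)" using assms by simp
  have "0 < lam_star" using \<epsilon>(1) by (simp add: lam_star_def add_nonneg_pos)
  moreover have "0 \<le> lower_right_deriv_0 (area_sqrt lam f) \<and>
      ((\<exists>x \<in> closure (Sigma_cone lam). f x \<noteq> 0) \<longrightarrow> 0 < lower_right_deriv_0 (area_sqrt lam f))"
    if lam: "0 < lam" "lam \<le> lam_star" and f: "f \<in> Lipschitz_compact lam" for lam and f :: "(real ^ 'm) \<times> real \<Rightarrow> real"
  proof -
    let ?a = "measure lborel (Sigma_cone lam \<inter> spt lam f)"
    obtain \<kappa> where \<kappa>: "0 \<le> \<kappa>" "(\<exists>x \<in> closure (Sigma_cone lam). f x \<noteq> 0) \<Longrightarrow> 0 < \<kappa>"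
      and growth: "\<And>c. c < \<kappa> \<Longrightarrow> \<forall>\<^sub>F t in at_right 0. ennreal (?a + t\<^sup>2 * c) \<le> area lam f t"
      and a0: "area lam f 0 \<le> ennreal ?a"
      using area_growth[OF m lam(1) _ \<epsilon> _ f] lam(2) unfolding lam_star_def by auto
    have "ereal \<kappa> \<le> lower_right_deriv_0 (area_sqrt lam f)"
    proof (rule lower_right_deriv_0_ge)
      fix c assume c: "c < \<kappa>"
      \<comment> \<open>The substitution \<open>t = sqrt s\<close> turns growth of order
        \<open>t\<^sup>2\<close> into linear growth in \<open>s\<close>.\<close>
      have "(sqrt \<longlongrightarrow> sqrt 0) (at_right 0)" by (intro tendsto_intros)
      then have "filterlim sqrt (at_right 0) (at_right 0)"
        using eventually_at_right_less[of "0::real"] by (auto simp: filterlim_at elim!: eventually_mono)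
      then have "\<forall>\<^sub>F s in at_right 0. ennreal (?a + (sqrt s)\<^sup>2 * c) \<le> area lam f (sqrt s)"
        using growth[OF c] by (rule eventually_compose_filterlim[rotated])
      then show "\<forall>\<^sub>F s in at_right 0. ennreal (?a + s * c) \<le> area_sqrt lam f s"
        using eventually_at_right_less[of "0::real"] by eventually_elim (simp add: area_sqrt_def)
    qed (use a0 in \<open>simp_all add: area_sqrt_def\<close>)
    then show ?thesis using \<kappa> by (meson ereal_less(2) ereal_less_eq(5) less_le_trans order_trans)
  qed
  ultimately show ?thesis by (intro exI[of _ lam_star] conjI allI ballI impI) auto
qed

end
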